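(* For every primitive recursive function $d$, $\mathsf{RCA}_0\nvdash\mathsf{McNaughton}^-_d$, where $\mathsf{McNaughton}^-_d$ is the statement: for every nondeterministic Büchi automaton $\mathcal A$, $d(\mathcal A)$ is a deterministic parity automaton and $\forall X.(X\in\mathcal L(\mathcal A)\equiv X\in\mathcal L(d(\mathcal A)))$.
   Context: $\mathsf{RCA}_0$: second-order arithmetic with $\Delta^0_1$-comprehension and $\Sigma^0_1$-induction; automata are coded by numbers and $d$ acts on codes. Sets are read as binary relations via pairing and $X\in S^\omega$ means $X$ is the graph of a function $\mathbb N\to S$. A nondeterministic Büchi automaton (NBA) $\mathcal A=(A,Q,\delta,q_0,F)$ has $\delta\subseteq(Q\times A)\times Q$ and accepting set $F$; $X\in\mathcal L(\mathcal A)$ is the formula $X\in A^\omega\wedge\exists Y\in Q^\omega.(Y(0,q_0)\wedge\forall x.(Y(x),X(x),Y(\mathsf{s}x))\in\delta\wedge\forall x.\exists x'>x.Y(x')\in F)$. A deterministic parity automaton (DRA) $(A,Q,\delta,q_0,c)$ has total deterministic $\delta:Q\times A\to Q$ and colouring $c:Q\to\mathbb N$; writing $q_X(x)$ for the $x$-th state of its run on $X\in A^\omega$, $X\in\mathcal L(\mathcal B)$ is the formula $X\in A^\omega\wedge\forall q\in Q.((\forall x.\exists x'>x.\,q_X(x')=q\wedge\exists x.\forall x'>x.\,c(q_X(x'))\ge c(q))\supset c(q)\text{ is even})$. *)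

theory Defs
  imports Main
begin

section \<open>Second-order arithmetic\<close>

text \<open>
  The language has a number sort and a set sort.  Both kinds of variables are de Bruijn indices,
  in two independent index spaces: \<open>\<forall>\<^sub>1\<close>, \<open>\<exists>\<^sub>1\<close> bind number variables, \<open>\<forall>\<^sub>2\<close>, \<open>\<exists>\<^sub>2\<close> bind set variables.
\<close>

datatype tm =
    Var nat
  | Zero
  | Succ tm
  | Plus tm tm  (infixl "\<^bold>+" 65)
  | Times tm tm  (infixl "\<^bold>*" 70)

datatype fm =
    Falsum
  | Equal tm tm  (infix "\<^bold>=" 50)
  | Less tm tm  (infix "\<^bold><" 50)
  | Mem tm nat  (infix "\<^bold>\<in>" 50)
  | Conj fm fm  (infixr "\<^bold>\<and>" 35)
  | Disj fm fm  (infixr "\<^bold>\<or>" 30)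
  | Impl fm fm  (infixr "\<^bold>\<longrightarrow>" 25)
  | All1 fm  ("\<^bold>\<forall>\<^sub>1_" [40] 40)
  | Ex1 fm  ("\<^bold>\<exists>\<^sub>1_" [40] 40)
  | All2 fm  ("\<^bold>\<forall>\<^sub>2_" [40] 40)
  | Ex2 fm  ("\<^bold>\<exists>\<^sub>2_" [40] 40)

definition Neg :: "fm \<Rightarrow> fm"  ("\<^bold>\<not>_" [40] 40) where
  "(\<^bold>\<not> \<phi>) = (\<phi> \<^bold>\<longrightarrow> Falsum)"

definition Iff :: "fm \<Rightarrow> fm \<Rightarrow> fm"  (infixr "\<^bold>\<longleftrightarrow>" 25) where
  "(\<phi> \<^bold>\<longleftrightarrow> \<psi>) = ((\<phi> \<^bold>\<longrightarrow> \<psi>) \<^bold>\<and> (\<psi> \<^bold>\<longrightarrow> \<phi>))"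

definition exs :: "nat \<Rightarrow> fm \<Rightarrow> fm" where
  "exs n = Ex1 ^^ n"

primrec subst_tm :: "(nat \<Rightarrow> tm) \<Rightarrow> tm \<Rightarrow> tm" where
  "subst_tm \<sigma> (Var n) = \<sigma> n"
| "subst_tm \<sigma> Zero = Zero"
| "subst_tm \<sigma> (Succ t) = Succ (subst_tm \<sigma> t)"
| "subst_tm \<sigma> (t \<^bold>+ u) = subst_tm \<sigma> t \<^bold>+ subst_tm \<sigma> u"
| "subst_tm \<sigma> (t \<^bold>* u) = subst_tm \<sigma> t \<^bold>* subst_tm \<sigma> u"

text \<open>\<open>t \<up> k\<close> is \<open>t\<close> as it has to be written under \<open>k\<close> further number quantifiers.\<close>

definition shift :: "tm \<Rightarrow> nat \<Rightarrow> tm"  (infixl "\<up>" 90) where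
  "t \<up> k = subst_tm (\<lambda>n. Var (n + k)) t"

text \<open>Simultaneous substitution of terms for number variables and of set variables for set variables.\<close>

primrec subst :: "(nat \<Rightarrow> tm) \<Rightarrow> (nat \<Rightarrow> nat) \<Rightarrow> fm \<Rightarrow> fm" where
  "subst \<sigma> \<rho> Falsum = Falsum"
| "subst \<sigma> \<rho> (t \<^bold>= u) = (subst_tm \<sigma> t \<^bold>= subst_tm \<sigma> u)"
| "subst \<sigma> \<rho> (t \<^bold>< u) = (subst_tm \<sigma> t \<^bold>< subst_tm \<sigma> u)"
| "subst \<sigma> \<rho> (t \<^bold>\<in> X) = (subst_tm \<sigma> t \<^bold>\<in> \<rho> X)"
| "subst \<sigma> \<rho> (\<phi> \<^bold>\<and> \<psi>) = (subst \<sigma> \<rho> \<phi> \<^bold>\<and> subst \<sigma> \<rho> \<psi>)"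
| "subst \<sigma> \<rho> (\<phi> \<^bold>\<or> \<psi>) = (subst \<sigma> \<rho> \<phi> \<^bold>\<or> subst \<sigma> \<rho> \<psi>)"
| "subst \<sigma> \<rho> (\<phi> \<^bold>\<longrightarrow> \<psi>) = (subst \<sigma> \<rho> \<phi> \<^bold>\<longrightarrow> subst \<sigma> \<rho> \<psi>)"
| "subst \<sigma> \<rho> (\<^bold>\<forall>\<^sub>1 \<phi>) = (\<^bold>\<forall>\<^sub>1 (subst (case_nat (Var 0) (\<lambda>n. \<sigma> n \<up> 1)) \<rho> \<phi>))"
| "subst \<sigma> \<rho> (\<^bold>\<exists>\<^sub>1 \<phi>) = (\<^bold>\<exists>\<^sub>1 (subst (case_nat (Var 0) (\<lambda>n. \<sigma> n \<up> 1)) \<rho> \<phi>))"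
| "subst \<sigma> \<rho> (\<^bold>\<forall>\<^sub>2 \<phi>) = (\<^bold>\<forall>\<^sub>2 (subst \<sigma> (case_nat 0 (\<lambda>n. Suc (\<rho> n))) \<phi>))"
| "subst \<sigma> \<rho> (\<^bold>\<exists>\<^sub>2 \<phi>) = (\<^bold>\<exists>\<^sub>2 (subst \<sigma> (case_nat 0 (\<lambda>n. Suc (\<rho> n))) \<phi>))"

definition lift1 :: "fm \<Rightarrow> fm" where
  "lift1 \<phi> = subst (\<lambda>n. Var (Suc n)) id \<phi>"

definition lift2 :: "fm \<Rightarrow> fm" where
  "lift2 \<phi> = subst Var Suc \<phi>"

text \<open>Instantiation of the outermost bound variable of a quantifier with body \<open>\<phi>\<close>.\<close>

definition inst1 :: "fm \<Rightarrow> tm \<Rightarrow> fm" where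
  "inst1 \<phi> t = subst (case_nat t Var) id \<phi>"

definition inst2 :: "fm \<Rightarrow> nat \<Rightarrow> fm" where
  "inst2 \<phi> X = subst Var (case_nat X id) \<phi>"

text \<open>
  Classical two-sorted natural deduction with equality.  The nonlogical axioms \<open>T\<close> are not part of
  the context \<open>\<Gamma>\<close>, so that \<open>All1I\<close> and \<open>All2I\<close> may generalise their free variables: an open axiom
  counts as its universal closure.
\<close>

inductive deriv :: "fm set \<Rightarrow> fm list \<Rightarrow> fm \<Rightarrow> bool" for T :: "fm set" where
  Axiom: "\<phi> \<in> T \<Longrightarrow> deriv T \<Gamma> \<phi>"
| Assumption: "\<phi> \<in> set \<Gamma> \<Longrightarrow> deriv T \<Gamma> \<phi>"
| Contradiction: "deriv T ((\<^bold>\<not> \<phi>) # \<Gamma>) Falsum \<Longrightarrow> deriv T \<Gamma> \<phi>"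
| ConjI: "deriv T \<Gamma> \<phi> \<Longrightarrow> deriv T \<Gamma> \<psi> \<Longrightarrow> deriv T \<Gamma> (\<phi> \<^bold>\<and> \<psi>)"
| ConjE1: "deriv T \<Gamma> (\<phi> \<^bold>\<and> \<psi>) \<Longrightarrow> deriv T \<Gamma> \<phi>"
| ConjE2: "deriv T \<Gamma> (\<phi> \<^bold>\<and> \<psi>) \<Longrightarrow> deriv T \<Gamma> \<psi>"
| DisjI1: "deriv T \<Gamma> \<phi> \<Longrightarrow> deriv T \<Gamma> (\<phi> \<^bold>\<or> \<psi>)"
| DisjI2: "deriv T \<Gamma> \<psi> \<Longrightarrow> deriv T \<Gamma> (\<phi> \<^bold>\<or> \<psi>)"
| DisjE: "deriv T \<Gamma> (\<phi> \<^bold>\<or> \<psi>) \<Longrightarrow> deriv T (\<phi> # \<Gamma>) \<chi> \<Longrightarrow> deriv T (\<psi> # \<Gamma>) \<chi> \<Longrightarrow> deriv T \<Gamma> \<chi>"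
| ImplI: "deriv T (\<phi> # \<Gamma>) \<psi> \<Longrightarrow> deriv T \<Gamma> (\<phi> \<^bold>\<longrightarrow> \<psi>)"
| ImplE: "deriv T \<Gamma> (\<phi> \<^bold>\<longrightarrow> \<psi>) \<Longrightarrow> deriv T \<Gamma> \<phi> \<Longrightarrow> deriv T \<Gamma> \<psi>"
| All1I: "deriv T (map lift1 \<Gamma>) \<phi> \<Longrightarrow> deriv T \<Gamma> (\<^bold>\<forall>\<^sub>1 \<phi>)"
| All1E: "deriv T \<Gamma> (\<^bold>\<forall>\<^sub>1 \<phi>) \<Longrightarrow> deriv T \<Gamma> (inst1 \<phi> t)"
| Ex1I: "deriv T \<Gamma> (inst1 \<phi> t) \<Longrightarrow> deriv T \<Gamma> (\<^bold>\<exists>\<^sub>1 \<phi>)"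
| Ex1E: "deriv T \<Gamma> (\<^bold>\<exists>\<^sub>1 \<phi>) \<Longrightarrow> deriv T (\<phi> # map lift1 \<Gamma>) (lift1 \<psi>) \<Longrightarrow> deriv T \<Gamma> \<psi>"
| All2I: "deriv T (map lift2 \<Gamma>) \<phi> \<Longrightarrow> deriv T \<Gamma> (\<^bold>\<forall>\<^sub>2 \<phi>)"
| All2E: "deriv T \<Gamma> (\<^bold>\<forall>\<^sub>2 \<phi>) \<Longrightarrow> deriv T \<Gamma> (inst2 \<phi> X)"
| Ex2I: "deriv T \<Gamma> (inst2 \<phi> X) \<Longrightarrow> deriv T \<Gamma> (\<^bold>\<exists>\<^sub>2 \<phi>)"
| Ex2E: "deriv T \<Gamma> (\<^bold>\<exists>\<^sub>2 \<phi>) \<Longrightarrow> deriv T (\<phi> # map lift2 \<Gamma>) (lift2 \<psi>) \<Longrightarrow> deriv T \<Gamma> \<psi>"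
| Refl: "deriv T \<Gamma> (t \<^bold>= t)"
| Leibniz: "deriv T \<Gamma> (t \<^bold>= u) \<Longrightarrow> deriv T \<Gamma> (inst1 \<phi> t) \<Longrightarrow> deriv T \<Gamma> (inst1 \<phi> u)"

definition provable :: "fm set \<Rightarrow> fm \<Rightarrow> bool"  (infix "\<turnstile>" 50) where
  "T \<turnstile> \<phi> \<longleftrightarrow> deriv T [] \<phi>"


section \<open>The theory RCA0\<close>

definition basic_axioms :: "fm set" where
  "basic_axioms =
    { \<^bold>\<not> (Succ (Var 0) \<^bold>= Zero),
      (Succ (Var 0) \<^bold>= Succ (Var 1)) \<^bold>\<longrightarrow> (Var 0 \<^bold>= Var 1),
      Var 0 \<^bold>+ Zero \<^bold>= Var 0,
      Var 0 \<^bold>+ Succ (Var 1) \<^bold>= Succ (Var 0 \<^bold>+ Var 1),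
      Var 0 \<^bold>* Zero \<^bold>= Zero,
      Var 0 \<^bold>* Succ (Var 1) \<^bold>= Var 0 \<^bold>* Var 1 \<^bold>+ Var 0,
      \<^bold>\<not> (Var 0 \<^bold>< Zero),
      (Var 0 \<^bold>< Succ (Var 1)) \<^bold>\<longleftrightarrow> ((Var 0 \<^bold>< Var 1) \<^bold>\<or> (Var 0 \<^bold>= Var 1)) }"

text \<open>
  The bound \<open>t\<close> of a bounded quantifier does not contain the quantified variable; set parameters are
  allowed.
\<close>

inductive delta0 :: "fm \<Rightarrow> bool" where
  "delta0 Falsum"
| "delta0 (t \<^bold>= u)"
| "delta0 (t \<^bold>< u)"
| "delta0 (t \<^bold>\<in> X)"
| "delta0 \<phi> \<Longrightarrow> delta0 \<psi> \<Longrightarrow> delta0 (\<phi> \<^bold>\<and> \<psi>)"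
| "delta0 \<phi> \<Longrightarrow> delta0 \<psi> \<Longrightarrow> delta0 (\<phi> \<^bold>\<or> \<psi>)"
| "delta0 \<phi> \<Longrightarrow> delta0 \<psi> \<Longrightarrow> delta0 (\<phi> \<^bold>\<longrightarrow> \<psi>)"
| "delta0 \<phi> \<Longrightarrow> delta0 (\<^bold>\<forall>\<^sub>1 ((Var 0 \<^bold>< t \<up> 1) \<^bold>\<longrightarrow> \<phi>))"
| "delta0 \<phi> \<Longrightarrow> delta0 (\<^bold>\<exists>\<^sub>1 ((Var 0 \<^bold>< t \<up> 1) \<^bold>\<and> \<phi>))"

definition sigma1 :: "fm \<Rightarrow> bool" where
  "sigma1 \<phi> \<longleftrightarrow> (\<exists>\<theta>. delta0 \<theta> \<and> \<phi> = (\<^bold>\<exists>\<^sub>1 \<theta>))"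

definition pi1 :: "fm \<Rightarrow> bool" where
  "pi1 \<phi> \<longleftrightarrow> (\<exists>\<theta>. delta0 \<theta> \<and> \<phi> = (\<^bold>\<forall>\<^sub>1 \<theta>))"

definition induction_axiom :: "fm \<Rightarrow> fm" where
  "induction_axiom \<phi> =
    (inst1 \<phi> Zero \<^bold>\<and> \<^bold>\<forall>\<^sub>1 (\<phi> \<^bold>\<longrightarrow> subst (Var(0 := Succ (Var 0))) id \<phi>) \<^bold>\<longrightarrow> \<^bold>\<forall>\<^sub>1 \<phi>)"

definition comprehension_axiom :: "fm \<Rightarrow> fm \<Rightarrow> fm" where
  "comprehension_axiom \<phi> \<psi> =
    (\<^bold>\<forall>\<^sub>1 (\<phi> \<^bold>\<longleftrightarrow> \<psi>) \<^bold>\<longrightarrow> \<^bold>\<exists>\<^sub>2 (\<^bold>\<forall>\<^sub>1 ((Var 0 \<^bold>\<in> 0) \<^bold>\<longleftrightarrow> lift2 \<phi>)))"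

definition RCA0 :: "fm set" where
  "RCA0 = basic_axioms \<union> {induction_axiom \<phi> |\<phi>. sigma1 \<phi>}
     \<union> {comprehension_axiom \<phi> \<psi> |\<phi> \<psi>. sigma1 \<phi> \<and> pi1 \<psi>}"


section \<open>Coding in second-order arithmetic\<close>

text \<open>The injective (not surjective) pairing \<open>(x + y)\<^sup>2 + x\<close>.\<close>

definition pair :: "tm \<Rightarrow> tm \<Rightarrow> tm"  ("\<langle>_,/ _\<rangle>") where
  "\<langle>s, t\<rangle> = (s \<^bold>+ t) \<^bold>* (s \<^bold>+ t) \<^bold>+ s"

text \<open>The set \<open>X\<close> read as a binary relation.\<close>

definition rel :: "nat \<Rightarrow> tm \<Rightarrow> tm \<Rightarrow> fm" where
  "rel X s t = (\<langle>s, t\<rangle> \<^bold>\<in> X)"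

text \<open>Goedel's beta function: \<open>y\<close> is the remainder of \<open>c\<close> modulo \<open>1 + m (i + 1)\<close>.\<close>

definition beta :: "tm \<Rightarrow> tm \<Rightarrow> tm \<Rightarrow> tm \<Rightarrow> fm" where
  "beta c m i y = (let b = Succ (m \<^bold>* Succ i) in
     (y \<^bold>< b) \<^bold>\<and> \<^bold>\<exists>\<^sub>1 (c\<up>1 \<^bold>= Var 0 \<^bold>* b\<up>1 \<^bold>+ y\<up>1))"

text \<open>
  Finite sets of numbers: \<open>\<langle>k, \<langle>c, m\<rangle>\<rangle>\<close> codes the set of all \<open>i < k\<close> such that \<open>1 + m (i + 1)\<close> divides
  \<open>c\<close>.  A set has many codes, and numbers not of this form code the empty set.
\<close>

definition code_mem :: "tm \<Rightarrow> tm \<Rightarrow> fm"  (infix "\<epsilon>" 50) where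
  "(t \<epsilon> s) = exs 3 ((s\<up>3 \<^bold>= \<langle>Var 2, \<langle>Var 1, Var 0\<rangle>\<rangle>) \<^bold>\<and> (t\<up>3 \<^bold>< Var 2)
     \<^bold>\<and> beta (Var 1) (Var 0) (t\<up>3) Zero)"

text \<open>\<open>X \<in> S\<^sup>\<omega>\<close>: the relation \<open>X\<close> is the graph of a function from the numbers to the finite set \<open>S\<close>.\<close>

definition omega_word :: "nat \<Rightarrow> tm \<Rightarrow> fm" where
  "omega_word X S = (\<^bold>\<forall>\<^sub>1 (\<^bold>\<exists>\<^sub>1 ((Var 0 \<epsilon> S\<up>2) \<^bold>\<and>
     \<^bold>\<forall>\<^sub>1 (rel X (Var 2) (Var 0) \<^bold>\<longleftrightarrow> (Var 0 \<^bold>= Var 1)))))"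


section \<open>Primitive recursive functions\<close>

text \<open>
  Definitions of primitive recursive functions:
  \<open>PRec f g\<close> defines \<open>h\<close> with \<open>h(0, xs) = f(xs)\<close> and \<open>h(n + 1, xs) = g(n, h(n, xs), xs)\<close>.
\<close>

datatype primrec_def =
    PZero
  | PSucc
  | PProj nat
  | PComp primrec_def "primrec_def list"
  | PRec primrec_def primrec_def

inductive has_arity :: "primrec_def \<Rightarrow> nat \<Rightarrow> bool" where
  "has_arity PZero n"
| "has_arity PSucc 1"
| "i < n \<Longrightarrow> has_arity (PProj i) n"
| "has_arity f (length gs) \<Longrightarrow> \<forall>g \<in> set gs. has_arity g n \<Longrightarrow> has_arity (PComp f gs) n"
| "has_arity f n \<Longrightarrow> has_arity g (n + 2) \<Longrightarrow> has_arity (PRec f g) (n + 1)"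

text \<open>
  \<open>graph d ts y\<close> is the canonical formula saying that the function defined by \<open>d\<close> maps \<open>ts\<close> to \<open>y\<close>;
  primitive recursion is expressed by a beta-coded sequence of the values \<open>h(0, xs), \<dots>, h(n, xs)\<close>.
\<close>

primrec graph :: "primrec_def \<Rightarrow> tm list \<Rightarrow> tm \<Rightarrow> fm" where
  "graph PZero = (\<lambda>ts y. y \<^bold>= Zero)"
| "graph PSucc = (\<lambda>ts y. y \<^bold>= Succ (hd ts))"
| "graph (PProj i) = (\<lambda>ts y. y \<^bold>= ts ! i)"
| "graph (PComp f gs) = (\<lambda>ts y. let k = length gs in
     exs k (foldr Conj (map2 (\<lambda>G j. G (map (\<lambda>t. t\<up>k) ts) (Var j)) (map graph gs) [0..<k])
       (graph f (map Var [0..<k]) (y\<up>k))))"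
| "graph (PRec f g) = (\<lambda>ts y. let n = hd ts; xs = tl ts in
     exs 2 (
       \<^bold>\<exists>\<^sub>1 (beta (Var 2) (Var 1) Zero (Var 0) \<^bold>\<and> graph f (map (\<lambda>t. t\<up>3) xs) (Var 0))
       \<^bold>\<and> \<^bold>\<forall>\<^sub>1 ((Var 0 \<^bold>< n\<up>3) \<^bold>\<longrightarrow> exs 2 (
            beta (Var 4) (Var 3) (Var 2) (Var 1)
            \<^bold>\<and> beta (Var 4) (Var 3) (Succ (Var 2)) (Var 0)
            \<^bold>\<and> graph g (Var 2 # Var 1 # map (\<lambda>t. t\<up>5) xs) (Var 0)))
       \<^bold>\<and> beta (Var 1) (Var 0) (n\<up>2) (y\<up>2)))"


section \<open>Automata\<close>

text \<open>
  An automaton is coded by the nested pair of its five components; a transition from \<open>q\<close> to \<open>r\<close>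
  reading \<open>a\<close> is coded by \<open>\<langle>\<langle>q, a\<rangle>, r\<rangle>\<close>.
\<close>

definition tuple5 :: "tm \<Rightarrow> tm \<Rightarrow> tm \<Rightarrow> tm \<Rightarrow> tm \<Rightarrow> tm" where
  "tuple5 A Q \<delta> q0 F = \<langle>A, \<langle>Q, \<langle>\<delta>, \<langle>q0, F\<rangle>\<rangle>\<rangle>\<rangle>"

definition transitions :: "tm \<Rightarrow> tm \<Rightarrow> tm \<Rightarrow> fm" where
  "transitions A Q \<delta> = (\<^bold>\<forall>\<^sub>1 ((Var 0 \<epsilon> \<delta>\<up>1) \<^bold>\<longrightarrow>
     exs 3 ((Var 2 \<epsilon> Q\<up>4) \<^bold>\<and> (Var 1 \<epsilon> A\<up>4) \<^bold>\<and> (Var 0 \<epsilon> Q\<up>4)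
       \<^bold>\<and> (Var 3 \<^bold>= \<langle>\<langle>Var 2, Var 1\<rangle>, Var 0\<rangle>))))"

definition deterministic :: "tm \<Rightarrow> tm \<Rightarrow> tm \<Rightarrow> fm" where
  "deterministic A Q \<delta> = (\<^bold>\<forall>\<^sub>1 ((Var 0 \<epsilon> Q\<up>1) \<^bold>\<longrightarrow> \<^bold>\<forall>\<^sub>1 ((Var 0 \<epsilon> A\<up>2) \<^bold>\<longrightarrow>
     \<^bold>\<exists>\<^sub>1 (\<^bold>\<forall>\<^sub>1 ((\<langle>\<langle>Var 3, Var 2\<rangle>, Var 0\<rangle> \<epsilon> \<delta>\<up>4) \<^bold>\<longleftrightarrow> (Var 0 \<^bold>= Var 1))))))"

definition colouring :: "tm \<Rightarrow> tm \<Rightarrow> fm" where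
  "colouring Q c =
    (\<^bold>\<forall>\<^sub>1 ((Var 0 \<epsilon> c\<up>1) \<^bold>\<longrightarrow> exs 2 ((Var 1 \<epsilon> Q\<up>3) \<^bold>\<and> (Var 2 \<^bold>= \<langle>Var 1, Var 0\<rangle>)))
     \<^bold>\<and> \<^bold>\<forall>\<^sub>1 ((Var 0 \<epsilon> Q\<up>1) \<^bold>\<longrightarrow>
          \<^bold>\<exists>\<^sub>1 (\<^bold>\<forall>\<^sub>1 ((\<langle>Var 2, Var 0\<rangle> \<epsilon> c\<up>3) \<^bold>\<longleftrightarrow> (Var 0 \<^bold>= Var 1)))))"

definition is_NBA :: "tm \<Rightarrow> fm" where
  "is_NBA a = exs 5 (let A = Var 4; Q = Var 3; \<delta> = Var 2; q0 = Var 1; F = Var 0 in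
     (a\<up>5 \<^bold>= tuple5 A Q \<delta> q0 F) \<^bold>\<and> transitions A Q \<delta> \<^bold>\<and> (q0 \<epsilon> Q)
     \<^bold>\<and> \<^bold>\<forall>\<^sub>1 ((Var 0 \<epsilon> F\<up>1) \<^bold>\<longrightarrow> (Var 0 \<epsilon> Q\<up>1)))"

definition is_DPA :: "tm \<Rightarrow> fm" where
  "is_DPA b = exs 5 (let A = Var 4; Q = Var 3; \<delta> = Var 2; q0 = Var 1; c = Var 0 in
     (b\<up>5 \<^bold>= tuple5 A Q \<delta> q0 c) \<^bold>\<and> transitions A Q \<delta> \<^bold>\<and> deterministic A Q \<delta> \<^bold>\<and> (q0 \<epsilon> Q)
     \<^bold>\<and> colouring Q c)"

text \<open>Below \<open>\<^bold>\<exists>\<^sub>2\<close>, the run \<open>Y\<close> is the set variable \<open>0\<close> and the word \<open>X\<close> is \<open>Suc X\<close>.\<close>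

definition NBA_accepts :: "nat \<Rightarrow> tm \<Rightarrow> fm" where
  "NBA_accepts X a = exs 5 (let A = Var 4; Q = Var 3; \<delta> = Var 2; q0 = Var 1; F = Var 0 in
     (a\<up>5 \<^bold>= tuple5 A Q \<delta> q0 F) \<^bold>\<and> omega_word X A \<^bold>\<and>
     \<^bold>\<exists>\<^sub>2 (
       omega_word 0 Q
       \<^bold>\<and> rel 0 Zero q0
       \<^bold>\<and> \<^bold>\<forall>\<^sub>1 (exs 3 (rel 0 (Var 3) (Var 2) \<^bold>\<and> rel (Suc X) (Var 3) (Var 1)
            \<^bold>\<and> rel 0 (Succ (Var 3)) (Var 0) \<^bold>\<and> (\<langle>\<langle>Var 2, Var 1\<rangle>, Var 0\<rangle> \<epsilon> \<delta>\<up>4)))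
       \<^bold>\<and> \<^bold>\<forall>\<^sub>1 (\<^bold>\<exists>\<^sub>1 ((Var 1 \<^bold>< Var 0) \<^bold>\<and> \<^bold>\<exists>\<^sub>1 (rel 0 (Var 1) (Var 0) \<^bold>\<and> (Var 0 \<epsilon> F\<up>3))))))"

text \<open>
  \<open>q\<^sub>X(x) = q\<close> for the deterministic \<open>\<delta>\<close> with initial state \<open>q0\<close>: there is a beta-coded sequence of
  states starting in \<open>q0\<close>, obeying \<open>\<delta>\<close> up to position \<open>x\<close>, and having \<open>q\<close> at position \<open>x\<close>.
\<close>

definition run_state :: "nat \<Rightarrow> tm \<Rightarrow> tm \<Rightarrow> tm \<Rightarrow> tm \<Rightarrow> fm" where
  "run_state X \<delta> q0 x q = exs 2 (
     beta (Var 1) (Var 0) Zero (q0\<up>2)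
     \<^bold>\<and> \<^bold>\<forall>\<^sub>1 ((Var 0 \<^bold>< x\<up>3) \<^bold>\<longrightarrow> exs 3 (
          beta (Var 5) (Var 4) (Var 3) (Var 2) \<^bold>\<and> rel X (Var 3) (Var 1)
          \<^bold>\<and> beta (Var 5) (Var 4) (Succ (Var 3)) (Var 0)
          \<^bold>\<and> (\<langle>\<langle>Var 2, Var 1\<rangle>, Var 0\<rangle> \<epsilon> \<delta>\<up>6)))
     \<^bold>\<and> beta (Var 1) (Var 0) (x\<up>2) (q\<up>2))"

definition DPA_accepts :: "nat \<Rightarrow> tm \<Rightarrow> fm" where
  "DPA_accepts X b = exs 5 (let A = Var 4; Q = Var 3; \<delta> = Var 2; q0 = Var 1; c = Var 0 in
     (b\<up>5 \<^bold>= tuple5 A Q \<delta> q0 c) \<^bold>\<and> omega_word X A \<^bold>\<and>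
     \<^bold>\<forall>\<^sub>1 ((Var 0 \<epsilon> Q\<up>1) \<^bold>\<longrightarrow>
       \<^bold>\<forall>\<^sub>1 (\<^bold>\<exists>\<^sub>1 ((Var 1 \<^bold>< Var 0) \<^bold>\<and> run_state X (\<delta>\<up>3) (q0\<up>3) (Var 0) (Var 2)))
       \<^bold>\<and> \<^bold>\<exists>\<^sub>1 (\<^bold>\<forall>\<^sub>1 ((Var 1 \<^bold>< Var 0) \<^bold>\<longrightarrow> exs 3 (
            run_state X (\<delta>\<up>6) (q0\<up>6) (Var 3) (Var 2)
            \<^bold>\<and> (\<langle>Var 2, Var 1\<rangle> \<epsilon> c\<up>6) \<^bold>\<and> (\<langle>Var 5, Var 0\<rangle> \<epsilon> c\<up>6)
            \<^bold>\<and> ((Var 0 \<^bold>< Var 1) \<^bold>\<or> (Var 0 \<^bold>= Var 1)))))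
       \<^bold>\<longrightarrow> \<^bold>\<exists>\<^sub>1 ((\<langle>Var 1, Var 0\<rangle> \<epsilon> c\<up>2) \<^bold>\<and> \<^bold>\<exists>\<^sub>1 (Var 1 \<^bold>= Var 0 \<^bold>+ Var 0))))"

definition McNaughton_minus :: "primrec_def \<Rightarrow> fm" where
  "McNaughton_minus d = (\<^bold>\<forall>\<^sub>1 (is_NBA (Var 0) \<^bold>\<longrightarrow>
     \<^bold>\<exists>\<^sub>1 (graph d [Var 1] (Var 0) \<^bold>\<and> is_DPA (Var 0)
       \<^bold>\<and> \<^bold>\<forall>\<^sub>2 (NBA_accepts 0 (Var 1) \<^bold>\<longleftrightarrow> DPA_accepts 0 (Var 0)))))"

end

theory Submission
  imports Defs "HOL-Number_Theory.Cong" "HOL-Library.Countable_Set"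
begin

text \<open>
  \<open>McNaughton_minus d\<close> fails for every \<open>d\<close> in a single model of \<open>RCA0\<close>, whose numbers form a cut \<open>K\<close> in
  an ultrapower of the naturals and whose sets are the traces of internal sets on \<open>K\<close>.  The cut is
  generic: no internal function on a bounded set is cofinal in \<open>K\<close>, which yields \<open>\<Sigma>\<^sub>1\<close>-induction, but
  there is an internal colouring of \<open>K\<close> with a bounded (nonstandard) number of colours each of which
  occurs only boundedly often.  Read as a word, this colouring is rejected by the Buechi automaton
  for ``some letter occurs infinitely often''.  An equivalent parity automaton rejects it too, hence
  some state of odd colour recurs and is eventually minimal.  Looping the word between two visits of
  that state gives an ultimately periodic word with the same verdict, but the Buechi automaton accepts
  every ultimately periodic word.
\<close>

section \<open>Semantics\<close>

text \<open>The gap exploited is that between Sigma_1-induction and the infinite pigeonhole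
  principle, which amounts to Sigma_2-bounding: a number of classes that is bounded in the cut may
  be nonstandard, so all classes can be bounded although their union is not. The same can happen to
  the states of a parity automaton. Its acceptance condition is universal over recurring states and
  may hold vacuously, which says nothing about the run. Rejection is existential and hands over a
  recurring state; therefore the argument starts from a word that the Buechi automaton rejects.
  Rejection survives the looping because every state met inside the loop was already met beyond the
  point where the colour becomes minimal. In the construction two demands compete: every small
  internal set has to miss an interval around the end of the cut, and every colour has to vanish
  from such an interval. Each level costs one colour, so \<open>m\<close> levels require
  \<open>m + 1\<close> colours. At index \<open>n\<close> both the number of levels and the left end
  point start as \<open>n\<close>: every standard stage is then available at almost all indices,
  while \<open>n\<close> itself belongs to the cut.\<close>

primrec val :: "(nat \<Rightarrow> nat) \<Rightarrow> tm \<Rightarrow> nat" where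
  "val e (Var i) = e i"
| "val e Zero = 0"
| "val e (Succ t) = Suc (val e t)"
| "val e (t \<^bold>+ u) = val e t + val e u"
| "val e (t \<^bold>* u) = val e t * val e u"

primrec holds :: "(nat \<Rightarrow> nat) \<Rightarrow> (nat \<Rightarrow> nat set) \<Rightarrow> fm \<Rightarrow> bool" where
  "holds e S Falsum \<longleftrightarrow> False"
| "holds e S (t \<^bold>= u) \<longleftrightarrow> val e t = val e u"
| "holds e S (t \<^bold>< u) \<longleftrightarrow> val e t < val e u"
| "holds e S (t \<^bold>\<in> X) \<longleftrightarrow> val e t \<in> S X"
| "holds e S (\<phi> \<^bold>\<and> \<psi>) \<longleftrightarrow> holds e S \<phi> \<and> holds e S \<psi>"
| "holds e S (\<phi> \<^bold>\<or> \<psi>) \<longleftrightarrow> holds e S \<phi> \<or> holds e S \<psi>"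
| "holds e S (\<phi> \<^bold>\<longrightarrow> \<psi>) \<longleftrightarrow> (holds e S \<phi> \<longrightarrow> holds e S \<psi>)"
| "holds e S (\<^bold>\<forall>\<^sub>1 \<phi>) \<longleftrightarrow> (\<forall>x. holds (case_nat x e) S \<phi>)"
| "holds e S (\<^bold>\<exists>\<^sub>1 \<phi>) \<longleftrightarrow> (\<exists>x. holds (case_nat x e) S \<phi>)"
| "holds e S (\<^bold>\<forall>\<^sub>2 \<phi>) \<longleftrightarrow> (\<forall>X. holds e (case_nat X S) \<phi>)"
| "holds e S (\<^bold>\<exists>\<^sub>2 \<phi>) \<longleftrightarrow> (\<exists>X. holds e (case_nat X S) \<phi>)"

lemma val_shift: "val e (t \<up> k) = val (\<lambda>i. e (i + k)) t"
  unfolding shift_def by (induction t) auto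

lemma val_subst: "val e (subst_tm \<sigma> t) = val (\<lambda>i. val e (\<sigma> i)) t"
  by (induction t) auto

section \<open>Dependence of truth on finitely many variables\<close>

definition agree :: "nat \<Rightarrow> (nat \<Rightarrow> 'a) \<Rightarrow> (nat \<Rightarrow> 'a) \<Rightarrow> bool" where
  "agree N e e' \<longleftrightarrow> (\<forall>i<N. e i = e' i)"

lemma agree_mono: "agree N e e' \<Longrightarrow> M \<le> N \<Longrightarrow> agree M e e'"
  by (auto simp: agree_def)

lemma agree_case_nat: "agree N e e' \<Longrightarrow> agree N (case_nat x e) (case_nat x e')"
  by (auto simp: agree_def split: nat.splits)

lemma val_finite_support: "\<exists>N. \<forall>e e'. agree N e e' \<longrightarrow> val e t = val e' t"
proof (induction t)
  case (Var x)
  show ?case by (rule exI[of _ "Suc x"]) (auto simp: agree_def)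
next
  case (Plus t u)
  then obtain N M where "\<forall>e e'. agree N e e' \<longrightarrow> val e t = val e' t"
    "\<forall>e e'. agree M e e' \<longrightarrow> val e u = val e' u" by blast
  then show ?case
    by (intro exI[of _ "max N M"]) (metis agree_mono val.simps(4) max.cobounded1 max.cobounded2)
next
  case (Times t u)
  then obtain N M where "\<forall>e e'. agree N e e' \<longrightarrow> val e t = val e' t"
    "\<forall>e e'. agree M e e' \<longrightarrow> val e u = val e' u" by blast
  then show ?case
    by (intro exI[of _ "max N M"]) (metis agree_mono val.simps(5) max.cobounded1 max.cobounded2)
qed auto

lemma holds_finite_support:
  "\<exists>N. \<forall>e e' S S'. agree N e e' \<longrightarrow> agree N S S' \<longrightarrow> holds e S \<phi> = holds e' S' \<phi>"
proof (induction \<phi>)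
  case (Equal t u)
  obtain N M where "\<forall>e e'. agree N e e' \<longrightarrow> val e t = val e' t"
    "\<forall>e e'. agree M e e' \<longrightarrow> val e u = val e' u"
    using val_finite_support by metis
  then show ?case
    by (intro exI[of _ "max N M"]) (metis agree_mono holds.simps(2) max.cobounded1 max.cobounded2)
next
  case (Less t u)
  obtain N M where "\<forall>e e'. agree N e e' \<longrightarrow> val e t = val e' t"
    "\<forall>e e'. agree M e e' \<longrightarrow> val e u = val e' u"
    using val_finite_support by metis
  then show ?case
    by (intro exI[of _ "max N M"]) (metis agree_mono holds.simps(3) max.cobounded1 max.cobounded2)
next
  case (Mem t X)
  obtain N where N: "\<forall>e e'. agree N e e' \<longrightarrow> val e t = val e' t"
    using val_finite_support by metis
  show ?case
  proof (intro exI[of _ "max N (Suc X)"] allI impI)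
    fix e e' :: "nat \<Rightarrow> nat" and S S' :: "nat \<Rightarrow> nat set"
    assume "agree (max N (Suc X)) e e'" "agree (max N (Suc X)) S S'"
    then have "val e t = val e' t" "S X = S' X"
      using N agree_mono[of _ e e' N] by (auto simp: agree_def)
    then show "holds e S (t \<^bold>\<in> X) = holds e' S' (t \<^bold>\<in> X)" by simp
  qed
next
  case (Conj \<phi> \<psi>)
  then obtain N M where "\<forall>e e' S S'. agree N e e' \<longrightarrow> agree N S S' \<longrightarrow> holds e S \<phi> = holds e' S' \<phi>"
    "\<forall>e e' S S'. agree M e e' \<longrightarrow> agree M S S' \<longrightarrow> holds e S \<psi> = holds e' S' \<psi>" by blast
  then show ?case
    by (intro exI[of _ "max N M"]) (metis agree_mono holds.simps(5) max.cobounded1 max.cobounded2)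
next
  case (Disj \<phi> \<psi>)
  then obtain N M where "\<forall>e e' S S'. agree N e e' \<longrightarrow> agree N S S' \<longrightarrow> holds e S \<phi> = holds e' S' \<phi>"
    "\<forall>e e' S S'. agree M e e' \<longrightarrow> agree M S S' \<longrightarrow> holds e S \<psi> = holds e' S' \<psi>" by blast
  then show ?case
    by (intro exI[of _ "max N M"]) (metis agree_mono holds.simps(6) max.cobounded1 max.cobounded2)
next
  case (Impl \<phi> \<psi>)
  then obtain N M where "\<forall>e e' S S'. agree N e e' \<longrightarrow> agree N S S' \<longrightarrow> holds e S \<phi> = holds e' S' \<phi>"
    "\<forall>e e' S S'. agree M e e' \<longrightarrow> agree M S S' \<longrightarrow> holds e S \<psi> = holds e' S' \<psi>" by blast
  then show ?case
    by (intro exI[of _ "max N M"]) (metis agree_mono holds.simps(7) max.cobounded1 max.cobounded2)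
next
  case (All1 \<phi>)
  then show ?case by (metis agree_case_nat holds.simps(8))
next
  case (Ex1 \<phi>)
  then show ?case by (metis agree_case_nat holds.simps(9))
next
  case (All2 \<phi>)
  then show ?case by (metis agree_case_nat holds.simps(10))
next
  case (Ex2 \<phi>)
  then show ?case by (metis agree_case_nat holds.simps(11))
qed auto

text \<open>
  Numbers of the model are sequences of naturals and sets are sequences of sets of naturals;
  an atomic formula is true if it is true at \<open>U\<close>-almost every index.  Equality is thus not
  identity but a congruence, which spares forming the quotient.
\<close>

definition evs :: "(nat \<Rightarrow> nat \<Rightarrow> nat) \<Rightarrow> tm \<Rightarrow> nat \<Rightarrow> nat" where
  "evs e t = (\<lambda>n. val (\<lambda>i. e i n) t)"

locale internal_model =
  fixes U :: "nat filter" and K :: "(nat \<Rightarrow> nat) set" and D :: "(nat \<Rightarrow> nat set) set"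
begin

primrec sat :: "(nat \<Rightarrow> nat \<Rightarrow> nat) \<Rightarrow> (nat \<Rightarrow> nat \<Rightarrow> nat set) \<Rightarrow> fm \<Rightarrow> bool" where
  "sat e S Falsum \<longleftrightarrow> False"
| "sat e S (t \<^bold>= u) \<longleftrightarrow> (\<forall>\<^sub>F n in U. evs e t n = evs e u n)"
| "sat e S (t \<^bold>< u) \<longleftrightarrow> (\<forall>\<^sub>F n in U. evs e t n < evs e u n)"
| "sat e S (t \<^bold>\<in> X) \<longleftrightarrow> (\<forall>\<^sub>F n in U. evs e t n \<in> S X n)"
| "sat e S (\<phi> \<^bold>\<and> \<psi>) \<longleftrightarrow> sat e S \<phi> \<and> sat e S \<psi>"
| "sat e S (\<phi> \<^bold>\<or> \<psi>) \<longleftrightarrow> sat e S \<phi> \<or> sat e S \<psi>"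
| "sat e S (\<phi> \<^bold>\<longrightarrow> \<psi>) \<longleftrightarrow> (sat e S \<phi> \<longrightarrow> sat e S \<psi>)"
| "sat e S (\<^bold>\<forall>\<^sub>1 \<phi>) \<longleftrightarrow> (\<forall>x\<in>K. sat (case_nat x e) S \<phi>)"
| "sat e S (\<^bold>\<exists>\<^sub>1 \<phi>) \<longleftrightarrow> (\<exists>x\<in>K. sat (case_nat x e) S \<phi>)"
| "sat e S (\<^bold>\<forall>\<^sub>2 \<phi>) \<longleftrightarrow> (\<forall>X\<in>D. sat e (case_nat X S) \<phi>)"
| "sat e S (\<^bold>\<exists>\<^sub>2 \<phi>) \<longleftrightarrow> (\<exists>X\<in>D. sat e (case_nat X S) \<phi>)"

end

lemma evs_simps [simp]:
  "evs e (Var i) = e i" "evs e Zero = (\<lambda>n. 0)" "evs e (Succ t) = (\<lambda>n. Suc (evs e t n))"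
  "evs e (t \<^bold>+ u) = (\<lambda>n. evs e t n + evs e u n)" "evs e (t \<^bold>* u) = (\<lambda>n. evs e t n * evs e u n)"
  by (auto simp: evs_def)

lemma evs_shift: "evs e (t \<up> k) = evs (\<lambda>i. e (i + k)) t"
  by (simp add: evs_def val_shift)

lemma evs_shift1 [simp]: "evs (case_nat x e) (t \<up> Suc 0) = evs e t"
  by (simp add: evs_shift)

lemma evs_subst: "evs e (subst_tm \<sigma> t) = evs (\<lambda>i. evs e (\<sigma> i)) t"
  by (simp add: evs_def val_subst)

lemma subst_env_case_nat:
  "(\<lambda>i. evs (case_nat x e) (case_nat (Var 0) (\<lambda>n. \<sigma> n \<up> 1) i)) = case_nat x (\<lambda>i. evs e (\<sigma> i))"
  by (auto split: nat.splits simp: fun_eq_iff)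

context internal_model
begin

section \<open>Substitution, congruence and soundness\<close>

lemma sat_subst: "sat e S (subst \<sigma> \<rho> \<phi>) = sat (\<lambda>i. evs e (\<sigma> i)) (\<lambda>i. S (\<rho> i)) \<phi>"
proof (induction \<phi> arbitrary: e S \<sigma> \<rho>)
  case (All1 \<phi>)
  show ?case unfolding subst.simps sat.simps All1.IH subst_env_case_nat ..
next
  case (Ex1 \<phi>)
  show ?case unfolding subst.simps sat.simps Ex1.IH subst_env_case_nat ..
next
  case (All2 \<phi>)
  have "(\<lambda>i. case_nat X S (case_nat 0 (\<lambda>n. Suc (\<rho> n)) i)) = case_nat X (\<lambda>i. S (\<rho> i))" for X
    by (auto split: nat.splits simp: fun_eq_iff)
  then show ?case by (simp add: All2.IH)
next
  case (Ex2 \<phi>)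
  have "(\<lambda>i. case_nat X S (case_nat 0 (\<lambda>n. Suc (\<rho> n)) i)) = case_nat X (\<lambda>i. S (\<rho> i))" for X
    by (auto split: nat.splits simp: fun_eq_iff)
  then show ?case by (simp add: Ex2.IH)
qed (auto simp: evs_subst)

lemma sat_lift1: "sat (case_nat x e) S (lift1 \<phi>) = sat e S \<phi>"
  by (simp add: lift1_def sat_subst)

lemma sat_lift2: "sat e (case_nat X S) (lift2 \<phi>) = sat e S \<phi>"
  by (simp add: lift2_def sat_subst)

lemma sat_inst1: "sat e S (inst1 \<phi> t) = sat (case_nat (evs e t) e) S \<phi>"
proof -
  have "(\<lambda>i. evs e (case_nat t Var i)) = case_nat (evs e t) e"
    by (auto split: nat.splits simp: fun_eq_iff)
  then show ?thesis by (simp add: inst1_def sat_subst)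
qed

lemma sat_inst2: "sat e S (inst2 \<phi> X) = sat e (case_nat (S X) S) \<phi>"
proof -
  have "(\<lambda>i. S (case_nat X id i)) = case_nat (S X) S"
    by (auto split: nat.splits simp: fun_eq_iff)
  then show ?thesis by (simp add: inst2_def sat_subst)
qed

lemma evs_cong:
  assumes "\<And>i. \<forall>\<^sub>F n in U. e i n = e' i n"
  shows "\<forall>\<^sub>F n in U. evs e t n = evs e' t n"
proof (induction t)
  case (Succ t)
  then show ?case by (auto elim: eventually_mono)
next
  case (Plus t u)
  then show ?case by (auto elim: eventually_elim2)
next
  case (Times t u)
  then show ?case by (auto elim: eventually_elim2)
qed (auto simp: assms)

text \<open>Representatives of a number differ on a set that \<open>U\<close> ignores, and truth
  must not notice. This validates the Leibniz rule and later allows a number to be replaced by an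
  almost everywhere equal one. Agreement for each variable separately is enough because a term
  contains only finitely many.\<close>

lemma sat_cong:
  assumes "\<And>i. \<forall>\<^sub>F n in U. e i n = e' i n"
  shows "sat e S \<phi> = sat e' S \<phi>"
  using assms
proof (induction \<phi> arbitrary: e e' S)
  case (Equal t u)
  from eventually_conj[OF evs_cong[of e e' t, OF Equal] evs_cong[of e e' u, OF Equal]]
  have "\<forall>\<^sub>F n in U. (evs e t n = evs e u n) = (evs e' t n = evs e' u n)"
    by (auto elim: eventually_mono)
  then show ?case unfolding sat.simps by (rule eventually_subst)
next
  case (Less t u)
  from eventually_conj[OF evs_cong[of e e' t, OF Less] evs_cong[of e e' u, OF Less]]
  have "\<forall>\<^sub>F n in U. (evs e t n < evs e u n) = (evs e' t n < evs e' u n)"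
    by (auto elim: eventually_mono)
  then show ?case unfolding sat.simps by (rule eventually_subst)
next
  case (Mem t X)
  from evs_cong[of e e' t, OF Mem]
  have "\<forall>\<^sub>F n in U. (evs e t n \<in> S X n) = (evs e' t n \<in> S X n)"
    by (auto elim: eventually_mono)
  then show ?case unfolding sat.simps by (rule eventually_subst)
next
  case (All1 \<phi>)
  have "sat (case_nat x e) S \<phi> = sat (case_nat x e') S \<phi>" for x
    by (rule All1.IH) (auto split: nat.splits simp: All1.prems)
  then show ?case by simp
next
  case (Ex1 \<phi>)
  have "sat (case_nat x e) S \<phi> = sat (case_nat x e') S \<phi>" for x
    by (rule Ex1.IH) (auto split: nat.splits simp: Ex1.prems)
  then show ?case by simp
next
  case (All2 \<phi>)
  from All2.IH[OF All2.prems] show ?case by simp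
next
  case (Ex2 \<phi>)
  from Ex2.IH[OF Ex2.prems] show ?case by simp
next
  case (Conj \<phi> \<psi>)
  show ?case unfolding sat.simps Conj.IH(1)[OF Conj.prems] Conj.IH(2)[OF Conj.prems] ..
next
  case (Disj \<phi> \<psi>)
  show ?case unfolding sat.simps Disj.IH(1)[OF Disj.prems] Disj.IH(2)[OF Disj.prems] ..
next
  case (Impl \<phi> \<psi>)
  show ?case unfolding sat.simps Impl.IH(1)[OF Impl.prems] Impl.IH(2)[OF Impl.prems] ..
qed simp

text \<open>Only atoms consult \<open>U\<close>; connectives and quantifiers are evaluated in the
  Tarskian way over \<open>K\<close> and \<open>D\<close>. Soundness is therefore the usual
  induction, and the ultrafilter property enters only when truth is compared with truth at the
  indices.\<close>

theorem soundness:
  assumes K: "\<And>e t. (\<And>i. e i \<in> K) \<Longrightarrow> evs e t \<in> K"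
    and T: "\<And>\<phi> e S. \<phi> \<in> T \<Longrightarrow> (\<And>i. e i \<in> K) \<Longrightarrow> (\<And>i. S i \<in> D) \<Longrightarrow> sat e S \<phi>"
    and "deriv T \<Gamma> \<phi>" "\<And>i. e i \<in> K" "\<And>i. S i \<in> D" "\<forall>\<gamma>\<in>set \<Gamma>. sat e S \<gamma>"
  shows "sat e S \<phi>"
  using assms(3-)
proof (induction arbitrary: e S rule: deriv.induct)
  case (Axiom \<phi> \<Gamma>)
  then show ?case using T by blast
next
  case (Contradiction \<phi> \<Gamma>)
  then show ?case by (auto simp: Neg_def)
next
  case (DisjE \<Gamma> \<phi> \<psi> \<chi>)
  from DisjE.IH(1)[OF DisjE.prems] have "sat e S \<phi> \<or> sat e S \<psi>" by simp
  then show ?case using DisjE.IH(2,3)[OF DisjE.prems(1,2)] DisjE.prems(3) by auto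
next
  case (All1I \<Gamma> \<phi>)
  have "sat (case_nat x e) S \<phi>" if "x \<in> K" for x
    by (rule All1I.IH) (use that All1I.prems in \<open>auto split: nat.splits simp: sat_lift1\<close>)
  then show ?case by simp
next
  case (All1E \<Gamma> \<phi> t)
  from All1E.IH[OF All1E.prems] K[OF All1E.prems(1)] show ?case by (simp add: sat_inst1)
next
  case (Ex1I \<Gamma> \<phi> t)
  from Ex1I.IH[OF Ex1I.prems] K[OF Ex1I.prems(1)] show ?case by (auto simp add: sat_inst1)
next
  case (Ex1E \<Gamma> \<phi> \<psi>)
  from Ex1E.IH(1)[OF Ex1E.prems] obtain x where x: "x \<in> K" "sat (case_nat x e) S \<phi>" by auto
  have "sat (case_nat x e) S (lift1 \<psi>)"
    by (rule Ex1E.IH(2)) (use x Ex1E.prems in \<open>auto split: nat.splits simp: sat_lift1\<close>)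
  then show ?case by (simp add: sat_lift1)
next
  case (All2I \<Gamma> \<phi>)
  have "sat e (case_nat X S) \<phi>" if "X \<in> D" for X
    by (rule All2I.IH) (use that All2I.prems in \<open>auto split: nat.splits simp: sat_lift2\<close>)
  then show ?case by simp
next
  case (All2E \<Gamma> \<phi> X)
  from All2E.IH[OF All2E.prems] All2E.prems(2) show ?case by (simp add: sat_inst2)
next
  case (Ex2I \<Gamma> \<phi> X)
  from Ex2I.IH[OF Ex2I.prems] Ex2I.prems(2) show ?case by (auto simp add: sat_inst2)
next
  case (Ex2E \<Gamma> \<phi> \<psi>)
  from Ex2E.IH(1)[OF Ex2E.prems] obtain X where X: "X \<in> D" "sat e (case_nat X S) \<phi>" by auto
  have "sat e (case_nat X S) (lift2 \<psi>)"
    by (rule Ex2E.IH(2)) (use X Ex2E.prems in \<open>auto split: nat.splits simp: sat_lift2\<close>)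
  then show ?case by (simp add: sat_lift2)
next
  case (Leibniz \<Gamma> t u \<phi>)
  from Leibniz.IH(1)[OF Leibniz.prems] have eq: "\<forall>\<^sub>F n in U. evs e t n = evs e u n" by simp
  have "sat (case_nat (evs e t) e) S \<phi> = sat (case_nat (evs e u) e) S \<phi>"
    by (rule sat_cong) (auto split: nat.splits simp: eq)
  then show ?case using Leibniz.IH(2)[OF Leibniz.prems] by (simp add: sat_inst1)
qed auto

end

section \<open>Ultrafilters\<close>

definition ultra :: "'a filter \<Rightarrow> bool" where
  "ultra U \<longleftrightarrow> U \<noteq> bot \<and> (\<forall>P. eventually P U \<or> eventually (\<lambda>x. \<not> P x) U)"

lemma ultra_not:
  assumes "ultra U"
  shows "(\<forall>\<^sub>F x in U. \<not> P x) \<longleftrightarrow> \<not> eventually P U"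
proof -
  have "\<not> (eventually P U \<and> (\<forall>\<^sub>F x in U. \<not> P x))"
    using assms eventually_conj[of P U "\<lambda>x. \<not> P x"] by (auto simp: ultra_def trivial_limit_def)
  then show ?thesis using assms by (auto simp: ultra_def)
qed

lemma ultra_imp:
  assumes "ultra U"
  shows "(\<forall>\<^sub>F x in U. P x \<longrightarrow> Q x) \<longleftrightarrow> (eventually P U \<longrightarrow> eventually Q U)"
proof (cases "eventually P U")
  case True
  then show ?thesis by (auto elim: eventually_mp eventually_mono)
next
  case False
  then have "\<forall>\<^sub>F x in U. \<not> P x" using assms by (simp add: ultra_not)
  then show ?thesis using False by (auto elim: eventually_mono)
qed

lemma ultra_disj:
  "ultra U \<Longrightarrow> (\<forall>\<^sub>F x in U. P x \<or> Q x) \<longleftrightarrow> eventually P U \<or> eventually Q U"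
  using ultra_imp[of U "\<lambda>x. \<not> P x" Q] ultra_not[of U P] by (simp add: disj_imp)

text \<open>Zorn's lemma for families all of whose finite intersections are infinite. If a maximal
  family contained neither \<open>A\<close> nor its complement, each would have a finite trace on
  some finite intersection, and the union of the two traces would cover a common one. Infinite
  intersections make the generated filter free.\<close>

lemma ex_free_ultrafilter:
  "\<exists>U :: 'a filter. ultra U \<and> (\<forall>P. eventually P U \<longrightarrow> infinite {x. P x})"
  if inf: "infinite (UNIV :: 'a set)"
proof -
  define fip where "fip E \<longleftrightarrow> (\<forall>C\<subseteq>E. finite C \<longrightarrow> infinite (\<Inter>C))" for E :: "'a set set"
  have "\<exists>E\<in>Collect fip. \<forall>E'\<in>Collect fip. E \<subseteq> E' \<longrightarrow> E' = E"
  proof (rule subset_Zorn_nonempty)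
    show "Collect fip \<noteq> {}" using inf by (auto simp: fip_def intro!: exI[of _ "{}"])
    fix \<C> :: "'a set set set" assume ne: "\<C> \<noteq> {}" and chain: "subset.chain (Collect fip) \<C>"
    show "\<Union>\<C> \<in> Collect fip"
      unfolding fip_def mem_Collect_eq
    proof (intro allI impI)
      fix C assume "C \<subseteq> \<Union>\<C>" "finite C"
      then obtain E where "E \<in> \<C>" "C \<subseteq> E"
        using finite_subset_Union_chain[OF _ _ ne chain] by metis
      then show "infinite (\<Inter>C)"
        using chain \<open>finite C\<close> by (auto simp: subset.chain_def fip_def)
    qed
  qed
  then obtain E where fE: "fip E" and max: "\<And>E'. fip E' \<Longrightarrow> E \<subseteq> E' \<Longrightarrow> E' = E" by auto
  define U where "U = (INF A\<in>E. principal A)"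
  have fin: "eventually P (INF A\<in>C. principal A) \<longleftrightarrow> \<Inter>C \<subseteq> {x. P x}"
    if "finite C" for C :: "'a set set" and P
  proof -
    have "(INF A\<in>C. principal A) = principal (\<Inter>C)"
      using INF_principal_finite[OF that, of id] by simp
    then show ?thesis by (simp add: eventually_principal subset_iff Ball_def)
  qed
  have ev: "eventually P U \<longleftrightarrow> (\<exists>C\<subseteq>E. finite C \<and> \<Inter>C \<subseteq> {x. P x})" for P
    unfolding U_def by (subst eventually_INF) (metis fin)
  have free: "infinite {x. P x}" if P: "eventually P U" for P
  proof
    assume fin: "finite {x. P x}"
    from P[unfolded ev] obtain C where "C \<subseteq> E" "finite C" "\<Inter>C \<subseteq> {x. P x}" by blast
    then show False using fE finite_subset[OF _ fin] unfolding fip_def by blast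
  qed
  have mem: "A \<in> E \<or> - A \<in> E" for A
  proof (rule ccontr)
    assume neg: "\<not> (A \<in> E \<or> - A \<in> E)"
    have *: "\<exists>C\<subseteq>E. finite C \<and> finite (B \<inter> \<Inter>C)" if B: "B \<notin> E" for B
    proof -
      from max[of "insert B E"] B have "\<not> fip (insert B E)" by blast
      then obtain C where C: "C \<subseteq> insert B E" "finite C" "finite (\<Inter>C)" by (auto simp: fip_def)
      have "B \<inter> \<Inter>(C - {B}) \<subseteq> \<Inter>C" by blast
      with C show ?thesis by (intro exI[of _ "C - {B}"]) (auto intro: finite_subset)
    qed
    from *[of A] *[of "- A"] neg obtain C1 C2 where
      C: "C1 \<subseteq> E" "finite C1" "finite (A \<inter> \<Inter>C1)" "C2 \<subseteq> E" "finite C2" "finite (- A \<inter> \<Inter>C2)"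
      by blast
    have "\<Inter>(C1 \<union> C2) \<subseteq> (A \<inter> \<Inter>C1) \<union> (- A \<inter> \<Inter>C2)" by blast
    then have "finite (\<Inter>(C1 \<union> C2))" using C finite_subset by blast
    then show False using fE C unfolding fip_def by (metis Un_least finite_UnI)
  qed
  have mem_ev: "eventually P U" if "{x. P x} \<in> E" for P
    unfolding ev using that by (intro exI[of _ "{{x. P x}}"]) auto
  have "eventually P U \<or> (\<forall>\<^sub>F x in U. \<not> P x)" for P
    using mem[of "{x. P x}"] mem_ev[of P] mem_ev[of "\<lambda>x. \<not> P x"] by (auto simp: Collect_neg_eq)
  moreover have "U \<noteq> bot" using free[of "\<lambda>_. False"] by (auto simp: trivial_limit_def)
  ultimately show ?thesis using free unfolding ultra_def by blast
qed

section \<open>Arithmetical coding\<close>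

definition pr :: "nat \<Rightarrow> nat \<Rightarrow> nat" where
  "pr x y = (x + y) * (x + y) + x"

text \<open>\<open>pr x y\<close> lies between the square of \<open>x + y\<close> and the next
  square, so it determines the sum, and then \<open>x\<close>.\<close>

lemma pr_inject [simp]: "pr x y = pr x' y' \<longleftrightarrow> x = x' \<and> y = y'"
proof
  assume eq: "pr x y = pr x' y'"
  have less: "pr a b < pr c d" if "a + b < c + d" for a b c d
  proof -
    have "pr a b < Suc (a + b) * Suc (a + b)" by (simp add: pr_def)
    also have "\<dots> \<le> (c + d) * (c + d)" using that by (intro mult_le_mono) auto
    also have "\<dots> \<le> pr c d" by (simp add: pr_def)
    finally show ?thesis .
  qed
  have "x + y = x' + y'"
    using less[of x y x' y'] less[of x' y' x y] eq by (metis less_irrefl nat_neq_iff)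
  then show "x = x' \<and> y = y'" using eq by (simp add: pr_def)
qed simp

lemma pr_ge1: "x \<le> pr x y" and pr_ge2: "y \<le> pr x y"
  unfolding pr_def using le_square[of "x + y"] by linarith+

definition cmem :: "nat \<Rightarrow> nat \<Rightarrow> bool" where
  "cmem t s \<longleftrightarrow> (\<exists>k c m. s = pr k (pr c m) \<and> t < k \<and> Suc (m * Suc t) dvd c)"

text \<open>Makes quantifiers over a coded set bounded, hence absolute for the cut.\<close>

lemma cmem_le: "cmem t s \<Longrightarrow> t \<le> s"
  unfolding cmem_def using pr_ge1 by (metis le_trans less_imp_le)

text \<open>Goedel's argument: a common divisor of two moduli is coprime to \<open>m\<close> and
  divides \<open>m * (j - i)\<close>, hence divides \<open>j - i\<close>, which in turn divides
  \<open>m\<close>.\<close>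

lemma coprime_beta_moduli:
  assumes m: "\<And>d. 0 < d \<Longrightarrow> d \<le> k \<Longrightarrow> d dvd m" and "i \<le> k" "j \<le> k" "i \<noteq> j"
  shows "coprime (Suc (m * Suc i)) (Suc (m * Suc j))"
  using assms(2-)
proof (induction i j rule: linorder_wlog)
  case (le i j)
  show ?case
  proof (rule coprimeI)
    fix d assume d: "d dvd Suc (m * Suc i)" "d dvd Suc (m * Suc j)"
    have "coprime d m"
    proof (rule coprimeI)
      fix c assume "c dvd d" "c dvd m"
      then have "c dvd Suc (m * Suc i)" "c dvd m * Suc i" using d by auto
      then show "is_unit c" using dvd_add_right_iff[of c "m * Suc i" 1] by auto
    qed
    have "d dvd Suc (m * Suc j) - Suc (m * Suc i)" using d by (intro dvd_diff_nat)
    also have "\<dots> = m * (j - i)" using le by (simp add: algebra_simps diff_mult_distrib2)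
    finally have "d dvd j - i" using \<open>coprime d m\<close> coprime_dvd_mult_right_iff by blast
    then have "d dvd m" using m[of "j - i"] le by (auto intro: dvd_trans)
    then show "is_unit d" using \<open>coprime d m\<close> by (metis coprime_common_divisor dvd_refl)
  qed
next
  case (sym i j)
  then show ?case by (simp add: coprime_commute)
qed

text \<open>The factorial supplies all divisors up to \<open>k\<close>; the factor
  \<open>Suc k\<close> puts the modulus above \<open>k\<close>, so that entries up to
  \<open>k\<close> are possible remainders.\<close>

definition beta_modulus :: "nat \<Rightarrow> nat" where
  "beta_modulus k = fact k * Suc k"

lemma dvd_beta_modulus: "0 < d \<Longrightarrow> d \<le> k \<Longrightarrow> d dvd beta_modulus k"
  unfolding beta_modulus_def by (intro dvd_mult2 dvd_fact) auto

lemma less_beta_modulus: "k < beta_modulus k"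
  unfolding beta_modulus_def by (metis fact_gt_zero le_simps(3) less_le_trans mult.commute mult_le_mono2 nat_mult_1_right One_nat_def Suc_leI)

definition beta_bound :: "nat \<Rightarrow> nat" where
  "beta_bound k = beta_modulus k + (\<Prod>i\<le>k. Suc (beta_modulus k * Suc i))"

text \<open>Chinese remaindering. The point is a bound that depends on \<open>k\<close> alone: a cut
  closed under \<open>grow\<close>, which dominates \<open>beta_bound\<close>, then contains a code
  of every such sequence.\<close>

lemma ex_beta_code:
  assumes "\<And>i. i \<le> k \<Longrightarrow> s i \<le> k"
  shows "\<exists>c\<le>beta_bound k. \<exists>m\<le>beta_bound k. \<forall>i\<le>k. s i = c mod Suc (m * Suc i)"
proof -
  let ?m = "beta_modulus k"
  have "\<exists>!x. x < (\<Prod>i\<in>{..k}. Suc (?m * Suc i)) \<and> (\<forall>i\<in>{..k}. [x = s i] (mod Suc (?m * Suc i)))"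
    by (rule chinese_remainder_unique_nat) (auto intro!: coprime_beta_moduli[of k] dvd_beta_modulus simp del: mult_Suc_right)
  then obtain x where x: "x < (\<Prod>i\<le>k. Suc (?m * Suc i))"
    "\<And>i. i \<le> k \<Longrightarrow> [x = s i] (mod Suc (?m * Suc i))" by auto
  have "s i = x mod Suc (?m * Suc i)" if i: "i \<le> k" for i
  proof -
    have "s i < Suc (?m * Suc i)" using assms[OF i] less_beta_modulus[of k] by (simp add: algebra_simps)
    then show ?thesis using x(2)[OF i] by (simp add: cong_def)
  qed
  moreover have "x \<le> beta_bound k" "?m \<le> beta_bound k" using x(1) by (auto simp: beta_bound_def)
  ultimately show ?thesis by blast
qed

text \<open>The code is the product of the moduli of the members. The modulus of a nonmember is
  coprime to this product and exceeds 1, so it does not divide it.\<close>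

lemma ex_set_code:
  assumes "finite T"
  shows "\<exists>s. \<forall>t. cmem t s \<longleftrightarrow> t \<in> T"
proof -
  obtain k where k: "\<And>t. t \<in> T \<Longrightarrow> t < k" using assms finite_nat_set_iff_bounded by auto
  let ?m = "beta_modulus k"
  let ?c = "\<Prod>t\<in>T. Suc (?m * Suc t)"
  have "Suc (?m * Suc t) dvd ?c \<longleftrightarrow> t \<in> T" if t: "t < k" for t
  proof
    show "t \<in> T \<Longrightarrow> Suc (?m * Suc t) dvd ?c" using assms dvd_prodI[of T t "\<lambda>t. Suc (?m * Suc t)"] by simp
    assume dvd: "Suc (?m * Suc t) dvd ?c"
    show "t \<in> T"
    proof (rule ccontr)
      assume "t \<notin> T"
      then have "coprime ?c (Suc (?m * Suc t))"
        by (intro prod_coprime_left coprime_beta_moduli[of k] dvd_beta_modulus)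
          (use k t in \<open>auto intro: less_imp_le\<close>)
      then have "is_unit (Suc (?m * Suc t))" using dvd by (meson coprime_common_divisor dvd_refl)
      then show False using less_beta_modulus[of k] by simp
    qed
  qed
  then have "cmem t (pr k (pr ?c ?m)) \<longleftrightarrow> t \<in> T" for t
    unfolding cmem_def using k by auto
  then show ?thesis by blast
qed

definition set_code :: "nat set \<Rightarrow> nat" where
  "set_code T = (SOME s. \<forall>t. cmem t s \<longleftrightarrow> t \<in> T)"

lemma cmem_set_code: "finite T \<Longrightarrow> cmem t (set_code T) \<longleftrightarrow> t \<in> T"
  using someI_ex[OF ex_set_code, of T] unfolding set_code_def by blast

section \<open>Countable families of internal sets\<close>

text \<open>An application of an operation then depends on finitely many arguments, so the closure
  of a countable family is named by finite trees and remains countable.\<close>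

definition finite_support :: "(nat \<Rightarrow> (nat \<Rightarrow> nat) \<Rightarrow> (nat \<Rightarrow> nat set) \<Rightarrow> 'a) \<Rightarrow> bool" where
  "finite_support F \<longleftrightarrow> (\<exists>N. \<forall>n e e' S S'. agree N e e' \<longrightarrow> agree N S S' \<longrightarrow> F n e S = F n e' S')"

datatype op_tree = Node nat "op_tree list" "op_tree list"

instance op_tree :: countable by countable_datatype

text \<open>Number arguments are stored as singletons, which \<open>the_elem\<close> unpacks, so
  that one closure serves numbers and sets. Positions beyond the argument lists receive
  \<open>0\<close> and \<open>{}\<close>, which is harmless once the lists cover the
  support.\<close>

primrec eval_tree ::
  "(nat \<Rightarrow> nat \<Rightarrow> (nat \<Rightarrow> nat) \<Rightarrow> (nat \<Rightarrow> nat set) \<Rightarrow> nat set) \<Rightarrow> op_tree \<Rightarrow> nat \<Rightarrow> nat set" where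
  "eval_tree H (Node k ts us) = (\<lambda>n. H k n
     (\<lambda>i. if i < length ts then the_elem ((map (eval_tree H) ts ! i) n) else 0)
     (\<lambda>i. if i < length us then (map (eval_tree H) us ! i) n else {}))"

definition closed_under ::
  "(nat \<Rightarrow> nat set) set \<Rightarrow> (nat \<Rightarrow> (nat \<Rightarrow> nat) \<Rightarrow> (nat \<Rightarrow> nat set) \<Rightarrow> nat set) \<Rightarrow> bool" where
  "closed_under D F \<longleftrightarrow> (\<forall>e S. (\<forall>i. (\<lambda>n. {e i n}) \<in> D) \<longrightarrow> (\<forall>i. S i \<in> D) \<longrightarrow>
     (\<lambda>n. F n (\<lambda>i. e i n) (\<lambda>i. S i n)) \<in> D)"

lemma closed_under_eval_tree:
  assumes "countable \<F>" and F: "F \<in> \<F>" and fs: "finite_support F"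
  shows "closed_under (range (eval_tree (from_nat_into \<F>))) F"
  unfolding closed_under_def
proof (intro allI impI)
  let ?H = "from_nat_into \<F>"
  fix e :: "nat \<Rightarrow> nat \<Rightarrow> nat" and S :: "nat \<Rightarrow> nat \<Rightarrow> nat set"
  assume "\<forall>i. (\<lambda>n. {e i n}) \<in> range (eval_tree ?H)" "\<forall>i. S i \<in> range (eval_tree ?H)"
  then obtain t u where t: "\<And>i. (\<lambda>n. {e i n}) = eval_tree ?H (t i)"
    and u: "\<And>i. S i = eval_tree ?H (u i)" unfolding image_iff by metis
  obtain k where k: "?H k = F" using F assms(1) from_nat_into_surj by metis
  obtain N where N: "\<And>n e e' S S'. agree N e e' \<Longrightarrow> agree N S S' \<Longrightarrow> F n e S = F n e' S'"
    using fs unfolding finite_support_def by blast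
  have eq: "(\<lambda>n. F n (\<lambda>i. e i n) (\<lambda>i. S i n)) = eval_tree ?H (Node k (map t [0..<N]) (map u [0..<N]))"
  proof (rule ext)
    fix n
    define e' where "e' = (\<lambda>i. if i < N then the_elem (eval_tree ?H (t i) n) else 0)"
    define S' where "S' = (\<lambda>i. if i < N then eval_tree ?H (u i) n else {})"
    have "agree N (\<lambda>i. e i n) e'" "agree N (\<lambda>i. S i n) S'"
      unfolding agree_def e'_def S'_def by (auto simp: t[symmetric] u[symmetric])
    from N[OF this, of n]
    show "F n (\<lambda>i. e i n) (\<lambda>i. S i n) = eval_tree ?H (Node k (map t [0..<N]) (map u [0..<N])) n"
      by (simp add: k e'_def S'_def cong: if_cong)
  qed
  have "eval_tree ?H (Node k (map t [0..<N]) (map u [0..<N])) \<in> range (eval_tree ?H)"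
    by blast
  then show "(\<lambda>n. F n (\<lambda>i. e i n) (\<lambda>i. S i n)) \<in> range (eval_tree ?H)"
    by (simp only: eq)
qed

text \<open>The second conjunct provides elements to start from; closure alone would hold for an
  empty \<open>D\<close>.\<close>

lemma ex_countable_closed:
  assumes "countable \<F>" "\<And>F. F \<in> \<F> \<Longrightarrow> finite_support F"
  shows "\<exists>D. countable D \<and> (\<forall>F\<in>\<F>. closed_under D F \<and> (\<lambda>n. F n (\<lambda>_. 0) (\<lambda>_. {})) \<in> D)"
proof (intro exI[of _ "range (eval_tree (from_nat_into \<F>))"] conjI ballI)
  fix F assume F: "F \<in> \<F>"
  show "closed_under (range (eval_tree (from_nat_into \<F>))) F"
    by (rule closed_under_eval_tree[OF assms(1) F assms(2)[OF F]])
  obtain k where "from_nat_into \<F> k = F" using F assms(1) from_nat_into_surj by metis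
  then have "(\<lambda>n. F n (\<lambda>_. 0) (\<lambda>_. {})) = eval_tree (from_nat_into \<F>) (Node k [] [])" by simp
  then show "(\<lambda>n. F n (\<lambda>_. 0) (\<lambda>_. {})) \<in> range (eval_tree (from_nat_into \<F>))" by blast
qed simp

section \<open>A colouring of large intervals\<close>

text \<open>
  \<open>good G f m k l\<close>: in the interval \<open>[k, l)\<close> one can \<open>m\<close> times in a row pass to a subinterval that
  avoids a prescribed colour of \<open>f\<close> and a prescribed set of at most \<open>k + 1\<close> points.
  Running through all prescriptions in a nonstandard number \<open>m\<close> of levels produces a cut that
  satisfies \<open>\<Sigma>\<^sub>1\<close>-induction while every colour of \<open>f\<close> occurs only boundedly often.
\<close>

primrec good :: "(nat \<Rightarrow> nat) \<Rightarrow> (nat \<Rightarrow> nat) \<Rightarrow> nat \<Rightarrow> nat \<Rightarrow> nat \<Rightarrow> bool" where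
  "good G f 0 k l \<longleftrightarrow> k < l"
| "good G f (Suc m) k l \<longleftrightarrow> k < l \<and> (\<forall>W c. finite W \<and> card W \<le> Suc k \<longrightarrow>
     (\<exists>k' l'. G k \<le> k' \<and> k \<le> k' \<and> l' \<le> l \<and> good G f m k' l' \<and> W \<inter> {k'..<l'} = {} \<and> c \<notin> f ` {k'..<l'}))"

lemma good_less: "good G f m k l \<Longrightarrow> k < l"
  by (cases m) auto

lemma good_cong:
  "good G f m k l \<Longrightarrow> (\<And>x. x \<in> {k..<l} \<Longrightarrow> f x = g x) \<Longrightarrow> good G g m k l"
proof (induction m arbitrary: k l)
  case (Suc m)
  show ?case unfolding good.simps
  proof (intro conjI allI impI)
    show "k < l" using Suc.prems good_less by blast
    fix W :: "nat set" and c assume "finite W \<and> card W \<le> Suc k"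
    with Suc.prems(1)[unfolded good.simps]
    obtain k' l' where *: "G k \<le> k'" "k \<le> k'" "l' \<le> l" "good G f m k' l'" "W \<inter> {k'..<l'} = {}"
      "c \<notin> f ` {k'..<l'}" by meson
    have eq: "f x = g x" if "x \<in> {k'..<l'}" for x using Suc.prems(2) * that by auto
    then have "f ` {k'..<l'} = g ` {k'..<l'}" by (rule image_cong[OF refl])
    with * Suc.IH[OF *(4) eq]
    show "\<exists>k' l'. G k \<le> k' \<and> k \<le> k' \<and> l' \<le> l \<and> good G g m k' l' \<and> W \<inter> {k'..<l'} = {} \<and> c \<notin> g ` {k'..<l'}"
      by blast
  qed
qed auto

text \<open>Blocks are placed one after the other to the right of \<open>p\<close>. Block
  \<open>i\<close> is coloured without \<open>c i\<close>, so it is a possible answer whenever that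
  colour is prescribed; disjointness of the blocks prepares a pigeonhole argument about the
  prescribed points.\<close>

lemma ex_good_sequence:
  fixes c :: "nat \<Rightarrow> nat"
  assumes IH: "\<And>k c. \<exists>f l. f ` {k..<l} \<subseteq> C - {c} \<and> good G f m k l"
  shows "\<exists>f l ks ls. p \<le> l \<and> f ` {p..<l} \<subseteq> C
    \<and> (\<forall>i<N. p \<le> ks i \<and> ls i \<le> l \<and> good G f m (ks i) (ls i) \<and> c i \<notin> f ` {ks i..<ls i})
    \<and> (\<forall>j<N. \<forall>i<j. ls i \<le> ks j)"
proof (induction N)
  case 0
  show ?case by (intro exI[of _ "\<lambda>_. 0"] exI[of _ p]) auto
next
  case (Suc N)
  from Suc.IH obtain f l ks ls where 1: "p \<le> l" "f ` {p..<l} \<subseteq> C"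
    "\<And>i. i < N \<Longrightarrow> p \<le> ks i \<and> ls i \<le> l \<and> good G f m (ks i) (ls i) \<and> c i \<notin> f ` {ks i..<ls i}"
    "\<And>i j. i < j \<Longrightarrow> j < N \<Longrightarrow> ls i \<le> ks j" by metis
  from IH[of l "c N"] obtain g l' where 2: "g ` {l..<l'} \<subseteq> C - {c N}" "good G g m l l'" by blast
  define h where "h = (\<lambda>x. if x < l then f x else g x)"
  have "l < l'" using 2 good_less by blast
  show ?case
  proof (rule exI[of _ h], rule exI[of _ l'], rule exI[of _ "ks(N := l)"], rule exI[of _ "ls(N := l')"],
      intro conjI allI impI)
    show "p \<le> l'" using 1 \<open>l < l'\<close> by linarith
    show "h ` {p..<l'} \<subseteq> C" using 1(2) 2(1) by (auto simp: h_def subset_iff)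
    fix i assume i: "i < Suc N"
    show "p \<le> (ks(N := l)) i" using 1(1,3) i by auto
    show "(ls(N := l')) i \<le> l'"
    proof (cases "i = N")
      case False
      then have "ls i \<le> l" using 1(3)[of i] i by simp
      then show ?thesis using False \<open>l < l'\<close> by simp
    qed simp
    show "good G h m ((ks(N := l)) i) ((ls(N := l')) i)"
    proof (cases "i = N")
      case True
      then show ?thesis using 2 by (auto intro: good_cong simp: h_def)
    next
      case False
      then have "i < N" using i by simp
      from 1(3)[OF this] show ?thesis using False by (auto intro!: good_cong[of G f] simp: h_def)
    qed
    show "c i \<notin> h ` {(ks(N := l)) i..<(ls(N := l')) i}"
    proof (cases "i = N")
      case True
      then show ?thesis using 2(1) by (auto simp: h_def)
    next
      case False
      then have "i < N" using i by simp
      from 1(3)[OF this] show ?thesis using False by (auto simp: h_def)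
    qed
  next
    fix j i assume "j < Suc N" "i < j"
    then show "(ls(N := l')) i \<le> (ks(N := l)) j"
      using 1(3)[of i] 1(4)[of i j] by (cases "j = N") auto
  qed
qed

text \<open>For each colour there are \<open>k + 2\<close> disjoint blocks that avoid it. At most
  \<open>k + 1\<close> prescribed points cannot meet all of them, so one block answers the
  prescription. Within a block one colour fewer is available, and at level 0 one must be left,
  whence \<open>m < card C\<close>.\<close>

lemma ex_good: "finite C \<Longrightarrow> m < card C \<Longrightarrow> \<exists>f l. f ` {k..<l} \<subseteq> C \<and> good G f m k l"
proof (induction m arbitrary: k C)
  case 0
  then obtain c where "c \<in> C" by (metis card_gt_0_iff ex_in_conv)
  then show ?case by (intro exI[of _ "\<lambda>_. c"] exI[of _ "Suc k"]) auto
next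
  case (Suc m)
  from Suc.prems obtain c0 where c0: "c0 \<in> C" by (metis card_gt_0_iff ex_in_conv less_trans zero_less_Suc)
  have IH: "\<exists>f l. f ` {k..<l} \<subseteq> C - {c} \<and> good G f m k l" for k c
  proof (rule Suc.IH)
    show "m < card (C - {c})" using Suc.prems by (cases "c \<in> C") (auto simp: card_Diff_singleton_if)
  qed (use Suc.prems in simp)
  obtain e where e: "bij_betw e {..<card C} C"
    using Suc.prems(1) ex_bij_betw_nat_finite[of C] by (auto simp: atLeast0LessThan)
  \<comment> \<open>Groups of \<open>k + 2\<close> consecutive blocks avoid the same colour.\<close>
  define c where "c = (\<lambda>i. e (i div (k + 2)))"
  define p where "p = max k (G k)"
  define N where "N = card C * (k + 2)"
  from ex_good_sequence[OF IH, of p N c] obtain f l ks ls where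
    1: "p \<le> l" "f ` {p..<l} \<subseteq> C"
    "\<And>i. i < N \<Longrightarrow> p \<le> ks i \<and> ls i \<le> l \<and> good G f m (ks i) (ls i) \<and> c i \<notin> f ` {ks i..<ls i}"
    "\<And>i j. i < j \<Longrightarrow> j < N \<Longrightarrow> ls i \<le> ks j" by metis
  \<comment> \<open>The blocks start only at \<open>p\<close>, which is at least \<open>G k\<close>;
    the stretch before it is padded with an arbitrary colour of \<open>C\<close>.\<close>
  define g where "g = (\<lambda>x. if x < p then c0 else f x)"
  have gC: "g ` {k..<l} \<subseteq> C" using 1(2) c0 by (auto simp: g_def subset_iff)
  have "0 < N" using Suc.prems by (simp add: N_def)
  then have "k < l" using 1(3)[of 0] good_less[of G f m "ks 0" "ls 0"] by (simp add: p_def)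
  moreover have "\<exists>k' l'. G k \<le> k' \<and> k \<le> k' \<and> l' \<le> l \<and> good G g m k' l'
      \<and> W \<inter> {k'..<l'} = {} \<and> d \<notin> g ` {k'..<l'}" if W: "finite W" "card W \<le> Suc k" for W d
  proof -
    \<comment> \<open>A colour outside \<open>C\<close> does not occur at all, so any group of
      blocks serves.\<close>
    obtain q where q: "q < card C" "d \<in> C \<longrightarrow> e q = d"
    proof (cases "d \<in> C")
      case True
      then have "d \<in> e ` {..<card C}" using e by (simp add: bij_betw_def)
      then show ?thesis using that by blast
    next
      case False
      then show ?thesis using that[of 0] Suc.prems by simp
    qed
    define t where "t r = q * (k + 2) + r" for r
    have tN: "t r < N" if "r < k + 2" for r
    proof -
      have "t r < Suc q * (k + 2)" using that by (simp add: t_def)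
      also have "\<dots> \<le> N" unfolding N_def using q by (intro mult_le_mono1) simp
      finally show ?thesis .
    qed
    have ct: "c (t r) = e q" if "r < k + 2" for r
      using that unfolding c_def t_def by (simp only: div_mult_self3 div_less) simp
    have "\<exists>r<k + 2. W \<inter> {ks (t r)..<ls (t r)} = {}"
    proof (rule ccontr)
      assume "\<not> ?thesis"
      then have "\<forall>r. r < k + 2 \<longrightarrow> (\<exists>w. w \<in> W \<inter> {ks (t r)..<ls (t r)})" by blast
      then obtain w where w: "\<And>r. r < k + 2 \<Longrightarrow> w r \<in> W \<inter> {ks (t r)..<ls (t r)}" by metis
      have lt: "w r < w r'" if "r < r'" "r' < k + 2" for r r'
      proof -
        have "w r < ls (t r)" using w[of r] that by simp
        also have "\<dots> \<le> ks (t r')" using 1(4)[of "t r" "t r'"] tN that by (simp add: t_def)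
        also have "\<dots> \<le> w r'" using w[of r'] that by simp
        finally show ?thesis .
      qed
      have "inj_on w {..<k + 2}"
        by (rule inj_onI) (metis lt lessThan_iff less_irrefl nat_neq_iff)
      then have "card (w ` {..<k + 2}) = k + 2" by (simp add: card_image)
      moreover have "w ` {..<k + 2} \<subseteq> W" using w by auto
      ultimately show False using W card_mono[of W "w ` {..<k + 2}"] by simp
    qed
    then obtain r where r: "r < k + 2" "W \<inter> {ks (t r)..<ls (t r)} = {}" by blast
    note 3 = 1(3)[OF tN[OF r(1)]]
    have same: "f x = g x" if "x \<in> {ks (t r)..<ls (t r)}" for x using 3 that by (auto simp: g_def)
    have img: "g ` {ks (t r)..<ls (t r)} = f ` {ks (t r)..<ls (t r)}" using same by (metis image_cong)
    have "d \<notin> g ` {ks (t r)..<ls (t r)}"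
    proof (cases "d \<in> C")
      case True
      then show ?thesis using 3 ct[OF r(1)] q img by simp
    next
      case False
      have "{ks (t r)..<ls (t r)} \<subseteq> {k..<l}" using 3 by (auto simp: p_def)
      then show ?thesis using gC False by blast
    qed
    moreover have "good G g m (ks (t r)) (ls (t r))" using 3 good_cong same by blast
    moreover have "G k \<le> ks (t r)" "k \<le> ks (t r)" "ls (t r) \<le> l" using 3 by (auto simp: p_def)
    ultimately show ?thesis using r by blast
  qed
  ultimately show ?case using gC by (intro exI[of _ g] exI[of _ l]) simp
qed

section \<open>The automaton\<close>

text \<open>
  The automaton guesses a colour \<open>i\<close> and checks that it occurs infinitely often.  State \<open>0\<close> waits
  for the guess; afterwards the state is \<open>2 * i\<close> or \<open>2 * i + 1\<close>, where an odd state may only be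
  entered by reading \<open>i\<close>.
\<close>

definition nba_trans :: "nat \<Rightarrow> nat set" where
  "nba_trans n = {pr (pr q b) r |q b r. q < 2 * n + 4 \<and> b \<in> {1..Suc n} \<and> r < 2 * n + 4 \<and>
     (q = 0 \<or> q div 2 = r div 2) \<and> (odd r \<longrightarrow> r div 2 = b)}"

text \<open>Letters run from \<open>1\<close> to \<open>Suc n\<close>, so the largest state is
  \<open>2 * n + 3\<close>. Letter \<open>0\<close> is omitted because its even state would be the
  waiting state.\<close>

definition nba_alphabet :: "nat \<Rightarrow> nat" where "nba_alphabet n = set_code {1..Suc n}"
definition nba_states :: "nat \<Rightarrow> nat" where "nba_states n = set_code {..<2 * n + 4}"
definition nba_delta :: "nat \<Rightarrow> nat" where "nba_delta n = set_code (nba_trans n)"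
definition nba_final :: "nat \<Rightarrow> nat" where "nba_final n = set_code {q. q < 2 * n + 4 \<and> odd q}"

definition nba :: "nat \<Rightarrow> nat" where
  "nba n = pr (nba_alphabet n) (pr (nba_states n) (pr (nba_delta n) (pr 0 (nba_final n))))"

lemma finite_nba_trans: "finite (nba_trans n)"
proof (rule finite_subset)
  show "nba_trans n \<subseteq> (\<lambda>(q, b, r). pr (pr q b) r) ` ({..<2 * n + 4} \<times> {1..Suc n} \<times> {..<2 * n + 4})"
    unfolding nba_trans_def by force
qed simp

lemma cmem_nba_alphabet: "cmem b (nba_alphabet n) \<longleftrightarrow> b \<in> {1..Suc n}"
  and cmem_nba_states: "cmem q (nba_states n) \<longleftrightarrow> q < 2 * n + 4"
  and cmem_nba_delta: "cmem t (nba_delta n) \<longleftrightarrow> t \<in> nba_trans n"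
  and cmem_nba_final: "cmem q (nba_final n) \<longleftrightarrow> q < 2 * n + 4 \<and> odd q"
  unfolding nba_alphabet_def nba_states_def nba_delta_def nba_final_def by (subst cmem_set_code; simp add: finite_nba_trans)+

section \<open>Operations on internal objects\<close>

text \<open>One monotone function for everything the cut has to absorb: the square dominates
  successor, sum and product, \<open>nba\<close> brings the automaton into the cut, and
  \<open>beta_bound\<close> the codes of sequences.\<close>

definition grow :: "nat \<Rightarrow> nat" where
  "grow k = (\<Sum>j\<le>k. (2 * j + 2) ^ 2 + nba j + beta_bound j)"

lemma grow_mono: "j \<le> k \<Longrightarrow> grow j \<le> grow k"
  unfolding grow_def by (rule sum_mono2) auto

lemma grow_ge: "(2 * k + 2) ^ 2 + nba k + beta_bound k \<le> grow k"
  unfolding grow_def by (rule member_le_sum[of k "{..k}" "\<lambda>j. (2 * j + 2) ^ 2 + nba j + beta_bound j"]) auto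

lemma add_le_grow: "x \<le> k \<Longrightarrow> y \<le> k \<Longrightarrow> x + y \<le> grow k"
  and mult_le_grow: "x \<le> k \<Longrightarrow> y \<le> k \<Longrightarrow> x * y \<le> grow k"
  and Suc_le_grow: "Suc k \<le> grow k"
proof -
  have *: "2 * k + 2 \<le> grow k" "k * k \<le> grow k"
    using grow_ge[of k] by (auto simp: power2_eq_square algebra_simps)
  show "Suc k \<le> grow k" using * by linarith
  assume "x \<le> k" "y \<le> k"
  then show "x + y \<le> grow k" "x * y \<le> grow k" using * mult_le_mono[of x k y k] by linarith+
qed

text \<open>\<open>n\<close> levels use up \<open>n\<close> colours and one has to remain, hence
  \<open>Suc n\<close> letters. Outside the interval the letter \<open>1\<close> is used, so that
  the whole sequence is a word over the alphabet.\<close>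

lemma ex_colour:
  "\<exists>p :: (nat \<Rightarrow> nat) \<times> nat. (\<forall>x. fst p x \<in> {1..Suc n}) \<and> good grow (fst p) n n (snd p)"
proof -
  have "card {1..Suc n} = Suc n" by simp
  then obtain f l where f: "f ` {n..<l} \<subseteq> {1..Suc n}" "good grow f n n l"
    using ex_good[of "{1..Suc n}" n n grow] by auto
  define g where "g x = (if x \<in> {n..<l} then f x else 1)" for x
  have "good grow g n n l" using f(2) by (rule good_cong) (simp add: g_def)
  moreover have "\<forall>x. g x \<in> {1..Suc n}" using f(1) unfolding g_def image_subset_iff by simp
  ultimately show ?thesis by (intro exI[of _ "(g, l)"]) simp
qed

definition colour_top :: "nat \<Rightarrow> (nat \<Rightarrow> nat) \<times> nat" where
  "colour_top n = (SOME p. (\<forall>x. fst p x \<in> {1..Suc n}) \<and> good grow (fst p) n n (snd p))"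

abbreviation colour :: "nat \<Rightarrow> nat \<Rightarrow> nat" where "colour n \<equiv> fst (colour_top n)"
abbreviation colour_end :: "nat \<Rightarrow> nat" where "colour_end n \<equiv> snd (colour_top n)"

lemma colour: "1 \<le> colour n x" "colour n x \<le> Suc n" and good_colour: "good grow (colour n) n n (colour_end n)"
  using someI_ex[OF ex_colour, of n] unfolding colour_top_def[symmetric] by auto

text \<open>The demand on \<open>W\<close> is conditional, since a scheduled set may be infinite or
  still too large; the interval then shrinks all the same and the colour is avoided.\<close>

definition step :: "nat \<Rightarrow> nat \<Rightarrow> nat \<Rightarrow> nat \<Rightarrow> nat set \<Rightarrow> nat \<Rightarrow> nat \<times> nat" where
  "step n m k l W c = (SOME (k', l'). grow k \<le> k' \<and> k \<le> k' \<and> l' \<le> l \<and> good grow (colour n) m k' l'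
     \<and> (finite W \<and> card W \<le> Suc k \<longrightarrow> W \<inter> {k'..<l'} = {}) \<and> c \<notin> colour n ` {k'..<l'})"

lemma step:
  assumes "good grow (colour n) (Suc m) k l" "step n m k l W c = (k', l')"
  shows "grow k \<le> k' \<and> k \<le> k' \<and> l' \<le> l \<and> good grow (colour n) m k' l'
     \<and> (finite W \<and> card W \<le> Suc k \<longrightarrow> W \<inter> {k'..<l'} = {}) \<and> c \<notin> colour n ` {k'..<l'}"
proof -
  let ?W = "if finite W \<and> card W \<le> Suc k then W else {}"
  have "finite ?W \<and> card ?W \<le> Suc k" by simp
  with assms(1) obtain k' l' where "grow k \<le> k' \<and> k \<le> k' \<and> l' \<le> l \<and> good grow (colour n) m k' l' \<and>
      ?W \<inter> {k'..<l'} = {} \<and> c \<notin> colour n ` {k'..<l'}" unfolding good.simps by blast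
  then have "\<exists>p. (\<lambda>(k', l'). grow k \<le> k' \<and> k \<le> k' \<and> l' \<le> l \<and> good grow (colour n) m k' l'
     \<and> (finite W \<and> card W \<le> Suc k \<longrightarrow> W \<inter> {k'..<l'} = {}) \<and> c \<notin> colour n ` {k'..<l'}) p"
    by (intro exI[of _ "(k', l')"]) (auto split: if_splits simp del: disjoint_iff)
  from someI_ex[OF this] show ?thesis using assms(2) unfolding step_def by simp
qed

definition graph_of :: "(nat \<Rightarrow> nat) \<Rightarrow> nat set" where
  "graph_of h = {pr x (h x) |x. True}"

lemma pr_in_graph_of [simp]: "pr x y \<in> graph_of h \<longleftrightarrow> y = h x"
  by (auto simp: graph_of_def)

text \<open>The position in \<open>[0, z)\<close> to which \<open>s\<close> is folded when the segment \<open>[x, z)\<close> is looped.\<close>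

definition fold_pos :: "nat \<Rightarrow> nat \<Rightarrow> nat \<Rightarrow> nat" where
  "fold_pos x z s = (if s < x then s else x + (s - x) mod (z - x))"

text \<open>Accepting if \<open>b\<close> recurs in \<open>w\<close>: the guess is made at the first
  letter, and every occurrence of \<open>b\<close> is answered by the odd state.\<close>

definition nba_run :: "(nat \<Rightarrow> nat) \<Rightarrow> nat \<Rightarrow> nat \<Rightarrow> nat" where
  "nba_run w b s = (if s = 0 then 0 else 2 * b + (if w (s - 1) = b then 1 else 0))"

definition tail :: "(nat \<Rightarrow> 'a) \<Rightarrow> nat \<Rightarrow> 'a" where
  "tail e = (\<lambda>i. e (Suc i))"

definition has_index :: "nat set \<Rightarrow> nat \<Rightarrow> nat \<Rightarrow> bool" where
  "has_index Y i z \<longleftrightarrow> pr z (2 * i) \<in> Y \<or> pr z (2 * i + 1) \<in> Y"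

text \<open>
  The generic construction can meet only countably many requirements.  Therefore only a countable
  family \<open>D\<close> of internal sets is admitted, closed under the Skolem functions of all formulas and the
  few operations used in the construction.
\<close>

type_synonym 'a operation = "nat \<Rightarrow> (nat \<Rightarrow> nat) \<Rightarrow> (nat \<Rightarrow> nat set) \<Rightarrow> 'a"

text \<open>After terms and least witnesses of formulas come the first component of a bounded pair
  of witnesses, for existential quantifiers over sequence codes, and the least failure of a bounded
  existential formula, for induction. \<open>LEAST y. pr (e 0) y \<in> S 0\<close> evaluates a
  function given by its graph; the last operation finds where a run of the Buechi automaton abandons
  its guess.\<close>

definition num_ops :: "nat operation set" where
  "num_ops =
     range (\<lambda>t n e S. val e t)
   \<union> range (\<lambda>\<phi> n e S. LEAST y. holds (case_nat y e) S \<phi>)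
   \<union> range (\<lambda>\<phi> n e S. LEAST c. \<exists>m\<le>e 0. holds (case_nat m (case_nat c (tail e))) S \<phi>)
   \<union> range (\<lambda>\<phi> n e S. LEAST x. \<not> (\<exists>y\<le>e 0. holds (case_nat y (case_nat x (tail e))) S \<phi>))
   \<union> range (\<lambda>i n e S. n - i)
   \<union> {\<lambda>n e S. colour_end n, \<lambda>n e S. nba_alphabet n, \<lambda>n e S. nba_states n, \<lambda>n e S. nba_delta n, \<lambda>n e S. nba_final n, \<lambda>n e S. nba n,
      \<lambda>n e S. grow (e 0),
      \<lambda>n e S. fst (step n (e 0) (e 1) (e 2) (S 0) (e 3)),
      \<lambda>n e S. snd (step n (e 0) (e 1) (e 2) (S 0) (e 3)),
      \<lambda>n e S. e 0 - e 1,
      \<lambda>n e S. fold_pos (e 0) (e 1) (e 2),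
      \<lambda>n e S. LEAST y. pr (e 0) y \<in> S 0,
      \<lambda>n e S. LEAST z. e 0 \<le> z \<and> has_index (S 0) (e 1) z \<and> \<not> has_index (S 0) (e 1) (Suc z)}"

text \<open>The first family consists of the sets of least witnesses that have to miss the end of
  the cut, the second of the sets required by comprehension; the rest are the words and the run that
  are used explicitly.\<close>

definition set_ops :: "nat set operation set" where
  "set_ops =
     range (\<lambda>\<phi> n e S. (\<lambda>x. LEAST y. holds (case_nat y (case_nat x (tail e))) S \<phi>) ` {..e 0})
   \<union> range (\<lambda>(\<theta>, \<eta>) n e S. {x. \<exists>y<e 0. holds (case_nat y (case_nat x (tail e))) S \<theta> \<and>
       (\<forall>y'\<le>y. holds (case_nat y' (case_nat x (tail e))) S \<eta>)})
   \<union> {\<lambda>n e S. graph_of (colour n),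
      \<lambda>n e S. graph_of (\<lambda>s. colour n (fold_pos (e 0) (e 1) s)),
      \<lambda>n e S. graph_of (nba_run (\<lambda>s. colour n (fold_pos (e 0) (e 1) s)) (e 2))}"

lemma num_opsI:
  fixes t :: tm and \<phi> :: fm and i :: nat
  shows
    "(\<lambda>n e S. val e t) \<in> num_ops"
    "(\<lambda>n e S. LEAST y. holds (case_nat y e) S \<phi>) \<in> num_ops"
    "(\<lambda>n e S. LEAST c. \<exists>m\<le>e 0. holds (case_nat m (case_nat c (tail e))) S \<phi>) \<in> num_ops"
    "(\<lambda>n e S. LEAST x. \<not> (\<exists>y\<le>e 0. holds (case_nat y (case_nat x (tail e))) S \<phi>)) \<in> num_ops"
    "(\<lambda>n e S. n - i) \<in> num_ops"
    "(\<lambda>n e S. colour_end n) \<in> num_ops"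
    "(\<lambda>n e S. nba_alphabet n) \<in> num_ops"
    "(\<lambda>n e S. nba_states n) \<in> num_ops"
    "(\<lambda>n e S. nba_delta n) \<in> num_ops"
    "(\<lambda>n e S. nba_final n) \<in> num_ops"
    "(\<lambda>n e S. nba n) \<in> num_ops"
    "(\<lambda>n e S. grow (e 0)) \<in> num_ops"
    "(\<lambda>n e S. fst (step n (e 0) (e 1) (e 2) (S 0) (e 3))) \<in> num_ops"
    "(\<lambda>n e S. snd (step n (e 0) (e 1) (e 2) (S 0) (e 3))) \<in> num_ops"
    "(\<lambda>n e S. e 0 - e 1) \<in> num_ops"
    "(\<lambda>n e S. fold_pos (e 0) (e 1) (e 2)) \<in> num_ops"
    "(\<lambda>n e S. LEAST y. pr (e 0) y \<in> S 0) \<in> num_ops"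
    "(\<lambda>n e S. LEAST z. e 0 \<le> z \<and> has_index (S 0) (e 1) z \<and> \<not> has_index (S 0) (e 1) (Suc z)) \<in> num_ops"
proof -
  show "(\<lambda>n e S. val e t) \<in> num_ops"
    unfolding num_ops_def
    by (rule UnI1, rule UnI1, rule UnI1, rule UnI1, rule UnI1, rule image_eqI[where x = t], rule refl, rule UNIV_I)
  show "(\<lambda>n e S. LEAST y. holds (case_nat y e) S \<phi>) \<in> num_ops"
    unfolding num_ops_def
    by (rule UnI1, rule UnI1, rule UnI1, rule UnI1, rule UnI2, rule image_eqI[where x = \<phi>], rule refl, rule UNIV_I)
  show "(\<lambda>n e S. LEAST c. \<exists>m\<le>e 0. holds (case_nat m (case_nat c (tail e))) S \<phi>) \<in> num_ops"
    unfolding num_ops_def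
    by (rule UnI1, rule UnI1, rule UnI1, rule UnI2, rule image_eqI[where x = \<phi>], rule refl, rule UNIV_I)
  show "(\<lambda>n e S. LEAST x. \<not> (\<exists>y\<le>e 0. holds (case_nat y (case_nat x (tail e))) S \<phi>)) \<in> num_ops"
    unfolding num_ops_def
    by (rule UnI1, rule UnI1, rule UnI2, rule image_eqI[where x = \<phi>], rule refl, rule UNIV_I)
  show "(\<lambda>n e S. n - i) \<in> num_ops"
    unfolding num_ops_def
    by (rule UnI1, rule UnI2, rule image_eqI[where x = i], rule refl, rule UNIV_I)
qed (simp_all only: num_ops_def Un_iff insert_iff simp_thms)

lemma set_opsI:
  fixes \<phi> \<theta> \<eta> :: fm
  shows
    "(\<lambda>n e S. (\<lambda>x. LEAST y. holds (case_nat y (case_nat x (tail e))) S \<phi>) ` {..e 0}) \<in> set_ops"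
    "(\<lambda>n e S. {x. \<exists>y<e 0. holds (case_nat y (case_nat x (tail e))) S \<theta> \<and>
       (\<forall>y'\<le>y. holds (case_nat y' (case_nat x (tail e))) S \<eta>)}) \<in> set_ops"
    "(\<lambda>n e S. graph_of (colour n)) \<in> set_ops"
    "(\<lambda>n e S. graph_of (\<lambda>s. colour n (fold_pos (e 0) (e 1) s))) \<in> set_ops"
    "(\<lambda>n e S. graph_of (nba_run (\<lambda>s. colour n (fold_pos (e 0) (e 1) s)) (e 2))) \<in> set_ops"
proof -
  show "(\<lambda>n e S. (\<lambda>x. LEAST y. holds (case_nat y (case_nat x (tail e))) S \<phi>) ` {..e 0}) \<in> set_ops"
    unfolding set_ops_def
    by (rule UnI1, rule UnI1, rule image_eqI[where x = \<phi>], simp, rule UNIV_I)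
  show "(\<lambda>n e S. {x. \<exists>y<e 0. holds (case_nat y (case_nat x (tail e))) S \<theta> \<and>
       (\<forall>y'\<le>y. holds (case_nat y' (case_nat x (tail e))) S \<eta>)}) \<in> set_ops"
    unfolding set_ops_def
    by (rule UnI1, rule UnI2, rule image_eqI[where x = "(\<theta>, \<eta>)"], simp, rule UNIV_I)
qed (simp_all only: set_ops_def Un_iff insert_iff simp_thms)

section \<open>Finite support and countability of the operations\<close>

definition ops :: "nat set operation set" where
  "ops = set_ops \<union> (\<lambda>g n e S. {g n e S}) ` num_ops"

lemma agree_tail: "agree (Suc N) e e' \<Longrightarrow> agree N (tail e) (tail e')"
  by (auto simp: agree_def tail_def)

lemma agree_0: "agree (Suc N) e e' \<Longrightarrow> e 0 = e' 0"
  by (auto simp: agree_def)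

lemma agree_Suc: "agree (Suc N) e e' \<Longrightarrow> agree N e e'"
  by (auto simp: agree_def)

lemma holds_tail_support:
  "\<exists>N. \<forall>e e' S S'. agree N e e' \<longrightarrow> agree N S S' \<longrightarrow> e 0 = e' 0 \<and>
     (\<lambda>x y. holds (case_nat y (case_nat x (tail e))) S \<phi>) =
     (\<lambda>x y. holds (case_nat y (case_nat x (tail e'))) S' \<phi>)"
proof -
  obtain N where N: "\<forall>e e' S S'. agree N e e' \<longrightarrow> agree N S S' \<longrightarrow> holds e S \<phi> = holds e' S' \<phi>"
    using holds_finite_support[of \<phi>] ..
  show ?thesis
  proof (intro exI[of _ "Suc N"] allI impI conjI ext)
    fix e e' :: "nat \<Rightarrow> nat" and S S' :: "nat \<Rightarrow> nat set" and x y
    assume a: "agree (Suc N) e e'" "agree (Suc N) S S'"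
    show "e 0 = e' 0" by (rule agree_0[OF a(1)])
    show "holds (case_nat y (case_nat x (tail e))) S \<phi> = holds (case_nat y (case_nat x (tail e'))) S' \<phi>"
      by (rule N[rule_format, OF agree_case_nat[OF agree_case_nat[OF agree_tail[OF a(1)]]] agree_Suc[OF a(2)]])
  qed
qed

lemma finite_support_num_ops: "g \<in> num_ops \<Longrightarrow> finite_support g"
proof -
  have val: "finite_support (\<lambda>n e S. val e t)" for t
    unfolding finite_support_def using val_finite_support[of t] by metis
  have least: "finite_support (\<lambda>n e S. LEAST y. holds (case_nat y e) S \<phi>)" for \<phi>
  proof -
    obtain N where N: "\<forall>e e' S S'. agree N e e' \<longrightarrow> agree N S S' \<longrightarrow> holds e S \<phi> = holds e' S' \<phi>"
      using holds_finite_support[of \<phi>] ..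
    have "(LEAST y. holds (case_nat y e) S \<phi>) = (LEAST y. holds (case_nat y e') S' \<phi>)"
      if "agree N e e'" "agree N S S'" for e e' S S'
      using N[rule_format, OF agree_case_nat[OF that(1)] that(2)] by simp
    then show ?thesis unfolding finite_support_def by blast
  qed
  have two: "finite_support (\<lambda>n e S. LEAST c. \<exists>m\<le>e 0. holds (case_nat m (case_nat c (tail e))) S \<phi>)" for \<phi>
  proof -
    obtain N where N: "\<forall>e e' S S'. agree N e e' \<longrightarrow> agree N S S' \<longrightarrow> e 0 = e' 0 \<and>
     (\<lambda>x y. holds (case_nat y (case_nat x (tail e))) S \<phi>) =
     (\<lambda>x y. holds (case_nat y (case_nat x (tail e'))) S' \<phi>)"
      using holds_tail_support[of \<phi>] ..
    show ?thesis
      unfolding finite_support_def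
      by (intro exI[of _ N] allI impI, drule (1) N[rule_format], simp add: fun_eq_iff)
  qed
  have ind: "finite_support (\<lambda>n e S. LEAST x. \<not> (\<exists>y\<le>e 0. holds (case_nat y (case_nat x (tail e))) S \<phi>))" for \<phi>
  proof -
    obtain N where N: "\<forall>e e' S S'. agree N e e' \<longrightarrow> agree N S S' \<longrightarrow> e 0 = e' 0 \<and>
     (\<lambda>x y. holds (case_nat y (case_nat x (tail e))) S \<phi>) =
     (\<lambda>x y. holds (case_nat y (case_nat x (tail e'))) S' \<phi>)"
      using holds_tail_support[of \<phi>] ..
    show ?thesis
      unfolding finite_support_def
      by (intro exI[of _ N] allI impI, drule (1) N[rule_format], simp add: fun_eq_iff)
  qed
  show "finite_support g" if "g \<in> num_ops"
    using that unfolding num_ops_def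
    by (elim UnE insertE emptyE rangeE; simp only: val least two ind)
      (unfold finite_support_def; rule exI[of _ 4]; simp add: agree_def)+
qed

lemma finite_support_ops: "F \<in> ops \<Longrightarrow> finite_support F"
proof -
  have W: "finite_support (\<lambda>n e S. (\<lambda>x. LEAST y. holds (case_nat y (case_nat x (tail e))) S \<phi>) ` {..e 0})" for \<phi>
  proof -
    obtain N where N: "\<forall>e e' S S'. agree N e e' \<longrightarrow> agree N S S' \<longrightarrow> e 0 = e' 0 \<and>
     (\<lambda>x y. holds (case_nat y (case_nat x (tail e))) S \<phi>) =
     (\<lambda>x y. holds (case_nat y (case_nat x (tail e'))) S' \<phi>)"
      using holds_tail_support[of \<phi>] ..
    show ?thesis
      unfolding finite_support_def
      by (intro exI[of _ N] allI impI, drule (1) N[rule_format], simp add: fun_eq_iff)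
  qed
  have CA: "finite_support (\<lambda>n e S. {x. \<exists>y<e 0. holds (case_nat y (case_nat x (tail e))) S \<theta> \<and>
       (\<forall>y'\<le>y. holds (case_nat y' (case_nat x (tail e))) S \<eta>)})" for \<theta> \<eta>
  proof -
    obtain M where M: "\<forall>e e' S S'. agree M e e' \<longrightarrow> agree M S S' \<longrightarrow> e 0 = e' 0 \<and>
     (\<lambda>x y. holds (case_nat y (case_nat x (tail e))) S \<theta>) =
     (\<lambda>x y. holds (case_nat y (case_nat x (tail e'))) S' \<theta>)"
      using holds_tail_support[of \<theta>] ..
    obtain L where L: "\<forall>e e' S S'. agree L e e' \<longrightarrow> agree L S S' \<longrightarrow> e 0 = e' 0 \<and>
     (\<lambda>x y. holds (case_nat y (case_nat x (tail e))) S \<eta>) =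
     (\<lambda>x y. holds (case_nat y (case_nat x (tail e'))) S' \<eta>)"
      using holds_tail_support[of \<eta>] ..
    show ?thesis unfolding finite_support_def
    proof (intro exI[of _ "max M L"] allI impI)
      fix n and e e' :: "nat \<Rightarrow> nat" and S S' :: "nat \<Rightarrow> nat set"
      assume "agree (max M L) e e'" "agree (max M L) S S'"
      then have a: "agree M e e'" "agree M S S'" "agree L e e'" "agree L S S'"
        by (auto elim: agree_mono)
      show "{x. \<exists>y<e 0. holds (case_nat y (case_nat x (tail e))) S \<theta> \<and>
          (\<forall>y'\<le>y. holds (case_nat y' (case_nat x (tail e))) S \<eta>)} =
        {x. \<exists>y<e' 0. holds (case_nat y (case_nat x (tail e'))) S' \<theta> \<and>
          (\<forall>y'\<le>y. holds (case_nat y' (case_nat x (tail e'))) S' \<eta>)}"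
        using M[rule_format, OF a(1,2)] L[rule_format, OF a(3,4)] by (simp add: fun_eq_iff)
    qed
  qed
  have set: "finite_support F" if "F \<in> set_ops"
    using that unfolding set_ops_def
    by (elim UnE insertE emptyE rangeE; simp only: W CA split_def)
      (unfold finite_support_def; rule exI[of _ 4]; simp add: agree_def)+
  have num: "finite_support (\<lambda>n e S. {g n e S})" if "g \<in> num_ops" for g
    using finite_support_num_ops[OF that] unfolding finite_support_def by metis
  show "finite_support F" if "F \<in> ops"
    using that set num unfolding ops_def by blast
qed

instance tm :: countable by countable_datatype
instance fm :: countable by countable_datatype

lemma countable_ops: "countable ops"
  unfolding ops_def num_ops_def set_ops_def by simp

section \<open>The model\<close>

text \<open>After stage \<open>i\<close> there are \<open>n - i\<close> levels left. Stages beyond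
  \<open>n\<close> are meaningless, but a fixed \<open>i\<close> exceeds \<open>n\<close> at
  finitely many indices only, and \<open>U\<close> ignores these.\<close>

primrec interval ::
  "(nat \<Rightarrow> (nat \<Rightarrow> nat set) \<times> (nat \<Rightarrow> nat)) \<Rightarrow> nat \<Rightarrow> nat \<Rightarrow> nat \<times> nat" where
  "interval \<rho> 0 n = (n, colour_end n)"
| "interval \<rho> (Suc i) n = step n (n - Suc i) (fst (interval \<rho> i n)) (snd (interval \<rho> i n))
     (fst (\<rho> i) n) (snd (\<rho> i) n)"

lemma good_interval:
  "i \<le> n \<Longrightarrow> good grow (colour n) (n - i) (fst (interval \<rho> i n)) (snd (interval \<rho> i n))"
proof (induction i)
  case 0
  then show ?case by (simp add: good_colour)
next
  case (Suc i)
  then have "n - i = Suc (n - Suc i)" by simp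
  with Suc step[of n "n - Suc i" "fst (interval \<rho> i n)" "snd (interval \<rho> i n)"] show ?case
    by (metis Suc_leD interval.simps(2) prod.collapse)
qed

lemma interval_Suc:
  assumes "i < n"
  shows "grow (fst (interval \<rho> i n)) \<le> fst (interval \<rho> (Suc i) n)"
    "fst (interval \<rho> i n) \<le> fst (interval \<rho> (Suc i) n)"
    "snd (interval \<rho> (Suc i) n) \<le> snd (interval \<rho> i n)"
    "finite (fst (\<rho> i) n) \<Longrightarrow> card (fst (\<rho> i) n) \<le> Suc (fst (interval \<rho> i n)) \<Longrightarrow>
      x \<in> fst (\<rho> i) n \<Longrightarrow> x < fst (interval \<rho> (Suc i) n) \<or> snd (interval \<rho> (Suc i) n) \<le> x"
    "fst (interval \<rho> (Suc i) n) \<le> x \<Longrightarrow> x < snd (interval \<rho> (Suc i) n) \<Longrightarrow> colour n x \<noteq> snd (\<rho> i) n"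
proof -
  have "good grow (colour n) (Suc (n - Suc i)) (fst (interval \<rho> i n)) (snd (interval \<rho> i n))"
    using good_interval[of i n \<rho>] assms by (simp add: Suc_diff_Suc)
  from step[OF this, of "fst (\<rho> i) n" "snd (\<rho> i) n" "fst (interval \<rho> (Suc i) n)" "snd (interval \<rho> (Suc i) n)"]
  have *: "grow (fst (interval \<rho> i n)) \<le> fst (interval \<rho> (Suc i) n) \<and>
    fst (interval \<rho> i n) \<le> fst (interval \<rho> (Suc i) n) \<and>
    snd (interval \<rho> (Suc i) n) \<le> snd (interval \<rho> i n) \<and>
    (finite (fst (\<rho> i) n) \<and> card (fst (\<rho> i) n) \<le> Suc (fst (interval \<rho> i n)) \<longrightarrow>
      fst (\<rho> i) n \<inter> {fst (interval \<rho> (Suc i) n)..<snd (interval \<rho> (Suc i) n)} = {}) \<and>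
    snd (\<rho> i) n \<notin> colour n ` {fst (interval \<rho> (Suc i) n)..<snd (interval \<rho> (Suc i) n)}"
    by simp
  then show "grow (fst (interval \<rho> i n)) \<le> fst (interval \<rho> (Suc i) n)"
    "fst (interval \<rho> i n) \<le> fst (interval \<rho> (Suc i) n)"
    "snd (interval \<rho> (Suc i) n) \<le> snd (interval \<rho> i n)" by blast+
  show "x < fst (interval \<rho> (Suc i) n) \<or> snd (interval \<rho> (Suc i) n) \<le> x"
    if "finite (fst (\<rho> i) n)" "card (fst (\<rho> i) n) \<le> Suc (fst (interval \<rho> i n))" "x \<in> fst (\<rho> i) n"
  proof -
    have "fst (\<rho> i) n \<inter> {fst (interval \<rho> (Suc i) n)..<snd (interval \<rho> (Suc i) n)} = {}"
      using * that(1,2) by simp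
    then have "x \<notin> {fst (interval \<rho> (Suc i) n)..<snd (interval \<rho> (Suc i) n)}" using that(3) by blast
    then show ?thesis unfolding atLeastLessThan_iff by linarith
  qed
  show "colour n x \<noteq> snd (\<rho> i) n"
    if "fst (interval \<rho> (Suc i) n) \<le> x" "x < snd (interval \<rho> (Suc i) n)"
  proof
    assume eq: "colour n x = snd (\<rho> i) n"
    have "colour n x \<in> colour n ` {fst (interval \<rho> (Suc i) n)..<snd (interval \<rho> (Suc i) n)}"
      using that by (intro imageI) simp
    then show False using * unfolding eq by blast
  qed
qed

text \<open>
  The schedule \<open>\<rho>\<close> lists every pair of an internal set and a colour infinitely often: a set \<open>W\<close> can
  only be avoided at a stage whose left end point is already at least \<open>card W - 1\<close>.
\<close>

locale generic_cut =
  fixes U :: "nat filter" and D :: "(nat \<Rightarrow> nat set) set"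
    and \<rho> :: "nat \<Rightarrow> (nat \<Rightarrow> nat set) \<times> (nat \<Rightarrow> nat)"
  assumes ultra: "ultra U"
    and large: "\<forall>\<^sub>F n in U. i < n"
    and closed: "F \<in> ops \<Longrightarrow> closed_under D F"
    and zero: "(\<lambda>n. {0}) \<in> D"
    and sched: "fst (\<rho> i) \<in> D" "(\<lambda>n. {snd (\<rho> i) n}) \<in> D"
    and generic: "W \<in> D \<Longrightarrow> (\<lambda>n. {c n}) \<in> D \<Longrightarrow> \<exists>i\<ge>j. \<rho> i = (W, c)"
begin

definition N :: "(nat \<Rightarrow> nat) set" where "N = {h. (\<lambda>n. {h n}) \<in> D}"

definition lo :: "nat \<Rightarrow> nat \<Rightarrow> nat" where "lo i n = fst (interval \<rho> i n)"
definition hi :: "nat \<Rightarrow> nat \<Rightarrow> nat" where "hi i n = snd (interval \<rho> i n)"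

text \<open>The initial segment of the internal numbers \<open>N\<close> in which the left end
  points are cofinal. It stays below every right end point, so each interval from
  \<open>lo i\<close> to \<open>hi i\<close> straddles the end of the cut, and what misses such an
  interval cannot accumulate there.\<close>

definition K :: "(nat \<Rightarrow> nat) set" where
  "K = {h \<in> N. \<exists>i. \<forall>\<^sub>F n in U. h n \<le> lo i n}"

sublocale internal_model U K D .

lemma N_0: "(\<lambda>n. 0) \<in> N"
  using zero by (simp add: N_def)

lemma set_op: "F \<in> set_ops \<Longrightarrow> (\<And>i. e i \<in> N) \<Longrightarrow> (\<And>i. S i \<in> D) \<Longrightarrow>
    (\<lambda>n. F n (\<lambda>i. e i n) (\<lambda>i. S i n)) \<in> D"
  using closed[of F] unfolding ops_def closed_under_def N_def by blast

lemma num_op: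
  assumes "g \<in> num_ops" "\<And>i. e i \<in> N" "\<And>i. S i \<in> D"
  shows "(\<lambda>n. g n (\<lambda>i. e i n) (\<lambda>i. S i n)) \<in> N"
proof -
  have "closed_under D (\<lambda>n e S. {g n e S})" using assms(1) by (intro closed) (simp add: ops_def)
  then show ?thesis using assms(2,3) unfolding closed_under_def N_def by simp
qed

lemma case_nat_mem: "a \<in> A \<Longrightarrow> (\<And>i. e i \<in> A) \<Longrightarrow> case_nat a e i \<in> A"
  by (cases i) auto

lemma case_nat_app: "(\<lambda>i. case_nat a e i n) = case_nat (a n) (\<lambda>i. e i n)"
  by (auto simp: fun_eq_iff split: nat.splits)

lemma num_op4:
  assumes "g \<in> num_ops" "a \<in> N" "b \<in> N" "c \<in> N" "d \<in> N" "X \<in> D"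
  shows "(\<lambda>n. g n (case_nat (a n) (case_nat (b n) (case_nat (c n) (\<lambda>_. d n)))) (\<lambda>_. X n)) \<in> N"
  using num_op[OF assms(1), of "case_nat a (case_nat b (case_nat c (\<lambda>_. d)))" "\<lambda>_. X"] assms
  by (simp add: case_nat_app case_nat_mem)

lemma set_op4:
  assumes "g \<in> set_ops" "a \<in> N" "b \<in> N" "c \<in> N" "d \<in> N" "X \<in> D"
  shows "(\<lambda>n. g n (case_nat (a n) (case_nat (b n) (case_nat (c n) (\<lambda>_. d n)))) (\<lambda>_. X n)) \<in> D"
  using set_op[OF assms(1), of "case_nat a (case_nat b (case_nat c (\<lambda>_. d)))" "\<lambda>_. X"] assms
  by (simp add: case_nat_app case_nat_mem)

lemma num_op0:
  assumes "(\<lambda>n e S. h n) \<in> num_ops" shows "h \<in> N"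
  using num_op4[OF assms N_0 N_0 N_0 N_0 zero] by simp

text \<open>A standard stage is a finite composition of operations of \<open>D\<close> applied to
  scheduled objects of \<open>D\<close>. Thus the end points are internal numbers themselves, and
  the left ones can belong to the cut.\<close>

lemma lo_hi_N: "lo i \<in> N \<and> hi i \<in> N"
proof (induction i)
  case 0
  have "(\<lambda>n e S. n - 0) \<in> num_ops" and "(\<lambda>n e S. colour_end n) \<in> num_ops" by (rule num_opsI)+
  then have "(\<lambda>n. n - 0) \<in> N" "colour_end \<in> N" by (auto intro: num_op0)
  then show ?case by (simp add: lo_def[abs_def] hi_def[abs_def])
next
  case (Suc i)
  have "(\<lambda>n e S. n - Suc i) \<in> num_ops" by (rule num_opsI)
  from num_op0[OF this] have lev: "(\<lambda>n. n - Suc i) \<in> N" .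
  have "snd (\<rho> i) \<in> N" "fst (\<rho> i) \<in> D" using sched by (auto simp: N_def)
  note mem = lev conjunct1[OF Suc] conjunct2[OF Suc] this
  have 1: "(\<lambda>n e S. fst (step n (e 0) (e 1) (e 2) (S 0) (e 3))) \<in> num_ops"
    and 2: "(\<lambda>n e S. snd (step n (e 0) (e 1) (e 2) (S 0) (e 3))) \<in> num_ops"
    by (rule num_opsI)+
  show ?case using num_op4[OF 1 mem] num_op4[OF 2 mem]
    by (simp add: lo_def[abs_def] hi_def[abs_def] numeral_2_eq_2 numeral_3_eq_3)
qed

lemma lo_Suc: "\<forall>\<^sub>F n in U. grow (lo i n) \<le> lo (Suc i) n"
  and lo_Suc': "\<forall>\<^sub>F n in U. lo i n \<le> lo (Suc i) n"
  and hi_Suc: "\<forall>\<^sub>F n in U. hi (Suc i) n \<le> hi i n"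
  and avoid_set: "\<forall>\<^sub>F n in U. finite (fst (\<rho> i) n) \<longrightarrow> card (fst (\<rho> i) n) \<le> Suc (lo i n) \<longrightarrow>
      (\<forall>x\<in>fst (\<rho> i) n. x < lo (Suc i) n \<or> hi (Suc i) n \<le> x)"
  and avoid_colour: "\<forall>\<^sub>F n in U. \<forall>x. lo (Suc i) n \<le> x \<longrightarrow> x < hi (Suc i) n \<longrightarrow> colour n x \<noteq> snd (\<rho> i) n"
  unfolding lo_def hi_def
  by (rule eventually_mono[OF large[of i]], erule interval_Suc,
      rule eventually_mono[OF large[of i]], erule interval_Suc,
      rule eventually_mono[OF large[of i]], erule interval_Suc,
      rule eventually_mono[OF large[of i]], intro impI ballI, rule interval_Suc(4), assumption+,
      rule eventually_mono[OF large[of i]], intro impI allI, rule interval_Suc(5), assumption+)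

lemma lo_less_hi: "\<forall>\<^sub>F n in U. lo i n < hi i n"
  using large[of i]
  by (rule eventually_mono) (unfold lo_def hi_def, metis good_interval good_less less_imp_le)

lemma lo_mono: "i \<le> j \<Longrightarrow> \<forall>\<^sub>F n in U. lo i n \<le> lo j n"
proof (induction j rule: dec_induct)
  case (step j)
  show ?case using step(3) lo_Suc'[of j] by eventually_elim simp
qed simp

lemma hi_mono: "i \<le> j \<Longrightarrow> \<forall>\<^sub>F n in U. hi j n \<le> hi i n"
proof (induction j rule: dec_induct)
  case (step j)
  show ?case using step(3) hi_Suc[of j] by eventually_elim simp
qed simp

section \<open>Closure properties of the cut\<close>

lemma K_N: "h \<in> K \<Longrightarrow> h \<in> N" by (simp add: K_def)

lemma K_less_hi:
  assumes "h \<in> K" shows "\<forall>\<^sub>F n in U. h n < hi i n"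
proof -
  obtain j where "\<forall>\<^sub>F n in U. h n \<le> lo j n" using assms by (auto simp: K_def)
  moreover have "\<forall>\<^sub>F n in U. lo j n \<le> lo (max i j) n" "\<forall>\<^sub>F n in U. hi (max i j) n \<le> hi i n"
    by (auto intro: lo_mono hi_mono)
  ultimately show ?thesis using lo_less_hi[of "max i j"] by eventually_elim linarith
qed

lemma K_down:
  assumes "h \<in> N" "g \<in> K" "\<forall>\<^sub>F n in U. h n \<le> g n" shows "h \<in> K"
proof -
  obtain j where "\<forall>\<^sub>F n in U. g n \<le> lo j n" using assms by (auto simp: K_def)
  with assms(3) have "\<forall>\<^sub>F n in U. h n \<le> lo j n" by eventually_elim simp
  then show ?thesis using assms(1) by (auto simp: K_def)
qed

lemma lo_K: "lo i \<in> K"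
  unfolding K_def using lo_hi_N[of i] by (auto intro: exI[of _ i])

lemma K_bound2:
  assumes "g \<in> K" "h \<in> K"
  obtains i where "\<forall>\<^sub>F n in U. g n \<le> lo i n" "\<forall>\<^sub>F n in U. h n \<le> lo i n"
proof -
  from assms obtain i j where *: "\<forall>\<^sub>F n in U. g n \<le> lo i n" "\<forall>\<^sub>F n in U. h n \<le> lo j n"
    by (auto simp: K_def)
  have ij: "\<forall>\<^sub>F n in U. lo i n \<le> lo (max i j) n" "\<forall>\<^sub>F n in U. lo j n \<le> lo (max i j) n"
    by (auto intro: lo_mono)
  have "\<forall>\<^sub>F n in U. g n \<le> lo (max i j) n" using *(1) ij(1) by eventually_elim linarith
  moreover have "\<forall>\<^sub>F n in U. h n \<le> lo (max i j) n" using *(2) ij(2) by eventually_elim linarith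
  ultimately show ?thesis by (rule that)
qed

lemma N_term:
  assumes "\<And>i. e i \<in> N" shows "evs e t \<in> N"
proof -
  have "(\<lambda>n e S. val e t) \<in> num_ops" by (rule num_opsI)
  from num_op[OF this assms, of "\<lambda>_ n. {0}"] zero show ?thesis by (simp add: evs_def)
qed

lemma N_term2:
  assumes "a \<in> N" "b \<in> N" shows "(\<lambda>n. val (case_nat (a n) (\<lambda>_. b n)) t) \<in> N"
  using N_term[of "case_nat a (\<lambda>_. b)" t] assms by (simp add: evs_def case_nat_mem case_nat_app)

lemma K_0: "(\<lambda>n. 0) \<in> K"
  using N_0 by (auto simp: K_def)

lemma K_grow: assumes "g \<in> K" shows "(\<lambda>n. grow (g n)) \<in> K"
proof -
  obtain i where i: "\<forall>\<^sub>F n in U. g n \<le> lo i n" using assms by (auto simp: K_def)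
  have "(\<lambda>n e S. grow (e 0)) \<in> num_ops" by (rule num_opsI)
  from num_op4[OF this K_N[OF assms] N_0 N_0 N_0 zero] have "(\<lambda>n. grow (g n)) \<in> N" by simp
  moreover have "\<forall>\<^sub>F n in U. grow (g n) \<le> lo (Suc i) n"
    using i lo_Suc[of i] by eventually_elim (meson grow_mono le_trans)
  ultimately show ?thesis by (auto simp: K_def)
qed

lemma K_Suc: assumes "g \<in> K" shows "(\<lambda>n. Suc (g n)) \<in> K"
proof (rule K_down[OF _ K_grow[OF assms]])
  show "(\<lambda>n. Suc (g n)) \<in> N" using N_term2[of g g "Succ (Var 0)"] K_N[OF assms] by simp
qed (simp add: Suc_le_grow)

lemma K_add: assumes "g \<in> K" "h \<in> K" shows "(\<lambda>n. g n + h n) \<in> K"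
proof -
  obtain i where i: "\<forall>\<^sub>F n in U. g n \<le> lo i n" "\<forall>\<^sub>F n in U. h n \<le> lo i n"
    using assms by (rule K_bound2)
  show ?thesis
  proof (rule K_down[OF _ K_grow[OF lo_K[of i]]])
    show "(\<lambda>n. g n + h n) \<in> N" using N_term2[of g h "Var 0 \<^bold>+ Var 1"] assms K_N by simp
    show "\<forall>\<^sub>F n in U. g n + h n \<le> grow (lo i n)" using i by eventually_elim (rule add_le_grow)
  qed
qed

lemma K_mult: assumes "g \<in> K" "h \<in> K" shows "(\<lambda>n. g n * h n) \<in> K"
proof -
  obtain i where i: "\<forall>\<^sub>F n in U. g n \<le> lo i n" "\<forall>\<^sub>F n in U. h n \<le> lo i n"
    using assms by (rule K_bound2)
  show ?thesis
  proof (rule K_down[OF _ K_grow[OF lo_K[of i]]])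
    show "(\<lambda>n. g n * h n) \<in> N" using N_term2[of g h "Var 0 \<^bold>* Var 1"] assms K_N by simp
    show "\<forall>\<^sub>F n in U. g n * h n \<le> grow (lo i n)" using i by eventually_elim (rule mult_le_grow)
  qed
qed

lemma K_term: "(\<And>i. e i \<in> K) \<Longrightarrow> evs e t \<in> K"
  by (induction t) (auto simp: K_0 K_Suc K_add K_mult)

text \<open>The first left end point is the diagonal number, so the nonstandard size of the alphabet
  is a number of the model.\<close>

lemma K_id: "(\<lambda>n. n) \<in> K"
  using lo_K[of 0] by (simp add: lo_def[abs_def])


section \<open>Absoluteness of bounded formulas\<close>

text \<open>The equivalence of Los's theorem at one environment: truth in the cut against truth at
  almost every index.\<close>

definition abs_at :: "(nat \<Rightarrow> nat \<Rightarrow> nat) \<Rightarrow> (nat \<Rightarrow> nat \<Rightarrow> nat set) \<Rightarrow> fm \<Rightarrow> bool" where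
  "abs_at e S \<phi> \<longleftrightarrow> (sat e S \<phi> \<longleftrightarrow> (\<forall>\<^sub>F n in U. holds (\<lambda>i. e i n) (\<lambda>i. S i n) \<phi>))"

definition absolute :: "fm \<Rightarrow> bool" where
  "absolute \<phi> \<longleftrightarrow> (\<forall>e S. (\<forall>i. e i \<in> K) \<longrightarrow> (\<forall>i. S i \<in> D) \<longrightarrow> abs_at e S \<phi>)"

lemma absoluteD: "absolute \<phi> \<Longrightarrow> (\<And>i. e i \<in> K) \<Longrightarrow> (\<And>i. S i \<in> D) \<Longrightarrow> abs_at e S \<phi>"
  by (simp add: absolute_def)

lemma abs_at_atoms: "abs_at e S Falsum" "abs_at e S (t \<^bold>= u)" "abs_at e S (t \<^bold>< u)" "abs_at e S (t \<^bold>\<in> X)"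
  using ultra by (auto simp: abs_at_def evs_def ultra_def)

lemma abs_at_conn:
  assumes "abs_at e S \<phi>" "abs_at e S \<psi>"
  shows "abs_at e S (\<phi> \<^bold>\<and> \<psi>)" "abs_at e S (\<phi> \<^bold>\<or> \<psi>)" "abs_at e S (\<phi> \<^bold>\<longrightarrow> \<psi>)"
  using assms by (simp_all add: abs_at_def eventually_conj_iff ultra_disj[OF ultra] ultra_imp[OF ultra])

lemma absolute_atoms [simp, intro]: "absolute Falsum" "absolute (t \<^bold>= u)" "absolute (t \<^bold>< u)" "absolute (t \<^bold>\<in> X)"
  by (auto simp: absolute_def abs_at_atoms)

lemma absolute_conn [simp, intro]:
  assumes "absolute \<phi>" "absolute \<psi>"
  shows "absolute (\<phi> \<^bold>\<and> \<psi>)" "absolute (\<phi> \<^bold>\<or> \<psi>)" "absolute (\<phi> \<^bold>\<longrightarrow> \<psi>)"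
  using assms by (auto simp: absolute_def abs_at_conn)

lemma absolute_Neg [simp, intro]: "absolute \<phi> \<Longrightarrow> absolute (\<^bold>\<not> \<phi>)"
  by (simp add: Neg_def)

lemma absolute_Iff [simp, intro]: "absolute \<phi> \<Longrightarrow> absolute \<psi> \<Longrightarrow> absolute (\<phi> \<^bold>\<longleftrightarrow> \<psi>)"
  by (simp add: Iff_def)

lemma N_least:
  assumes "\<And>i. e i \<in> N" "\<And>i. S i \<in> D"
  shows "(\<lambda>n. LEAST y. holds (case_nat y (\<lambda>i. e i n)) (\<lambda>i. S i n) \<phi>) \<in> N"
proof -
  have "(\<lambda>n e S. LEAST y. holds (case_nat y e) S \<phi>) \<in> num_ops" by (rule num_opsI)
  from num_op[OF this, of e S] assms show ?thesis by simp
qed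

text \<open>Closure of \<open>D\<close> under least witnesses provides an internal witness, and the
  bound \<open>h\<close> from \<open>K\<close> keeps it inside the cut.\<close>

lemma abs_at_Ex1:
  assumes "\<And>i. e i \<in> K" "\<And>i. S i \<in> D" "\<And>y. y \<in> K \<Longrightarrow> abs_at (case_nat y e) S \<phi>" "h \<in> K"
    "\<forall>\<^sub>F n in U. (\<exists>y. holds (case_nat y (\<lambda>i. e i n)) (\<lambda>i. S i n) \<phi>) \<longrightarrow>
      (\<exists>y\<le>h n. holds (case_nat y (\<lambda>i. e i n)) (\<lambda>i. S i n) \<phi>)"
  shows "abs_at e S (\<^bold>\<exists>\<^sub>1 \<phi>)"
  unfolding abs_at_def
proof
  assume "sat e S (\<^bold>\<exists>\<^sub>1 \<phi>)"
  then obtain y where "y \<in> K" "sat (case_nat y e) S \<phi>" by auto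
  then have "\<forall>\<^sub>F n in U. holds (case_nat (y n) (\<lambda>i. e i n)) (\<lambda>i. S i n) \<phi>"
    using assms(3) by (simp add: abs_at_def case_nat_app)
  then show "\<forall>\<^sub>F n in U. holds (\<lambda>i. e i n) (\<lambda>i. S i n) (\<^bold>\<exists>\<^sub>1 \<phi>)"
    by (rule eventually_mono) auto
next
  let ?y = "\<lambda>n. LEAST y. holds (case_nat y (\<lambda>i. e i n)) (\<lambda>i. S i n) \<phi>"
  assume ex: "\<forall>\<^sub>F n in U. holds (\<lambda>i. e i n) (\<lambda>i. S i n) (\<^bold>\<exists>\<^sub>1 \<phi>)"
  have "?y \<in> K"
  proof (rule K_down[OF N_least assms(4)])
    show "\<forall>\<^sub>F n in U. ?y n \<le> h n" using ex assms(5)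
      by eventually_elim (auto intro: Least_le order_trans)
  qed (use assms K_N in auto)
  moreover have "\<forall>\<^sub>F n in U. holds (case_nat (?y n) (\<lambda>i. e i n)) (\<lambda>i. S i n) \<phi>"
    using ex by eventually_elim (auto intro: LeastI)
  ultimately have "sat (case_nat ?y e) S \<phi>" using assms(3) by (simp add: abs_at_def case_nat_app)
  then show "sat e S (\<^bold>\<exists>\<^sub>1 \<phi>)" using \<open>?y \<in> K\<close> by auto
qed

lemma absolute_Ex1:
  assumes "absolute \<phi>" "\<And>e S y. holds (case_nat y e) S \<phi> \<Longrightarrow> y \<le> val e t"
  shows "absolute (\<^bold>\<exists>\<^sub>1 \<phi>)"
  unfolding absolute_def
proof (intro allI impI)
  fix e :: "nat \<Rightarrow> nat \<Rightarrow> nat" and S :: "nat \<Rightarrow> nat \<Rightarrow> nat set"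
  assume *: "\<forall>i. e i \<in> K" "\<forall>i. S i \<in> D"
  show "abs_at e S (\<^bold>\<exists>\<^sub>1 \<phi>)"
  proof (rule abs_at_Ex1[where h = "evs e t"])
    show "\<forall>\<^sub>F n in U. (\<exists>y. holds (case_nat y (\<lambda>i. e i n)) (\<lambda>i. S i n) \<phi>) \<longrightarrow>
      (\<exists>y\<le>evs e t n. holds (case_nat y (\<lambda>i. e i n)) (\<lambda>i. S i n) \<phi>)"
      by (rule always_eventually) (use assms(2) in \<open>auto simp: evs_def\<close>)
  qed (use * assms(1) in \<open>auto intro: K_term absoluteD case_nat_mem\<close>)
qed

lemma absolute_All1:
  assumes "absolute \<phi>" "\<And>e S y. \<not> holds (case_nat y e) S \<phi> \<Longrightarrow> y \<le> val e t"
  shows "absolute (\<^bold>\<forall>\<^sub>1 \<phi>)"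
proof -
  have "absolute (\<^bold>\<exists>\<^sub>1 (\<^bold>\<not> \<phi>))"
    by (rule absolute_Ex1) (use assms in \<open>auto simp: Neg_def\<close>)
  moreover have *: "holds e S (\<^bold>\<exists>\<^sub>1 (\<^bold>\<not> \<phi>)) = (\<not> holds e S (\<^bold>\<forall>\<^sub>1 \<phi>))"
    "sat e' S' (\<^bold>\<exists>\<^sub>1 (\<^bold>\<not> \<phi>)) = (\<not> sat e' S' (\<^bold>\<forall>\<^sub>1 \<phi>))" for e S e' S'
    by (simp_all add: Neg_def)
  ultimately show ?thesis unfolding absolute_def abs_at_def * ultra_not[OF ultra] by blast
qed

lemma absolute_delta0: "delta0 \<phi> \<Longrightarrow> absolute \<phi>"
proof (induction rule: delta0.induct)
  case (8 \<phi> t)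
  show ?case
    by (rule absolute_All1[where t = t]) (use 8 in \<open>auto simp: val_shift\<close>)
next
  case (9 \<phi> t)
  show ?case
    by (rule absolute_Ex1[where t = t]) (use 9 in \<open>auto simp: val_shift\<close>)
qed auto


section \<open>The axioms of RCA0 in the model\<close>

lemma sat_basic_axioms:
  assumes "\<phi> \<in> basic_axioms" "\<And>i. e i \<in> K" "\<And>i. S i \<in> D"
  shows "sat e S \<phi>"
proof -
  have "absolute \<phi>" "\<And>e S. holds e S \<phi>"
    using assms(1) unfolding basic_axioms_def by (auto simp: Neg_def Iff_def)
  then show ?thesis using absoluteD[of \<phi> e S] assms by (simp add: abs_at_def)
qed

text \<open>Semiregularity of the cut. The schedule lists \<open>W\<close> at arbitrarily late
  stages; one of them comes after the left end point has passed \<open>b\<close>, when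
  \<open>W\<close> is small enough to be avoided.\<close>

lemma K_semiregular:
  assumes "W \<in> D" "b \<in> K" "\<And>n. finite (W n)" "\<And>n. card (W n) \<le> Suc (b n)"
  obtains i where "\<forall>\<^sub>F n in U. \<forall>x\<in>W n. x < lo i n \<or> hi i n \<le> x"
proof -
  obtain j where j: "\<forall>\<^sub>F n in U. b n \<le> lo j n" using assms(2) by (auto simp: K_def)
  obtain i where i: "j \<le> i" "\<rho> i = (W, \<lambda>n. 0)" using generic[OF assms(1) zero, of j] by blast
  have "\<forall>\<^sub>F n in U. \<forall>x\<in>W n. x < lo (Suc i) n \<or> hi (Suc i) n \<le> x"
    using j lo_mono[OF i(1)] avoid_set[of i]
  proof eventually_elim
    case (elim n)
    have "card (W n) \<le> Suc (lo i n)" using assms(4)[of n] elim(1,2) by linarith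
    then show ?case using elim(3) assms(3) i(2) by simp
  qed
  then show ?thesis by (rule that)
qed

text \<open>The colour is removed at the stage that schedules it, here together with the dummy set
  \<open>{0}\<close>. Numbers of \<open>K\<close> beyond the new left end point remain in the
  interval, because they are below the right one.\<close>

lemma K_colour_bounded:
  assumes "c \<in> N"
  obtains i where "\<And>x. x \<in> K \<Longrightarrow> \<forall>\<^sub>F n in U. lo i n \<le> x n \<Longrightarrow> \<forall>\<^sub>F n in U. colour n (x n) \<noteq> c n"
proof -
  obtain i where i: "\<rho> i = (\<lambda>n. {0}, c)" using generic[OF zero, of c 0] assms by (auto simp: N_def)
  have "\<forall>\<^sub>F n in U. colour n (x n) \<noteq> c n" if "x \<in> K" "\<forall>\<^sub>F n in U. lo (Suc i) n \<le> x n" for x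
    using avoid_colour[of i] K_less_hi[OF that(1), of "Suc i"] that(2)
    by eventually_elim (use i in auto)
  then show ?thesis by (rule that)
qed

lemma tail_case_nat [simp]: "tail (case_nat x e) = e"
  by (simp add: tail_def)

text \<open>
  The least witnesses for the numbers up to \<open>b\<close> form a set that is not cofinal in the cut, so on
  these numbers a \<open>\<Sigma>\<^sub>1\<close>-formula is equivalent to an internal one.
\<close>

lemma sigma1_eq_bounded:
  assumes \<theta>: "absolute \<theta>" and env: "\<And>i. e i \<in> K" "\<And>i. S i \<in> D" and b: "b \<in> K"
  shows "\<exists>i. \<forall>x\<in>K. (\<forall>\<^sub>F n in U. x n \<le> b n) \<longrightarrow> sat (case_nat x e) S (\<^bold>\<exists>\<^sub>1 \<theta>) =
    (\<forall>\<^sub>F n in U. \<exists>y\<le>lo i n. holds (case_nat y (case_nat (x n) (\<lambda>i. e i n))) (\<lambda>i. S i n) \<theta>)"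
proof -
  define P where "P = (\<lambda>n x y. holds (case_nat y (case_nat x (\<lambda>i. e i n))) (\<lambda>i. S i n) \<theta>)"
  define W where "W n = (\<lambda>x. LEAST y. P n x y) ` {..b n}" for n
  have "(\<lambda>n e S. (\<lambda>x. LEAST y. holds (case_nat y (case_nat x (tail e))) S \<theta>) ` {..e 0}) \<in> set_ops"
    by (rule set_opsI)
  from set_op[OF this, of "case_nat b e" S] have W: "W \<in> D"
    using env b K_N by (simp add: W_def[abs_def] P_def case_nat_mem case_nat_app)
  have fin: "finite (W n)" "card (W n) \<le> Suc (b n)" for n
    using card_image_le[of "{..b n}" "\<lambda>x. LEAST y. P n x y"] by (auto simp: W_def)
  obtain i where i: "\<forall>\<^sub>F n in U. \<forall>x\<in>W n. x < lo i n \<or> hi i n \<le> x"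
    by (rule K_semiregular[OF W b fin])
  have "sat (case_nat x e) S (\<^bold>\<exists>\<^sub>1 \<theta>) \<longleftrightarrow> (\<forall>\<^sub>F n in U. \<exists>y\<le>lo i n. P n (x n) y)"
    if x: "x \<in> K" "\<forall>\<^sub>F n in U. x n \<le> b n" for x
  proof
    assume "sat (case_nat x e) S (\<^bold>\<exists>\<^sub>1 \<theta>)"
    then obtain y where y: "y \<in> K" "sat (case_nat y (case_nat x e)) S \<theta>" by auto
    have "abs_at (case_nat y (case_nat x e)) S \<theta>"
      by (rule absoluteD[OF \<theta>]) (auto intro: case_nat_mem y x env)
    with y have "\<forall>\<^sub>F n in U. P n (x n) (y n)" unfolding abs_at_def case_nat_app P_def by simp
    then show "\<forall>\<^sub>F n in U. \<exists>y\<le>lo i n. P n (x n) y"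
      using i K_less_hi[OF y(1), of i] x(2)
    proof eventually_elim
      case (elim n)
      \<comment> \<open>A witness from \<open>K\<close> pushes the least one below
        \<open>hi i\<close>; since \<open>W\<close> misses the interval, it is even below
        \<open>lo i\<close>.\<close>
      have "(LEAST y. P n (x n) y) \<in> W n" using elim(4) by (auto simp: W_def)
      moreover have "(LEAST y. P n (x n) y) < hi i n" using elim(1,3) Least_le[of "P n (x n)"] by (meson le_less_trans)
      ultimately have "(LEAST y. P n (x n) y) < lo i n" using elim(2) by (metis not_less)
      then show ?case using LeastI[of "P n (x n)", OF elim(1)] by (blast intro: less_imp_le)
    qed
  next
    assume *: "\<forall>\<^sub>F n in U. \<exists>y\<le>lo i n. P n (x n) y"
    define y where "y n = (LEAST y. P n (x n) y)" for n
    have "y \<in> K"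
    proof (rule K_down[OF _ lo_K])
      show "y \<in> N" using N_least[of "case_nat x e" S \<theta>] env x(1) K_N
        by (simp add: y_def[abs_def] P_def case_nat_mem case_nat_app)
      show "\<forall>\<^sub>F n in U. y n \<le> lo i n" using * unfolding y_def
        by eventually_elim (meson Least_le le_trans)
    qed
    have "\<forall>\<^sub>F n in U. P n (x n) (y n)" using * unfolding y_def by eventually_elim (auto intro: LeastI)
    moreover have "abs_at (case_nat y (case_nat x e)) S \<theta>"
      by (rule absoluteD[OF \<theta>]) (auto intro: case_nat_mem \<open>y \<in> K\<close> x env)
    ultimately have "sat (case_nat y (case_nat x e)) S \<theta>" unfolding abs_at_def case_nat_app P_def by simp
    then show "sat (case_nat x e) S (\<^bold>\<exists>\<^sub>1 \<theta>)" using \<open>y \<in> K\<close> by auto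
  qed
  then show ?thesis unfolding P_def by blast
qed

text \<open>Up to \<open>b\<close> the formula is equivalent to an internal one. A failure at
  \<open>b\<close> thus gives a least failure that is internal and at most \<open>b\<close>, hence
  in \<open>K\<close>, and the induction step from its predecessor refutes it.\<close>

lemma sat_induction_axiom:
  assumes "sigma1 \<phi>" and env: "\<And>i. e i \<in> K" "\<And>i. S i \<in> D"
  shows "sat e S (induction_axiom \<phi>)"
proof -
  obtain \<theta> where \<theta>: "absolute \<theta>" "\<phi> = (\<^bold>\<exists>\<^sub>1 \<theta>)" using assms(1) absolute_delta0 by (auto simp: sigma1_def)
  have upd: "sat (case_nat x e) S (subst (Var(0 := Succ (Var 0))) id \<phi>) = sat (case_nat (\<lambda>n. Suc (x n)) e) S \<phi>" for x
  proof -
    have "(\<lambda>i. evs (case_nat x e) ((Var(0 := Succ (Var 0))) i)) = case_nat (\<lambda>n. Suc (x n)) e"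
      by (auto simp: fun_eq_iff split: nat.splits)
    then show ?thesis unfolding sat_subst by (simp only: id_apply)
  qed
  have "sat (case_nat b e) S \<phi>"
    if z: "sat (case_nat (\<lambda>n. 0) e) S \<phi>" and b: "b \<in> K"
      and s: "\<And>x. x \<in> K \<Longrightarrow> sat (case_nat x e) S \<phi> \<Longrightarrow> sat (case_nat (\<lambda>n. Suc (x n)) e) S \<phi>" for b
  proof (rule ccontr)
    assume neg: "\<not> sat (case_nat b e) S \<phi>"
    obtain i where i: "\<And>x. x \<in> K \<Longrightarrow> \<forall>\<^sub>F n in U. x n \<le> b n \<Longrightarrow> sat (case_nat x e) S \<phi> \<longleftrightarrow>
      (\<forall>\<^sub>F n in U. \<exists>y\<le>lo i n. holds (case_nat y (case_nat (x n) (\<lambda>i. e i n))) (\<lambda>i. S i n) \<theta>)"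
      using sigma1_eq_bounded[of \<theta> e S b, OF \<theta>(1) env b] unfolding \<theta>(2) by blast
    define P where "P n x \<longleftrightarrow> (\<exists>y\<le>lo i n. holds (case_nat y (case_nat x (\<lambda>i. e i n))) (\<lambda>i. S i n) \<theta>)" for n x
    define x where "x n = (LEAST x. \<not> P n x)" for n
    have nPb: "\<forall>\<^sub>F n in U. \<not> P n (b n)"
      unfolding ultra_not[OF ultra] using neg i[OF b] by (simp add: P_def)
    then have xb: "\<forall>\<^sub>F n in U. x n \<le> b n" unfolding x_def by eventually_elim (rule Least_le)
    have nPx: "\<forall>\<^sub>F n in U. \<not> P n (x n)" using nPb unfolding x_def by eventually_elim (rule LeastI)
    have "(\<lambda>n e S. LEAST x. \<not> (\<exists>y\<le>e 0. holds (case_nat y (case_nat x (tail e))) S \<theta>)) \<in> num_ops"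
      by (rule num_opsI)
    from num_op[OF this, of "case_nat (lo i) e" S] have "x \<in> N"
      using env K_N lo_hi_N by (simp add: x_def[abs_def] P_def case_nat_mem case_nat_app)
    then have x: "x \<in> K" using K_down b xb by blast
    have "\<forall>\<^sub>F n in U. P n 0"
      using i[OF K_0] z by (simp add: P_def)
    then have x0: "\<forall>\<^sub>F n in U. 0 < x n" using nPx by eventually_elim (metis gr0I)
    define x' where "x' n = x n - Suc 0" for n
    have "(\<lambda>n e S. e 0 - e 1) \<in> num_ops" by (rule num_opsI)
    moreover have "(\<lambda>n. Suc 0) \<in> N" using N_term[of "\<lambda>_ _. 0" "Succ Zero"] N_0 by simp
    ultimately have "x' \<in> N" unfolding x'_def[abs_def]
      using num_op4[of "\<lambda>n e S. e 0 - e 1" x "\<lambda>n. Suc 0" x x "\<lambda>n. {0}"] \<open>x \<in> N\<close> zero by simp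
    then have x': "x' \<in> K" by (rule K_down[OF _ x]) (simp add: x'_def)
    have "\<forall>\<^sub>F n in U. P n (x' n)" using x0
    proof eventually_elim
      case (elim n)
      then show ?case using not_less_Least[of "x' n" "\<lambda>x. \<not> P n x"] by (auto simp: x_def x'_def)
    qed
    moreover have "\<forall>\<^sub>F n in U. x' n \<le> b n" using xb by eventually_elim (simp add: x'_def)
    ultimately have "sat (case_nat x' e) S \<phi>" using i[OF x'] by (simp add: P_def)
    then have "sat (case_nat (\<lambda>n. Suc (x' n)) e) S \<phi>" using s x' by blast
    \<comment> \<open>\<open>Suc (x' n)\<close> is \<open>x n\<close> only where \<open>x n\<close>
      is positive, that is, at almost every index.\<close>
    moreover have "sat (case_nat (\<lambda>n. Suc (x' n)) e) S \<phi> = sat (case_nat x e) S \<phi>"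
      by (rule sat_cong) (use x0 in \<open>auto split: nat.splits simp: x'_def elim: eventually_mono\<close>)
    ultimately have "\<forall>\<^sub>F n in U. P n (x n)" using i[OF x xb] by (simp add: P_def)
    then show False using nPx by (simp add: ultra_not[OF ultra])
  qed
  then show ?thesis
    by (auto simp: induction_axiom_def sat_inst1 upd)
qed

text \<open>A race between the two formulas: \<open>x\<close> enters the set if a witness for
  \<open>\<theta>\<close> appears before any counterexample to \<open>\<eta>\<close>. If
  \<open>\<phi>\<close> holds, a witness in \<open>K\<close> wins, since no counterexample lies in
  \<open>K\<close>. If \<open>\<phi>\<close> fails, so does \<open>\<psi>\<close>; a counterexample
  in \<open>K\<close> then bounds every winning witness, which would make \<open>\<phi>\<close>
  true.\<close>

lemma sat_comprehension_axiom:
  assumes "sigma1 \<phi>" "pi1 \<psi>" and env: "\<And>i. e i \<in> K" "\<And>i. S i \<in> D"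
  shows "sat e S (comprehension_axiom \<phi> \<psi>)"
proof -
  obtain \<theta> \<eta> where \<theta>: "absolute \<theta>" "\<phi> = (\<^bold>\<exists>\<^sub>1 \<theta>)" and \<eta>: "absolute \<eta>" "\<psi> = (\<^bold>\<forall>\<^sub>1 \<eta>)"
    using assms(1,2) absolute_delta0 by (auto simp: sigma1_def pi1_def)
  define P where "P = (\<lambda>n x y. holds (case_nat y (case_nat x (\<lambda>i. e i n))) (\<lambda>i. S i n) \<theta>)"
  define R where "R = (\<lambda>n x y. holds (case_nat y (case_nat x (\<lambda>i. e i n))) (\<lambda>i. S i n) \<eta>)"
  have satP: "sat (case_nat y (case_nat x e)) S \<theta> \<longleftrightarrow> (\<forall>\<^sub>F n in U. P n (x n) (y n))"
    and satR: "sat (case_nat y (case_nat x e)) S \<eta> \<longleftrightarrow> (\<forall>\<^sub>F n in U. R n (x n) (y n))"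
    if "x \<in> K" "y \<in> K" for x y
  proof -
    have "abs_at (case_nat y (case_nat x e)) S \<theta>" "abs_at (case_nat y (case_nat x e)) S \<eta>"
      by (rule absoluteD[OF \<theta>(1)] absoluteD[OF \<eta>(1)]; auto intro: case_nat_mem that env)+
    then show "sat (case_nat y (case_nat x e)) S \<theta> \<longleftrightarrow> (\<forall>\<^sub>F n in U. P n (x n) (y n))"
      "sat (case_nat y (case_nat x e)) S \<eta> \<longleftrightarrow> (\<forall>\<^sub>F n in U. R n (x n) (y n))"
      by (simp_all only: abs_at_def case_nat_app P_def R_def)
  qed
  \<comment> \<open>\<open>hi 0\<close> lies above the whole cut, so no witness from
    \<open>K\<close> is lost.\<close>
  define X where "X n = {x. \<exists>y<hi 0 n. P n x y \<and> (\<forall>y'\<le>y. R n x y')}" for n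
  have "(\<lambda>n e S. {x. \<exists>y<e 0. holds (case_nat y (case_nat x (tail e))) S \<theta> \<and>
       (\<forall>y'\<le>y. holds (case_nat y' (case_nat x (tail e))) S \<eta>)}) \<in> set_ops"
    by (rule set_opsI)
  from set_op[OF this, of "case_nat (hi 0) e" S] have X: "X \<in> D"
    using env K_N lo_hi_N by (simp add: X_def[abs_def] P_def R_def case_nat_mem case_nat_app)
  have "(\<forall>\<^sub>F n in U. x n \<in> X n) \<longleftrightarrow> sat (case_nat x e) S \<phi>"
    if eq: "sat (case_nat x e) S \<phi> \<longleftrightarrow> sat (case_nat x e) S \<psi>" and x: "x \<in> K" for x
  proof
    assume "sat (case_nat x e) S \<phi>"
    then obtain y where y: "y \<in> K" "\<forall>\<^sub>F n in U. P n (x n) (y n)" unfolding \<theta>(2) using satP[OF x] by auto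
    have "sat (case_nat x e) S \<psi>" using eq \<open>sat (case_nat x e) S \<phi>\<close> by simp
    then have R: "\<forall>\<^sub>F n in U. R n (x n) (z n)" if "z \<in> K" for z unfolding \<eta>(2) using satR[OF x] that by auto
    define z where "z n = (LEAST z. \<not> R n (x n) z)" for n
    have zN: "z \<in> N" using N_least[of "case_nat x e" S "\<^bold>\<not> \<eta>"] env x K_N
      by (simp add: z_def[abs_def] R_def Neg_def case_nat_mem case_nat_app)
    have "\<forall>\<^sub>F n in U. \<forall>y'\<le>y n. R n (x n) y'"
    proof (rule ccontr)
      assume "\<not> ?thesis"
      then have *: "\<forall>\<^sub>F n in U. \<exists>y'\<le>y n. \<not> R n (x n) y'"
        by (simp add: ultra_not[OF ultra, symmetric])
      then have "\<forall>\<^sub>F n in U. z n \<le> y n" unfolding z_def by eventually_elim (meson Least_le le_trans)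
      then have "z \<in> K" using K_down zN y(1) by blast
      moreover have "\<forall>\<^sub>F n in U. \<not> R n (x n) (z n)"
        using * unfolding z_def by eventually_elim (metis (mono_tags, lifting) LeastI)
      ultimately show False using R by (simp add: ultra_not[OF ultra])
    qed
    then show "\<forall>\<^sub>F n in U. x n \<in> X n" using y(2) K_less_hi[OF y(1), of 0]
      by eventually_elim (auto simp: X_def)
  next
    assume inX: "\<forall>\<^sub>F n in U. x n \<in> X n"
    show "sat (case_nat x e) S \<phi>"
    proof (rule ccontr)
      assume neg: "\<not> sat (case_nat x e) S \<phi>"
      then obtain z where z: "z \<in> K" "\<forall>\<^sub>F n in U. \<not> R n (x n) (z n)"
        using eq satR[OF x] unfolding \<eta>(2) by (auto simp: ultra_not[OF ultra])
      define y where "y n = (LEAST y. P n (x n) y)" for n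
      have yN: "y \<in> N" using N_least[of "case_nat x e" S \<theta>] env x K_N
        by (simp add: y_def[abs_def] P_def case_nat_mem case_nat_app)
      from inX z(2) have "\<forall>\<^sub>F n in U. P n (x n) (y n) \<and> y n \<le> z n"
      proof eventually_elim
        case (elim n)
        then obtain w where w: "P n (x n) w" "\<forall>y'\<le>w. R n (x n) y'" by (auto simp: X_def)
        then have "w < z n" using elim(2) by (metis not_less)
        then show ?case using w(1) LeastI[of "P n (x n)"] Least_le[of "P n (x n)"]
          unfolding y_def by (metis less_imp_le le_trans)
      qed
      then have "\<forall>\<^sub>F n in U. P n (x n) (y n)" "\<forall>\<^sub>F n in U. y n \<le> z n" by (auto elim: eventually_mono)
      moreover from this have "y \<in> K" using K_down yN z(1) by blast
      ultimately show False using neg satP[OF x] unfolding \<theta>(2) by auto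
    qed
  qed
  then show ?thesis using X
    by (auto simp: comprehension_axiom_def Iff_def sat_lift2 intro!: bexI[of _ X])
qed

lemma sat_RCA0:
  assumes "\<phi> \<in> RCA0" "\<And>i. e i \<in> K" "\<And>i. S i \<in> D"
  shows "sat e S \<phi>"
  using assms sat_basic_axioms sat_induction_axiom sat_comprehension_axiom
  unfolding RCA0_def by blast

lemma sat_provable:
  assumes "RCA0 \<turnstile> \<phi>" "\<And>i. e i \<in> K" "\<And>i. S i \<in> D"
  shows "sat e S \<phi>"
  using soundness[OF K_term sat_RCA0 assms(1)[unfolded provable_def]] assms(2,3) by simp

end

section \<open>Decoding the formulas\<close>

lemma Least_le_bound: "\<exists>c\<le>h. P c \<Longrightarrow> (LEAST c. P c) \<le> (h :: nat)"
  by (metis Least_le le_trans)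

lemma LeastI_bound: "\<exists>c\<le>h. P c \<Longrightarrow> P (LEAST c :: nat. P c)"
  by (metis LeastI)

lemma exs_simps [simp]: "exs 0 \<phi> = \<phi>" "exs (Suc k) \<phi> = (\<^bold>\<exists>\<^sub>1 (exs k \<phi>))"
  by (simp_all add: exs_def)

lemma val_shift_simps [simp]:
  "val e (t \<up> 0) = val e t" "val (case_nat x e) (t \<up> Suc k) = val e (t \<up> k)"
  by (simp_all add: val_shift)

lemma evs_shift_simps [simp]:
  "evs e (t \<up> 0) = evs e t" "evs (case_nat x e) (t \<up> Suc k) = evs e (t \<up> k)"
  by (simp_all add: evs_shift)

lemma val_pair [simp]: "val e \<langle>s, t\<rangle> = pr (val e s) (val e t)"
  by (simp add: pair_def pr_def)

lemma evs_pair [simp]: "evs e \<langle>s, t\<rangle> = (\<lambda>n. pr (evs e s n) (evs e t n))"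
  by (simp add: evs_def)

lemma evs_tuple5 [simp]: "evs e (tuple5 A Q T q F) =
    (\<lambda>n. pr (evs e A n) (pr (evs e Q n) (pr (evs e T n) (pr (evs e q n) (evs e F n)))))"
  by (simp add: tuple5_def)

lemma holds_Iff [simp]: "holds e S (\<phi> \<^bold>\<longleftrightarrow> \<psi>) \<longleftrightarrow> (holds e S \<phi> \<longleftrightarrow> holds e S \<psi>)"
  by (auto simp: Iff_def)

lemma holds_rel [simp]: "holds e S (rel X s t) \<longleftrightarrow> pr (val e s) (val e t) \<in> S X"
  by (simp add: rel_def)

definition beta_val :: "nat \<Rightarrow> nat \<Rightarrow> nat \<Rightarrow> nat" where
  "beta_val c m i = c mod Suc (m * Suc i)"

lemma holds_beta [simp]:
  "holds e S (beta c m i y) \<longleftrightarrow> val e y = beta_val (val e c) (val e m) (val e i)"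
proof -
  have "holds e S (beta c m i y) \<longleftrightarrow> val e y < Suc (val e m * Suc (val e i)) \<and>
      (\<exists>x. val e c = x * Suc (val e m * Suc (val e i)) + val e y)"
    by (simp add: beta_def Let_def)
  also have "\<dots> \<longleftrightarrow> val e y = beta_val (val e c) (val e m) (val e i)"
    unfolding beta_val_def
    by (metis div_mult_mod_eq mod_less mod_less_divisor mod_mult_self3 zero_less_Suc)
  finally show ?thesis .
qed

lemma holds_code_mem [simp]: "holds e S (t \<epsilon> s) \<longleftrightarrow> cmem (val e t) (val e s)"
  by (auto simp: code_mem_def cmem_def beta_val_def eval_nat_numeral mod_eq_0_iff_dvd)

section \<open>Runs and determinism at a single index\<close>

definition runs :: "nat set \<Rightarrow> nat \<Rightarrow> nat \<Rightarrow> nat \<Rightarrow> nat \<Rightarrow> bool" where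
  "runs W T q0 x q \<longleftrightarrow> (\<exists>s. s 0 = q0 \<and>
     (\<forall>t<x. \<exists>b. pr t b \<in> W \<and> cmem (pr (pr (s t) b) (s (Suc t))) T) \<and> s x = q)"

definition trans_ok :: "nat \<Rightarrow> nat \<Rightarrow> nat \<Rightarrow> bool" where
  "trans_ok A Q T \<longleftrightarrow> (\<forall>x. cmem x T \<longrightarrow>
     (\<exists>q b r. cmem q Q \<and> cmem b A \<and> cmem r Q \<and> x = pr (pr q b) r))"

definition det_ok :: "nat \<Rightarrow> nat \<Rightarrow> nat \<Rightarrow> bool" where
  "det_ok A Q T \<longleftrightarrow> (\<forall>q. cmem q Q \<longrightarrow> (\<forall>b. cmem b A \<longrightarrow>
     (\<exists>r. \<forall>r'. cmem (pr (pr q b) r') T \<longleftrightarrow> r' = r)))"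

lemma holds_transitions:
  "holds e S (transitions A Q T) \<longleftrightarrow> trans_ok (val e A) (val e Q) (val e T)"
  by (simp add: transitions_def trans_ok_def eval_nat_numeral)

lemma holds_deterministic:
  "holds e S (deterministic A Q T) \<longleftrightarrow> det_ok (val e A) (val e Q) (val e T)"
  by (simp add: deterministic_def det_ok_def eval_nat_numeral)

definition run_body :: "nat \<Rightarrow> tm \<Rightarrow> tm \<Rightarrow> tm \<Rightarrow> tm \<Rightarrow> fm" where
  "run_body X \<delta> q0 x q = (
     beta (Var 1) (Var 0) Zero (q0\<up>2)
     \<^bold>\<and> \<^bold>\<forall>\<^sub>1 ((Var 0 \<^bold>< x\<up>3) \<^bold>\<longrightarrow> exs 3 (
          beta (Var 5) (Var 4) (Var 3) (Var 2) \<^bold>\<and> rel X (Var 3) (Var 1)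
          \<^bold>\<and> beta (Var 5) (Var 4) (Succ (Var 3)) (Var 0)
          \<^bold>\<and> (\<langle>\<langle>Var 2, Var 1\<rangle>, Var 0\<rangle> \<epsilon> \<delta>\<up>6)))
     \<^bold>\<and> beta (Var 1) (Var 0) (x\<up>2) (q\<up>2))"

lemma run_state_eq: "run_state X T q0 x q = (\<^bold>\<exists>\<^sub>1 (\<^bold>\<exists>\<^sub>1 (run_body X T q0 x q)))"
  by (simp add: run_state_def run_body_def numeral_2_eq_2)

lemma holds_run_body:
  "holds (case_nat m (case_nat c e)) S (run_body X T q0 x q) \<longleftrightarrow>
     beta_val c m 0 = val e q0 \<and>
     (\<forall>t<val e x. \<exists>b. pr t b \<in> S X \<and>
       cmem (pr (pr (beta_val c m t) b) (beta_val c m (Suc t))) (val e T)) \<and>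
     beta_val c m (val e x) = val e q"
  by (auto simp: run_body_def eval_nat_numeral)

text \<open>Every state left by a transition is bounded by the code of the transition table, so a
  run is a sequence with small length and small entries and has a code below
  \<open>grow\<close>.\<close>

lemma runs_imp_holds_run_body:
  assumes "runs (S X) (val e T) (val e q0) (val e x) (val e q)"
  shows "\<exists>c\<le>grow (val e x + val e T + val e q). \<exists>m\<le>grow (val e x + val e T + val e q).
    holds (case_nat m (case_nat c e)) S (run_body X T q0 x q)"
proof -
  \<comment> \<open>The summand \<open>val e q\<close> takes care of the last state, which is not
    the source of a transition considered here.\<close>
  let ?k = "val e x + val e T + val e q"
  obtain s where s: "s 0 = val e q0" "s (val e x) = val e q"
    "\<And>t. t < val e x \<Longrightarrow> \<exists>b. pr t b \<in> S X \<and> cmem (pr (pr (s t) b) (s (Suc t))) (val e T)"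
    using assms unfolding runs_def by blast
  \<comment> \<open>Coding requires bounded entries up to \<open>?k\<close>, so the sequence is cut
    off after the run.\<close>
  define s' where "s' t = (if t \<le> val e x then s t else 0)" for t
  have "s' t \<le> ?k" if "t \<le> ?k" for t
  proof -
    consider "t < val e x" | "t = val e x" | "t > val e x" by linarith
    then show ?thesis
    proof cases
      case 1
      then obtain b where "cmem (pr (pr (s t) b) (s (Suc t))) (val e T)" using s(3) by blast
      then have "pr (pr (s t) b) (s (Suc t)) \<le> val e T" by (rule cmem_le)
      then have "s t \<le> val e T" using pr_ge1 by (meson le_trans)
      then show ?thesis using 1 by (simp add: s'_def)
    qed (simp_all add: s'_def s)
  qed
  from ex_beta_code[of ?k s', OF this] obtain c m where
    cm: "c \<le> beta_bound ?k" "m \<le> beta_bound ?k" "\<And>i. i \<le> ?k \<Longrightarrow> s' i = beta_val c m i"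
    unfolding beta_val_def by blast
  have code: "beta_val c m i = s i" if "i \<le> val e x" for i
    using cm(3)[of i] that by (simp add: s'_def)
  have "holds (case_nat m (case_nat c e)) S (run_body X T q0 x q)"
    unfolding holds_run_body using s code by simp
  moreover have "beta_bound ?k \<le> grow ?k" using grow_ge[of ?k] by linarith
  ultimately show ?thesis using cm(1,2) by (meson le_trans)
qed

lemma holds_run_body_imp_runs:
  "holds (case_nat m (case_nat c e)) S (run_body X T q0 x q) \<Longrightarrow>
    runs (S X) (val e T) (val e q0) (val e x) (val e q)"
  unfolding holds_run_body runs_def by (rule exI[of _ "beta_val c m"]) simp

context generic_cut
begin

declare case_nat_mem [simp]

lemma sat_Iff [simp]: "sat e S (\<phi> \<^bold>\<longleftrightarrow> \<psi>) \<longleftrightarrow> (sat e S \<phi> \<longleftrightarrow> sat e S \<psi>)"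
  by (auto simp: Iff_def)

lemma sat_rel [simp]: "sat e S (rel X s t) \<longleftrightarrow> (\<forall>\<^sub>F n in U. pr (evs e s n) (evs e t n) \<in> S X n)"
  by (simp add: rel_def)

lemma absolute_rel [simp, intro]: "absolute (rel X s t)"
  by (simp add: rel_def)

lemma absolute_beta [simp, intro]: "absolute (beta c m i y)"
  unfolding beta_def Let_def
  by (intro absolute_conn absolute_atoms absolute_Ex1[where t = c])
    (simp add: val_shift algebra_simps)

lemma absolute_code_mem [simp, intro]: "absolute (t \<epsilon> s)"
proof -
  have le: "k \<le> pr k (pr c m)" "c \<le> pr k (pr c m)" "m \<le> pr k (pr c m)" for k c m
    using pr_ge1 pr_ge2 by (meson le_trans)+
  show ?thesis
    unfolding code_mem_def
    by (simp only: numeral_3_eq_3 exs_simps,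
        intro absolute_Ex1[where t = s] absolute_Ex1[where t = "s \<up> 1"] absolute_Ex1[where t = "s \<up> 2"]
          absolute_conn absolute_atoms absolute_beta)
      (auto simp: eval_nat_numeral le)
qed

lemma sat_absolute:
  "absolute \<phi> \<Longrightarrow> (\<And>i. e i \<in> K) \<Longrightarrow> (\<And>i. S i \<in> D) \<Longrightarrow>
    sat e S \<phi> \<longleftrightarrow> (\<forall>\<^sub>F n in U. holds (\<lambda>i. e i n) (\<lambda>i. S i n) \<phi>)"
  using absoluteD[of \<phi> e S] by (simp add: abs_at_def)

lemma sat_code_mem [simp]:
  "(\<And>i. e i \<in> K) \<Longrightarrow> (\<And>i. S i \<in> D) \<Longrightarrow>
    sat e S (t \<epsilon> s) \<longleftrightarrow> (\<forall>\<^sub>F n in U. cmem (evs e t n) (evs e s n))"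
  by (simp add: sat_absolute evs_def)

lemma pr3_le: "q \<le> pr (pr q b) r" "b \<le> pr (pr q b) r" "r \<le> pr (pr q b) r"
  using pr_ge1 pr_ge2 by (meson le_trans)+

lemma sat_transitions:
  assumes "\<And>i. e i \<in> K" "\<And>i. S i \<in> D"
  shows "sat e S (transitions A Q T) \<longleftrightarrow> (\<forall>\<^sub>F n in U. trans_ok (evs e A n) (evs e Q n) (evs e T n))"
proof -
  have "absolute (transitions A Q T)"
    unfolding transitions_def
    by (simp only: numeral_3_eq_3 exs_simps,
        intro absolute_All1[where t = T] absolute_Ex1[where t = "Var 0"] absolute_Ex1[where t = "Var 1"]
          absolute_Ex1[where t = "Var 2"] absolute_conn absolute_atoms absolute_code_mem)
      (auto simp: eval_nat_numeral pr3_le cmem_le)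
  from sat_absolute[OF this assms] show ?thesis by (simp add: holds_transitions evs_def)
qed

text \<open>Every quantifier needs a term as a bound. A counterexample to the inner equivalence is
  either a target occurring in the table or the candidate itself, hence at most their sum.\<close>

lemma sat_deterministic:
  assumes "\<And>i. e i \<in> K" "\<And>i. S i \<in> D"
  shows "sat e S (deterministic A Q T) \<longleftrightarrow> (\<forall>\<^sub>F n in U. det_ok (evs e A n) (evs e Q n) (evs e T n))"
proof -
  have le: "r \<le> T" if "cmem (pr (pr q b) r) T" for q b r T
    using cmem_le[OF that] pr3_le(3)[of r q b] by simp
  have "absolute (deterministic A Q T)"
    unfolding deterministic_def
  proof (rule absolute_All1[where t = Q], rule absolute_conn(3)[OF absolute_code_mem],
      rule absolute_All1[where t = "A \<up> 1"], rule absolute_conn(3)[OF absolute_code_mem],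
      rule absolute_Ex1[where t = "T \<up> 2"], rule absolute_All1[where t = "T \<up> 3 \<^bold>+ Var 0"])
    show "absolute (\<langle>\<langle>Var 3, Var 2\<rangle>, Var 0\<rangle> \<epsilon> T \<up> 4 \<^bold>\<longleftrightarrow> Var 0 \<^bold>= Var 1)" by simp
    fix e S y
    show "\<not> holds (case_nat y e) S (\<langle>\<langle>Var 3, Var 2\<rangle>, Var 0\<rangle> \<epsilon> T \<up> 4 \<^bold>\<longleftrightarrow> Var 0 \<^bold>= Var 1) \<Longrightarrow>
        y \<le> val e (T \<up> 3 \<^bold>+ Var 0)"
      using le by (fastforce simp: eval_nat_numeral intro: trans_le_add1)
    show "holds (case_nat y e) S (\<^bold>\<forall>\<^sub>1 (\<langle>\<langle>Var 3, Var 2\<rangle>, Var 0\<rangle> \<epsilon> T \<up> 4 \<^bold>\<longleftrightarrow> Var 0 \<^bold>= Var 1)) \<Longrightarrow>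
        y \<le> val e (T \<up> 2)"
      by (rule le[of "e 1" "e 0" y]) (simp add: eval_nat_numeral)
  qed (auto simp: eval_nat_numeral cmem_le)
  from sat_absolute[OF this assms] show ?thesis by (simp add: holds_deterministic evs_def)
qed

text \<open>For sequence codes, whose bound \<open>grow\<close> is not a term of the language. First
  the least \<open>c\<close> that has some \<open>m\<close> below the bound is chosen, then the
  least such \<open>m\<close>; both are internal and bounded by \<open>h\<close>.\<close>

lemma abs_at_Ex1_Ex1:
  assumes env: "\<And>i. e i \<in> K" "\<And>i. S i \<in> D" and "absolute \<phi>" and h: "h \<in> K"
    and bound: "\<forall>\<^sub>F n in U. (\<exists>c m. holds (case_nat m (case_nat c (\<lambda>i. e i n))) (\<lambda>i. S i n) \<phi>) \<longrightarrow>
      (\<exists>c\<le>h n. \<exists>m\<le>h n. holds (case_nat m (case_nat c (\<lambda>i. e i n))) (\<lambda>i. S i n) \<phi>)"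
  shows "abs_at e S (\<^bold>\<exists>\<^sub>1 (\<^bold>\<exists>\<^sub>1 \<phi>))"
  unfolding abs_at_def
proof
  define P where "P = (\<lambda>n c m. holds (case_nat m (case_nat c (\<lambda>i. e i n))) (\<lambda>i. S i n) \<phi>)"
  have sat_P: "sat (case_nat m (case_nat c e)) S \<phi> \<longleftrightarrow> (\<forall>\<^sub>F n in U. P n (c n) (m n))"
    if "c \<in> K" "m \<in> K" for c m
    using sat_absolute[OF \<open>absolute \<phi>\<close>, of "case_nat m (case_nat c e)" S] that env
    by (simp add: P_def case_nat_app)
  have eq: "(\<forall>\<^sub>F n in U. holds (\<lambda>i. e i n) (\<lambda>i. S i n) (\<^bold>\<exists>\<^sub>1 (\<^bold>\<exists>\<^sub>1 \<phi>))) \<longleftrightarrow> (\<forall>\<^sub>F n in U. \<exists>c m. P n c m)"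
    by (simp add: P_def)
  show "\<forall>\<^sub>F n in U. holds (\<lambda>i. e i n) (\<lambda>i. S i n) (\<^bold>\<exists>\<^sub>1 (\<^bold>\<exists>\<^sub>1 \<phi>))" if "sat e S (\<^bold>\<exists>\<^sub>1 (\<^bold>\<exists>\<^sub>1 \<phi>))"
  proof -
    from that obtain c m where "c \<in> K" "m \<in> K" "sat (case_nat m (case_nat c e)) S \<phi>" by auto
    then have "\<forall>\<^sub>F n in U. P n (c n) (m n)" using sat_P by simp
    then show ?thesis unfolding eq by (rule eventually_mono) blast
  qed
  show "sat e S (\<^bold>\<exists>\<^sub>1 (\<^bold>\<exists>\<^sub>1 \<phi>))" if ex: "\<forall>\<^sub>F n in U. holds (\<lambda>i. e i n) (\<lambda>i. S i n) (\<^bold>\<exists>\<^sub>1 (\<^bold>\<exists>\<^sub>1 \<phi>))"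
  proof -
    define c where "c n = (LEAST c. \<exists>m\<le>h n. P n c m)" for n
    define m where "m n = (LEAST m. P n (c n) m)" for n
    have b: "\<forall>\<^sub>F n in U. \<exists>c\<le>h n. \<exists>m\<le>h n. P n c m"
      using ex[unfolded eq] bound unfolding P_def by eventually_elim blast
    have "(\<lambda>n. LEAST c. \<exists>m\<le>(case_nat h e 0) n. holds (case_nat m (case_nat c (tail (\<lambda>i. case_nat h e i n)))) (\<lambda>i. S i n) \<phi>) \<in> N"
      by (rule num_op[OF num_opsI(3)]) (use env h K_N in auto)
    then have "c \<in> N" by (simp add: c_def[abs_def] P_def case_nat_app)
    then have "c \<in> K"
    proof (rule K_down[OF _ h])
      show "\<forall>\<^sub>F n in U. c n \<le> h n" using b unfolding c_def by eventually_elim (rule Least_le_bound)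
    qed
    have b2: "\<forall>\<^sub>F n in U. \<exists>m\<le>h n. P n (c n) m"
      using b unfolding c_def by eventually_elim (rule LeastI_bound)
    have "m \<in> N" using N_least[of "case_nat c e" S \<phi>] env \<open>c \<in> K\<close> K_N
      by (simp add: m_def[abs_def] P_def case_nat_app)
    then have "m \<in> K"
    proof (rule K_down[OF _ h])
      show "\<forall>\<^sub>F n in U. m n \<le> h n" using b2 unfolding m_def by eventually_elim (rule Least_le_bound)
    qed
    moreover have "\<forall>\<^sub>F n in U. P n (c n) (m n)"
      using b2 unfolding m_def by eventually_elim (auto intro: LeastI)
    ultimately show ?thesis using sat_P \<open>c \<in> K\<close> by auto
  qed
qed

lemma sat_run_state:
  assumes env: "\<And>i. e i \<in> K" "\<And>i. S i \<in> D"
  shows "sat e S (run_state X T q0 x q) \<longleftrightarrow>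
    (\<forall>\<^sub>F n in U. runs (S X n) (evs e T n) (evs e q0 n) (evs e x n) (evs e q n))"
proof -
  have le: "q \<le> T" "b \<le> T" "r \<le> T" if "cmem (pr (pr q b) r) T" for q b r T
    using cmem_le[OF that] pr3_le[where q = q and b = b and r = r] by simp_all
  have "absolute (run_body X T q0 x q)"
    unfolding run_body_def
    by (simp only: numeral_3_eq_3 exs_simps,
        intro absolute_All1[where t = "x \<up> 2"] absolute_Ex1[where t = "T \<up> 3"] absolute_Ex1[where t = "T \<up> 4"]
          absolute_Ex1[where t = "T \<up> 5"] absolute_conn absolute_atoms absolute_code_mem absolute_beta absolute_rel)
      (auto simp: eval_nat_numeral le)
  moreover have "(\<lambda>n. grow (evs e x n + evs e T n + evs e q n)) \<in> K"
    by (intro K_grow K_add K_term env)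
  ultimately have "abs_at e S (\<^bold>\<exists>\<^sub>1 (\<^bold>\<exists>\<^sub>1 (run_body X T q0 x q)))"
  proof (rule abs_at_Ex1_Ex1[OF env])
    show "\<forall>\<^sub>F n in U. (\<exists>c m. holds (case_nat m (case_nat c (\<lambda>i. e i n))) (\<lambda>i. S i n) (run_body X T q0 x q)) \<longrightarrow>
      (\<exists>c\<le>grow (evs e x n + evs e T n + evs e q n). \<exists>m\<le>grow (evs e x n + evs e T n + evs e q n).
        holds (case_nat m (case_nat c (\<lambda>i. e i n))) (\<lambda>i. S i n) (run_body X T q0 x q))"
      unfolding evs_def
      by (rule always_eventually) (blast intro: runs_imp_holds_run_body dest: holds_run_body_imp_runs)
  qed
  moreover have "holds (\<lambda>i. e i n) (\<lambda>i. S i n) (\<^bold>\<exists>\<^sub>1 (\<^bold>\<exists>\<^sub>1 (run_body X T q0 x q))) \<longleftrightarrow>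
      runs (S X n) (evs e T n) (evs e q0 n) (evs e x n) (evs e q n)" for n
    using runs_imp_holds_run_body[of "\<lambda>i. S i n" X "\<lambda>i. e i n"] holds_run_body_imp_runs[where S = "\<lambda>i. S i n"]
    unfolding evs_def holds.simps by blast
  ultimately show ?thesis by (simp add: run_state_eq abs_at_def)
qed

text \<open>Injectivity of pairing determines the components up to almost everywhere equality, which
  truth cannot distinguish.\<close>

lemma sat_tuple5:
  assumes comps: "A \<in> K" "Q \<in> K" "T \<in> K" "q \<in> K" "F \<in> K"
    and eq: "\<forall>\<^sub>F n in U. evs e a n = pr (A n) (pr (Q n) (pr (T n) (pr (q n) (F n))))"
  shows "sat e S (exs 5 ((a\<up>5 \<^bold>= tuple5 (Var 4) (Var 3) (Var 2) (Var 1) (Var 0)) \<^bold>\<and> \<phi>)) \<longleftrightarrow>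
    sat (case_nat F (case_nat q (case_nat T (case_nat Q (case_nat A e))))) S \<phi>"
proof
  assume "sat e S (exs 5 ((a\<up>5 \<^bold>= tuple5 (Var 4) (Var 3) (Var 2) (Var 1) (Var 0)) \<^bold>\<and> \<phi>))"
  then obtain A' Q' T' q' F' where
    eq': "\<forall>\<^sub>F n in U. evs e a n = pr (A' n) (pr (Q' n) (pr (T' n) (pr (q' n) (F' n))))"
    and sat: "sat (case_nat F' (case_nat q' (case_nat T' (case_nat Q' (case_nat A' e))))) S \<phi>"
    by (auto simp: eval_nat_numeral)
  from eq eq' have same: "\<forall>\<^sub>F n in U. A n = A' n \<and> Q n = Q' n \<and> T n = T' n \<and> q n = q' n \<and> F n = F' n"
    by eventually_elim simp
  have "sat (case_nat F (case_nat q (case_nat T (case_nat Q (case_nat A e))))) S \<phi> =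
      sat (case_nat F' (case_nat q' (case_nat T' (case_nat Q' (case_nat A' e))))) S \<phi>"
    by (rule sat_cong) (use same in \<open>auto split: nat.splits elim: eventually_mono\<close>)
  with sat show "sat (case_nat F (case_nat q (case_nat T (case_nat Q (case_nat A e))))) S \<phi>" by simp
next
  assume "sat (case_nat F (case_nat q (case_nat T (case_nat Q (case_nat A e))))) S \<phi>"
  with comps eq show "sat e S (exs 5 ((a\<up>5 \<^bold>= tuple5 (Var 4) (Var 3) (Var 2) (Var 1) (Var 0)) \<^bold>\<and> \<phi>))"
    by (simp add: eval_nat_numeral) blast
qed

section \<open>Words and acceptance as seen from the cut\<close>

definition omega :: "(nat \<Rightarrow> nat set) \<Rightarrow> (nat \<Rightarrow> nat) \<Rightarrow> bool" where
  "omega W A \<longleftrightarrow> (\<forall>x\<in>K. \<exists>v\<in>K. (\<forall>\<^sub>F n in U. cmem (v n) (A n)) \<and>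
     (\<forall>u\<in>K. (\<forall>\<^sub>F n in U. pr (x n) (u n) \<in> W n) \<longleftrightarrow> (\<forall>\<^sub>F n in U. u n = v n)))"

lemma sat_omega_word:
  "(\<And>i. e i \<in> K) \<Longrightarrow> (\<And>i. S i \<in> D) \<Longrightarrow> sat e S (omega_word X A) \<longleftrightarrow> omega (S X) (evs e A)"
  by (simp add: omega_word_def omega_def eval_nat_numeral)

definition nba_accepts :: "(nat \<Rightarrow> nat set) \<Rightarrow> bool" where
  "nba_accepts W \<longleftrightarrow> omega W nba_alphabet \<and> (\<exists>Y\<in>D. omega Y nba_states \<and> (\<forall>\<^sub>F n in U. pr 0 0 \<in> Y n) \<and>
     (\<forall>x\<in>K. \<exists>q\<in>K. \<exists>b\<in>K. \<exists>r\<in>K. (\<forall>\<^sub>F n in U. pr (x n) (q n) \<in> Y n) \<and> (\<forall>\<^sub>F n in U. pr (x n) (b n) \<in> W n) \<and>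
       (\<forall>\<^sub>F n in U. pr (Suc (x n)) (r n) \<in> Y n) \<and> (\<forall>\<^sub>F n in U. cmem (pr (pr (q n) (b n)) (r n)) (nba_delta n))) \<and>
     (\<forall>x\<in>K. \<exists>x'\<in>K. (\<forall>\<^sub>F n in U. x n < x' n) \<and>
       (\<exists>q\<in>K. (\<forall>\<^sub>F n in U. pr (x' n) (q n) \<in> Y n) \<and> (\<forall>\<^sub>F n in U. cmem (q n) (nba_final n)))))"

definition dpa_accepts ::
  "(nat \<Rightarrow> nat) \<Rightarrow> (nat \<Rightarrow> nat) \<Rightarrow> (nat \<Rightarrow> nat) \<Rightarrow> (nat \<Rightarrow> nat) \<Rightarrow> (nat \<Rightarrow> nat) \<Rightarrow> (nat \<Rightarrow> nat set) \<Rightarrow> bool" where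
  "dpa_accepts A Q T q0 c W \<longleftrightarrow> omega W A \<and> (\<forall>q\<in>K. (\<forall>\<^sub>F n in U. cmem (q n) (Q n)) \<longrightarrow>
     (\<forall>x\<in>K. \<exists>x'\<in>K. (\<forall>\<^sub>F n in U. x n < x' n) \<and> (\<forall>\<^sub>F n in U. runs (W n) (T n) (q0 n) (x' n) (q n))) \<and>
     (\<exists>x\<in>K. \<forall>x'\<in>K. (\<forall>\<^sub>F n in U. x n < x' n) \<longrightarrow> (\<exists>q'\<in>K. \<exists>k'\<in>K. \<exists>k\<in>K.
       (\<forall>\<^sub>F n in U. runs (W n) (T n) (q0 n) (x' n) (q' n)) \<and> (\<forall>\<^sub>F n in U. cmem (pr (q' n) (k' n)) (c n)) \<and>
       (\<forall>\<^sub>F n in U. cmem (pr (q n) (k n)) (c n)) \<and>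
       ((\<forall>\<^sub>F n in U. k n < k' n) \<or> (\<forall>\<^sub>F n in U. k n = k' n)))) \<longrightarrow>
     (\<exists>k\<in>K. (\<forall>\<^sub>F n in U. cmem (pr (q n) (k n)) (c n)) \<and> (\<exists>h\<in>K. \<forall>\<^sub>F n in U. k n = h n + h n)))"

lemma nba_K: "nba \<in> K" "nba_alphabet \<in> K" "nba_states \<in> K" "nba_delta \<in> K" "nba_final \<in> K"
proof -
  show 1: "nba \<in> K"
  proof (rule K_down[OF _ K_grow[OF K_id]])
    show "nba \<in> N" by (rule num_op0, rule num_opsI)
    have "nba n \<le> grow n" for n using grow_ge[of n] by linarith
    then show "\<forall>\<^sub>F n in U. nba n \<le> grow n" by simp
  qed
  have le: "nba_alphabet n \<le> nba n" "nba_states n \<le> nba n" "nba_delta n \<le> nba n" "nba_final n \<le> nba n" for n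
    unfolding nba_def by (meson pr_ge1 pr_ge2 le_trans)+
  show "nba_alphabet \<in> K" by (rule K_down[OF _ 1]) (rule num_op0, rule num_opsI, simp add: le)
  show "nba_states \<in> K" by (rule K_down[OF _ 1]) (rule num_op0, rule num_opsI, simp add: le)
  show "nba_delta \<in> K" by (rule K_down[OF _ 1]) (rule num_op0, rule num_opsI, simp add: le)
  show "nba_final \<in> K" by (rule K_down[OF _ 1]) (rule num_op0, rule num_opsI, simp add: le)
qed

lemma sat_NBA_accepts:
  assumes "\<And>i. e i \<in> K" "\<And>i. S i \<in> D" "evs e a = nba"
  shows "sat e S (NBA_accepts X a) \<longleftrightarrow> nba_accepts (S X)"
proof -
  have "\<forall>\<^sub>F n in U. evs e a n = pr (nba_alphabet n) (pr (nba_states n) (pr (nba_delta n) (pr 0 (nba_final n))))"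
    by (simp add: assms(3) nba_def)
  note tuple = sat_tuple5[OF nba_K(2,3,4) K_0 nba_K(5) this]
  show ?thesis
    unfolding NBA_accepts_def Let_def tuple nba_accepts_def
    using assms(1,2) nba_K K_0
    by (simp add: sat_omega_word eval_nat_numeral)
qed

lemma sat_DPA_accepts:
  assumes "\<And>i. e i \<in> K" "\<And>i. S i \<in> D" "A \<in> K" "Q \<in> K" "T \<in> K" "q0 \<in> K" "c \<in> K"
    "\<forall>\<^sub>F n in U. evs e a n = pr (A n) (pr (Q n) (pr (T n) (pr (q0 n) (c n))))"
  shows "sat e S (DPA_accepts X a) \<longleftrightarrow> dpa_accepts A Q T q0 c (S X)"
  unfolding DPA_accepts_def Let_def sat_tuple5[OF assms(3-8)] dpa_accepts_def
  using assms(1-7)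
  by (simp add: sat_omega_word sat_run_state eval_nat_numeral)

lemma sat_is_NBA:
  assumes "\<And>i. e i \<in> K" "\<And>i. S i \<in> D" "evs e a = nba"
  shows "sat e S (is_NBA a)"
proof -
  have "\<forall>\<^sub>F n in U. evs e a n = pr (nba_alphabet n) (pr (nba_states n) (pr (nba_delta n) (pr 0 (nba_final n))))"
    by (simp add: assms(3) nba_def)
  note tuple = sat_tuple5[OF nba_K(2,3,4) K_0 nba_K(5) this]
  have "trans_ok (nba_alphabet n) (nba_states n) (nba_delta n)" for n
    unfolding trans_ok_def cmem_nba_alphabet cmem_nba_states cmem_nba_delta nba_trans_def by blast
  moreover have "\<forall>x\<in>K. (\<forall>\<^sub>F n in U. cmem (x n) (nba_final n)) \<longrightarrow> (\<forall>\<^sub>F n in U. cmem (x n) (nba_states n))"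
    by (auto simp: cmem_nba_final cmem_nba_states elim: eventually_mono)
  ultimately show ?thesis
    unfolding is_NBA_def Let_def tuple
    using assms(1,2) nba_K K_0
    by (simp add: sat_transitions eval_nat_numeral cmem_nba_states)
qed

lemma sat_is_DPA:
  assumes "\<And>i. e i \<in> K" "\<And>i. S i \<in> D" "sat e S (is_DPA b)"
  obtains A Q T q0 c where "A \<in> K" "Q \<in> K" "T \<in> K" "q0 \<in> K" "c \<in> K"
    "\<forall>\<^sub>F n in U. evs e b n = pr (A n) (pr (Q n) (pr (T n) (pr (q0 n) (c n))))"
    "\<forall>\<^sub>F n in U. trans_ok (A n) (Q n) (T n)" "\<forall>\<^sub>F n in U. det_ok (A n) (Q n) (T n)"
proof -
  have "\<exists>A\<in>K. \<exists>Q\<in>K. \<exists>T\<in>K. \<exists>q0\<in>K. \<exists>c\<in>K.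
    (\<forall>\<^sub>F n in U. evs e b n = pr (A n) (pr (Q n) (pr (T n) (pr (q0 n) (c n))))) \<and>
    (\<forall>\<^sub>F n in U. trans_ok (A n) (Q n) (T n)) \<and> (\<forall>\<^sub>F n in U. det_ok (A n) (Q n) (T n))"
    using assms unfolding is_DPA_def Let_def
    by (simp add: sat_transitions sat_deterministic eval_nat_numeral) blast
  then show ?thesis using that by blast
qed

end

section \<open>Looping a run\<close>

lemma fold_pos_less: "x < z \<Longrightarrow> fold_pos x z s < z"
proof -
  assume "x < z"
  then have "(s - x) mod (z - x) < z - x" by simp
  then show ?thesis using \<open>x < z\<close>
    by (cases "s < x"; simp only: fold_pos_def if_True if_False; linarith)
qed

lemma fold_pos_ge: "x \<le> s \<Longrightarrow> x \<le> fold_pos x z s"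
  by (simp add: fold_pos_def)

lemma fold_pos_loop: "fold_pos x z (x + (z - x) * k) = x"
  by (simp add: fold_pos_def)

lemma loop_progress: "x < z \<Longrightarrow> y < x + (z - x) * Suc y"
  by (auto dest!: less_imp_Suc_add)

lemma fold_pos_0: "fold_pos x z 0 = 0"
  by (simp add: fold_pos_def)

lemma fold_pos_Suc:
  assumes "x < z"
  shows "fold_pos x z (Suc s) = (if Suc (fold_pos x z s) = z then x else Suc (fold_pos x z s))"
proof (cases "s < x")
  case True
  then show ?thesis using assms by (auto simp: fold_pos_def)
next
  case False
  then have "Suc s - x = Suc (s - x)" by simp
  then show ?thesis using False assms by (auto simp: fold_pos_def mod_Suc)
qed

lemma det_unique:
  assumes "trans_ok A Q T" "det_ok A Q T" "cmem (pr (pr q b) r) T" "cmem (pr (pr q b) r') T"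
  shows "r = r'"
proof -
  have "cmem q Q" "cmem b A" using assms(1,3) unfolding trans_ok_def by fastforce+
  then obtain r0 where "\<forall>r'. cmem (pr (pr q b) r') T \<longleftrightarrow> r' = r0"
    using assms(2) unfolding det_ok_def by blast
  then show ?thesis using assms(3,4) by simp
qed

text \<open>By determinism the three given runs are initial pieces of one run \<open>s\<close>. It
  is in the same state at \<open>x\<close> and at \<open>z\<close>, so reading \<open>s\<close>
  along folded positions respects the transition table also where the position jumps back.\<close>

lemma loop_runs:
  assumes ok: "trans_ok A Q T" "det_ok A Q T" and "x < z"
    and rx: "runs (graph_of g) T q0 x q" and rz: "runs (graph_of g) T q0 z q"
    and rp: "runs (graph_of g) T q0 (fold_pos x z y) q'"
  shows "runs (graph_of (\<lambda>s. g (fold_pos x z s))) T q0 y q'"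
proof -
  have unique: "s t = s' t" if "s 0 = q0" "s' 0 = q0" "t \<le> a" "t \<le> a'"
    "\<forall>t<a. cmem (pr (pr (s t) (g t)) (s (Suc t))) T" "\<forall>t<a'. cmem (pr (pr (s' t) (g t)) (s' (Suc t))) T"
    for s s' t a a'
    using that(3,4)
  proof (induction t)
    case (Suc t)
    then show ?case using that(5)[rule_format, of t] that(6)[rule_format, of t] det_unique[OF ok, of "s t" "g t" "s (Suc t)" "s' (Suc t)"] by simp
  qed (use that in simp)
  have run: "\<exists>s. s 0 = q0 \<and> s a = r \<and> (\<forall>t<a. cmem (pr (pr (s t) (g t)) (s (Suc t))) T)"
    if "runs (graph_of g) T q0 a r" for a r
    using that unfolding runs_def by auto
  obtain s where s: "s 0 = q0" "s z = q" "\<forall>t<z. cmem (pr (pr (s t) (g t)) (s (Suc t))) T"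
    using run[OF rz] by blast
  have at: "s a = r" if ra: "runs (graph_of g) T q0 a r" and az: "a \<le> z" for a r
  proof -
    obtain s' where "s' 0 = q0" "s' a = r" "\<forall>t<a. cmem (pr (pr (s' t) (g t)) (s' (Suc t))) T"
      using run[OF ra] by blast
    then show ?thesis using unique[OF s(1) _ az order_refl s(3)] by blast
  qed
  have sx: "s x = s z" using at[OF rx] \<open>x < z\<close> s(2) by simp
  have "s (fold_pos x z y) = q'" using at[OF rp] fold_pos_less[OF \<open>x < z\<close>, of y] by simp
  moreover have "cmem (pr (pr (s (fold_pos x z t)) (g (fold_pos x z t))) (s (fold_pos x z (Suc t)))) T" for t
    using s(3)[rule_format, OF fold_pos_less[OF \<open>x < z\<close>, of t]] sx
    by (auto simp: fold_pos_Suc[OF \<open>x < z\<close>])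
  ultimately show ?thesis
    unfolding runs_def by (intro exI[of _ "\<lambda>t. s (fold_pos x z t)"]) (auto simp: fold_pos_0 s(1))
qed

lemma nba_run_less: "b \<le> Suc n \<Longrightarrow> nba_run w b s < 2 * n + 4"
  by (auto simp: nba_run_def)

lemma nba_run_trans:
  assumes "1 \<le> b" "b \<le> Suc n" "w s \<in> {1..Suc n}"
  shows "pr (pr (nba_run w b s) (w s)) (nba_run w b (Suc s)) \<in> nba_trans n"
  unfolding nba_trans_def mem_Collect_eq
  using assms by (intro exI[of _ "nba_run w b s"] exI[of _ "w s"] exI[of _ "nba_run w b (Suc s)"])
    (auto simp: nba_run_def)

lemma nba_transD:
  assumes "pr (pr q b) r \<in> nba_trans n"
  shows "1 \<le> b" "odd r \<Longrightarrow> r div 2 = b" "q \<noteq> 0 \<Longrightarrow> q div 2 = r div 2"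
  using assms unfolding nba_trans_def by auto


section \<open>The two automata disagree\<close>

context generic_cut
begin

abbreviation word :: "nat \<Rightarrow> nat set" where
  "word \<equiv> \<lambda>n. graph_of (colour n)"

abbreviation loop_word :: "(nat \<Rightarrow> nat) \<Rightarrow> (nat \<Rightarrow> nat) \<Rightarrow> nat \<Rightarrow> nat set" where
  "loop_word x z \<equiv> \<lambda>n. graph_of (\<lambda>s. colour n (fold_pos (x n) (z n) s))"

lemma word_D: "word \<in> D"
  using set_op4[OF set_opsI(3) N_0 N_0 N_0 N_0 zero] by simp

lemma loop_word_D: "x \<in> K \<Longrightarrow> z \<in> K \<Longrightarrow> loop_word x z \<in> D"
  using set_op4[OF set_opsI(4) K_N K_N N_0 N_0 zero] by simp

text \<open>The value is internal because it can be read off the graph; the bound \<open>g\<close>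
  places it in the cut.\<close>

lemma K_app:
  assumes "(\<lambda>n. graph_of (h n)) \<in> D" "x \<in> K" "g \<in> K" "\<And>n. h n (x n) \<le> g n"
  shows "(\<lambda>n. h n (x n)) \<in> K"
proof (rule K_down[OF _ assms(3)])
  have op: "(\<lambda>n e S. LEAST y. pr (e 0) y \<in> S 0) \<in> num_ops" by (rule num_opsI)
  have "(LEAST y. y = a) = a" for a :: nat by (rule Least_equality) auto
  then show "(\<lambda>n. h n (x n)) \<in> N" using num_op4[OF op K_N[OF assms(2)] N_0 N_0 N_0 assms(1)] by simp
qed (simp add: assms(4))

lemma colour_K: "x \<in> K \<Longrightarrow> (\<lambda>n. colour n (x n)) \<in> K"
  using K_app[OF word_D _ K_Suc[OF K_id]] colour(2) by simp

lemma fold_pos_K: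
  assumes "x \<in> K" "z \<in> K" "s \<in> K" shows "(\<lambda>n. fold_pos (x n) (z n) (s n)) \<in> K"
proof (rule K_down[OF _ K_add[OF assms(1,3)]])
  have op: "(\<lambda>n e S. fold_pos (e 0) (e 1) (e 2)) \<in> num_ops" by (rule num_opsI)
  show "(\<lambda>n. fold_pos (x n) (z n) (s n)) \<in> N"
    using num_op4[OF op K_N K_N K_N N_0 zero, OF assms] by (simp add: eval_nat_numeral)
  have "fold_pos a b c \<le> a + c" for a b c
    using mod_less_eq_dividend[of "c - a" "b - a"]
    by (cases "c < a"; simp only: fold_pos_def if_True if_False; linarith)
  then show "\<forall>\<^sub>F n in U. fold_pos (x n) (z n) (s n) \<le> x n + s n" by simp
qed

lemma K_diff:
  assumes "x \<in> K" "y \<in> K" shows "(\<lambda>n. x n - y n) \<in> K"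
proof (rule K_down[OF _ assms(1)])
  have op: "(\<lambda>n e S. e 0 - e 1) \<in> num_ops" by (rule num_opsI)
  show "(\<lambda>n. x n - y n) \<in> N" using num_op4[OF op K_N K_N N_0 N_0 zero, OF assms] by simp
qed simp

text \<open>The bound from \<open>K\<close> makes the function total in the sense of the model: a
  value above the cut would escape its quantifiers.\<close>

lemma omega_graph:
  assumes "(\<lambda>n. graph_of (h n)) \<in> D" "g \<in> K" "\<And>n s. h n s \<le> g n"
  shows "omega (\<lambda>n. graph_of (h n)) A \<longleftrightarrow> (\<forall>s\<in>K. \<forall>\<^sub>F n in U. cmem (h n (s n)) (A n))"
proof
  assume om: "omega (\<lambda>n. graph_of (h n)) A"
  show "\<forall>s\<in>K. \<forall>\<^sub>F n in U. cmem (h n (s n)) (A n)"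
  proof
    fix s assume s: "s \<in> K"
    have app: "(\<lambda>n. h n (s n)) \<in> K" using K_app[OF assms(1) s assms(2)] assms(3) by simp
    from om s obtain v where v: "\<forall>\<^sub>F n in U. cmem (v n) (A n)"
      "\<forall>u\<in>K. (\<forall>\<^sub>F n in U. pr (s n) (u n) \<in> graph_of (h n)) \<longleftrightarrow> (\<forall>\<^sub>F n in U. u n = v n)"
      unfolding omega_def by blast
    from v(2)[rule_format, OF app] have "\<forall>\<^sub>F n in U. h n (s n) = v n" by simp
    with v(1) show "\<forall>\<^sub>F n in U. cmem (h n (s n)) (A n)" by eventually_elim simp
  qed
next
  assume *: "\<forall>s\<in>K. \<forall>\<^sub>F n in U. cmem (h n (s n)) (A n)"
  show "omega (\<lambda>n. graph_of (h n)) A"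
    unfolding omega_def
  proof
    fix s assume s: "s \<in> K"
    have "(\<lambda>n. h n (s n)) \<in> K" using K_app[OF assms(1) s assms(2)] assms(3) by simp
    then show "\<exists>v\<in>K. (\<forall>\<^sub>F n in U. cmem (v n) (A n)) \<and>
        (\<forall>u\<in>K. (\<forall>\<^sub>F n in U. pr (s n) (u n) \<in> graph_of (h n)) \<longleftrightarrow> (\<forall>\<^sub>F n in U. u n = v n))"
      using * s by (intro bexI[of _ "\<lambda>n. h n (s n)"]) auto
  qed
qed

lemma omega_colour:
  assumes "(\<lambda>n. graph_of (\<lambda>s. colour n (p n s))) \<in> D"
  shows "omega (\<lambda>n. graph_of (\<lambda>s. colour n (p n s))) A \<longleftrightarrow>
    (\<forall>s\<in>K. \<forall>\<^sub>F n in U. cmem (colour n (p n (s n))) (A n))"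
  using omega_graph[OF assms K_Suc[OF K_id]] colour(2) by simp

lemma omega_unique:
  assumes "omega Y Q" "x \<in> K" "q \<in> K" "r \<in> K"
    "\<forall>\<^sub>F n in U. pr (x n) (q n) \<in> Y n" "\<forall>\<^sub>F n in U. pr (x n) (r n) \<in> Y n"
  shows "\<forall>\<^sub>F n in U. q n = r n"
proof -
  obtain v where v: "\<forall>u\<in>K. (\<forall>\<^sub>F n in U. pr (x n) (u n) \<in> Y n) \<longleftrightarrow> (\<forall>\<^sub>F n in U. u n = v n)"
    using assms(1,2) unfolding omega_def by blast
  have "\<forall>\<^sub>F n in U. q n = v n" "\<forall>\<^sub>F n in U. r n = v n" using v assms(3-) by blast+
  then show ?thesis by eventually_elim simp
qed

text \<open>
  In an accepting run the guessed index could only change at a least position, which is a number of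
  the model; so it is constant and the corresponding colour would be unbounded in \<open>K\<close>.
\<close>

lemma nba_rejects_word: "\<not> nba_accepts word"
proof
  assume "nba_accepts word"
  then obtain Y where Y: "Y \<in> D" "omega Y nba_states" and
    trn: "\<And>x. x \<in> K \<Longrightarrow> \<exists>q\<in>K. \<exists>b\<in>K. \<exists>r\<in>K. (\<forall>\<^sub>F n in U. pr (x n) (q n) \<in> Y n) \<and>
      (\<forall>\<^sub>F n in U. pr (x n) (b n) \<in> word n) \<and> (\<forall>\<^sub>F n in U. pr (Suc (x n)) (r n) \<in> Y n) \<and>
      (\<forall>\<^sub>F n in U. cmem (pr (pr (q n) (b n)) (r n)) (nba_delta n))" and
    inf: "\<And>x. x \<in> K \<Longrightarrow> \<exists>x'\<in>K. (\<forall>\<^sub>F n in U. x n < x' n) \<and>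
      (\<exists>q\<in>K. (\<forall>\<^sub>F n in U. pr (x' n) (q n) \<in> Y n) \<and> (\<forall>\<^sub>F n in U. cmem (q n) (nba_final n)))"
    unfolding nba_accepts_def by blast
  note unique = omega_unique[OF Y(2)]
  \<comment> \<open>A final state is odd, so its index is the letter read immediately before, at
    \<open>y n = x' n - 1\<close>.\<close>
  have visit: "\<exists>y\<in>K. \<exists>b\<in>K. (\<forall>\<^sub>F n in U. x n \<le> y n) \<and> (\<forall>\<^sub>F n in U. b n = colour n (y n)) \<and>
      (\<forall>\<^sub>F n in U. pr (Suc (y n)) (2 * b n + 1) \<in> Y n)" if "x \<in> K" for x
  proof -
    from inf[OF that] obtain x' q where x': "x' \<in> K" "\<forall>\<^sub>F n in U. x n < x' n" and
      q: "q \<in> K" "\<forall>\<^sub>F n in U. pr (x' n) (q n) \<in> Y n" "\<forall>\<^sub>F n in U. cmem (q n) (nba_final n)" by blast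
    define y where "y n = x' n - 1" for n
    have y: "y \<in> K" unfolding y_def[abs_def] by (rule K_diff[OF x'(1)]) (use K_Suc[OF K_0] in simp)
    have Sy: "\<forall>\<^sub>F n in U. Suc (y n) = x' n" using x'(2) by eventually_elim (simp add: y_def)
    from trn[OF y] obtain p b r where pbr: "p \<in> K" "b \<in> K" "r \<in> K" "\<forall>\<^sub>F n in U. b n = colour n (y n)"
      "\<forall>\<^sub>F n in U. pr (Suc (y n)) (r n) \<in> Y n" "\<forall>\<^sub>F n in U. cmem (pr (pr (p n) (b n)) (r n)) (nba_delta n)" by auto
    have "\<forall>\<^sub>F n in U. pr (x' n) (r n) \<in> Y n" using pbr(5) Sy by eventually_elim simp
    then have "\<forall>\<^sub>F n in U. q n = r n" by (rule unique[OF x'(1) q(1) pbr(3) q(2)])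
    then have "\<forall>\<^sub>F n in U. pr (Suc (y n)) (2 * b n + 1) \<in> Y n" using q(3) pbr(5,6)
    proof eventually_elim
      case (elim n)
      then have "odd (r n)" "r n div 2 = b n" using nba_transD(2) by (auto simp: cmem_nba_final cmem_nba_delta)
      then have "2 * b n + 1 = r n" by (metis odd_two_times_div_two_succ)
      then show ?case using elim by simp
    qed
    moreover have "\<forall>\<^sub>F n in U. x n \<le> y n" using x'(2) by eventually_elim (simp add: y_def)
    ultimately show ?thesis using y pbr(2,4) by blast
  qed
  obtain y i where y: "y \<in> K" and i: "i \<in> K" "\<forall>\<^sub>F n in U. i n = colour n (y n)"
    "\<forall>\<^sub>F n in U. pr (Suc (y n)) (2 * i n + 1) \<in> Y n" using visit[OF K_0] by blast
  \<comment> \<open>The guessed letter is positive, so states with this index differ from the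
    waiting state, the only one that may change its index.\<close>
  have i1: "\<forall>\<^sub>F n in U. 1 \<le> i n" using i(2) by eventually_elim (metis colour(1))
  have i0: "(\<lambda>n. 2 * i n) \<in> K" "(\<lambda>n. 2 * i n + 1) \<in> K"
    using K_add[OF i(1) i(1)] K_Suc[OF K_add[OF i(1) i(1)]] by (simp_all add: mult_2)
  have index: "\<forall>\<^sub>F n in U. q n div 2 = i n"
    if x: "x \<in> K" and q: "q \<in> K" "\<forall>\<^sub>F n in U. pr (x n) (q n) \<in> Y n" and "\<forall>\<^sub>F n in U. has_index (Y n) (i n) (x n)" for x q
  proof -
    have "(\<forall>\<^sub>F n in U. pr (x n) (2 * i n) \<in> Y n) \<or> (\<forall>\<^sub>F n in U. pr (x n) (2 * i n + 1) \<in> Y n)"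
      using that(4) unfolding has_index_def ultra_disj[OF ultra] .
    then have "(\<forall>\<^sub>F n in U. q n = 2 * i n) \<or> (\<forall>\<^sub>F n in U. q n = 2 * i n + 1)"
      using unique[OF x q(1) i0(1) q(2)] unique[OF x q(1) i0(2) q(2)] by blast
    then show ?thesis by (auto elim: eventually_mono)
  qed
  have index_Suc: "\<forall>\<^sub>F n in U. has_index (Y n) (i n) (Suc (x n))"
    if x: "x \<in> K" and hx: "\<forall>\<^sub>F n in U. has_index (Y n) (i n) (x n)" for x
  proof -
    from trn[OF x] obtain p b r where pbr: "p \<in> K" "\<forall>\<^sub>F n in U. pr (x n) (p n) \<in> Y n"
      "\<forall>\<^sub>F n in U. pr (Suc (x n)) (r n) \<in> Y n" "\<forall>\<^sub>F n in U. cmem (pr (pr (p n) (b n)) (r n)) (nba_delta n)" by blast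
    from index[OF x pbr(1,2) hx] i1 pbr(3,4) show ?thesis
    proof eventually_elim
      case (elim n)
      then have "p n \<noteq> 0" by auto
      with elim have "r n div 2 = i n" using nba_transD(3) by (auto simp: cmem_nba_delta)
      then have "r n = 2 * i n \<or> r n = 2 * i n + 1" by linarith
      then show ?case using elim(3) by (auto simp: has_index_def)
    qed
  qed
  have all: "\<forall>\<^sub>F n in U. has_index (Y n) (i n) (x n)" if x: "x \<in> K" "\<forall>\<^sub>F n in U. Suc (y n) \<le> x n" for x
  proof (rule ccontr)
    assume "\<not> ?thesis"
    then have neg: "\<forall>\<^sub>F n in U. \<not> has_index (Y n) (i n) (x n)" by (simp add: ultra_not[OF ultra])
    define z where "z n = (LEAST z. Suc (y n) \<le> z \<and> has_index (Y n) (i n) z \<and> \<not> has_index (Y n) (i n) (Suc z))" for n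
    have op: "(\<lambda>n e S. LEAST z. e 0 \<le> z \<and> has_index (S 0) (e 1) z \<and> \<not> has_index (S 0) (e 1) (Suc z)) \<in> num_ops"
      by (rule num_opsI)
    have zN: "z \<in> N" unfolding z_def[abs_def]
      using num_op4[OF op K_N[OF K_Suc[OF y]] K_N[OF i(1)] N_0 N_0 Y(1)] by simp
    from neg x(2) i(3)
    have z: "\<forall>\<^sub>F n in U. z n \<le> x n \<and> has_index (Y n) (i n) (z n) \<and> \<not> has_index (Y n) (i n) (Suc (z n))"
    proof eventually_elim
      case (elim n)
      let ?P = "\<lambda>z. Suc (y n) \<le> z \<and> has_index (Y n) (i n) z \<and> \<not> has_index (Y n) (i n) (Suc z)"
      have "\<exists>z\<le>x n. ?P z"
      proof (rule ccontr)
        assume no: "\<not> (\<exists>z\<le>x n. ?P z)"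
        \<comment> \<open>This induction runs over the true naturals at one index; the model itself
          is not asked for it.\<close>
        have "w \<le> x n \<Longrightarrow> has_index (Y n) (i n) w" if "Suc (y n) \<le> w" for w
          using that
        proof (induction w rule: dec_induct)
          case base
          show ?case using elim(3) by (simp add: has_index_def)
        next
          case (step w)
          then show ?case using no by (meson Suc_leD)
        qed
        then show False using elim(1,2) by blast
      qed
      then show ?case using Least_le_bound[of "x n" ?P] LeastI_bound[of "x n" ?P] unfolding z_def by blast
    qed
    have zK: "z \<in> K" by (rule K_down[OF zN x(1)]) (use z in \<open>auto elim: eventually_mono\<close>)
    have "\<forall>\<^sub>F n in U. has_index (Y n) (i n) (z n)" using z by (auto elim: eventually_mono)
    from index_Suc[OF zK this] z have "\<forall>\<^sub>F n in U. False" by eventually_elim simp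
    then show False using ultra by (simp add: ultra_def)
  qed
  obtain j where j: "\<And>x. x \<in> K \<Longrightarrow> \<forall>\<^sub>F n in U. lo j n \<le> x n \<Longrightarrow> \<forall>\<^sub>F n in U. colour n (x n) \<noteq> i n"
    using K_colour_bounded[OF K_N[OF i(1)]] by blast
  have "(\<lambda>n. lo j n + Suc (y n)) \<in> K" by (intro K_add K_Suc lo_K y)
  from visit[OF this] obtain w b where w: "w \<in> K" and b: "b \<in> K"
    and wb: "\<forall>\<^sub>F n in U. lo j n + Suc (y n) \<le> w n" "\<forall>\<^sub>F n in U. b n = colour n (w n)"
      "\<forall>\<^sub>F n in U. pr (Suc (w n)) (2 * b n + 1) \<in> Y n" by blast
  have "(\<lambda>n. 2 * b n + 1) \<in> K" using K_Suc[OF K_add[OF b b]] by (simp add: mult_2)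
  moreover have "\<forall>\<^sub>F n in U. has_index (Y n) (i n) (Suc (w n))"
    by (rule all[OF K_Suc[OF w]]) (use wb(1) in \<open>auto elim: eventually_mono\<close>)
  ultimately have "\<forall>\<^sub>F n in U. (2 * b n + 1) div 2 = i n"
    using index[OF K_Suc[OF w] _ wb(3)] by blast
  moreover have "\<forall>\<^sub>F n in U. colour n (w n) \<noteq> i n"
    by (rule j[OF w]) (use wb(1) in \<open>auto elim: eventually_mono\<close>)
  ultimately have "\<forall>\<^sub>F n in U. False" using wb(2) by eventually_elim simp
  then show False using ultra by (simp add: ultra_def)
qed

text \<open>The letter at \<open>x\<close> returns once per period, so guessing it is right. The
  word and its run are internal sets by closure of \<open>D\<close>, and hence sets of the
  model.\<close>

lemma nba_accepts_loop_word:
  assumes x: "x \<in> K" and z: "z \<in> K" and xz: "\<forall>\<^sub>F n in U. x n < z n"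
  shows "nba_accepts (loop_word x z)"
proof -
  define w where "w n s = colour n (fold_pos (x n) (z n) s)" for n s
  define b where "b n = colour n (x n)" for n
  have b: "b \<in> K" unfolding b_def[abs_def] by (rule colour_K[OF x])
  have W: "(\<lambda>n. graph_of (w n)) \<in> D" using loop_word_D[OF x z] by (simp add: w_def[abs_def])
  have omW: "omega (\<lambda>n. graph_of (w n)) nba_alphabet"
    using omega_graph[OF W K_Suc[OF K_id], of nba_alphabet] colour by (simp add: w_def cmem_nba_alphabet)
  have wK: "(\<lambda>n. w n (s n)) \<in> K" if "s \<in> K" for s
    using K_app[OF W that K_Suc[OF K_id]] colour(2) by (simp add: w_def)
  have YD: "(\<lambda>n. graph_of (nba_run (w n) (b n))) \<in> D"
    using set_op4[OF set_opsI(5) K_N[OF x] K_N[OF z] K_N[OF b] N_0 zero]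
    by (simp add: w_def[abs_def] eval_nat_numeral)
  have b2: "(\<lambda>n. 2 * b n + 1) \<in> K" using K_Suc[OF K_add[OF b b]] by (simp add: mult_2)
  have run_le: "nba_run (w n) (b n) s \<le> 2 * b n + 1" for n s by (simp add: nba_run_def)
  have runK: "(\<lambda>n. nba_run (w n) (b n) (s n)) \<in> K" if "s \<in> K" for s
    using K_app[OF YD that b2] run_le by simp
  have bn: "1 \<le> b n" "b n \<le> Suc n" for n using colour by (simp_all add: b_def)
  have omY: "omega (\<lambda>n. graph_of (nba_run (w n) (b n))) nba_states"
    using omega_graph[OF YD b2, of nba_states] run_le nba_run_less[OF bn(2)] by (simp add: cmem_nba_states)
  have trn: "cmem (pr (pr (nba_run (w n) (b n) s) (w n s)) (nba_run (w n) (b n) (Suc s))) (nba_delta n)" for n s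
    unfolding cmem_nba_delta by (rule nba_run_trans[OF bn]) (use colour in \<open>simp add: w_def\<close>)
  have inf: "\<exists>x'\<in>K. (\<forall>\<^sub>F n in U. y n < x' n) \<and>
      (\<exists>q\<in>K. (\<forall>\<^sub>F n in U. q n = nba_run (w n) (b n) (x' n)) \<and> (\<forall>\<^sub>F n in U. cmem (q n) (nba_final n)))"
    if y: "y \<in> K" for y
  \<comment> \<open>The position folds to \<open>x\<close> after \<open>Suc (y n)\<close> rounds;
    the outer \<open>Suc\<close> is there because the odd state follows the letter.\<close>
  proof (rule bexI[of _ "\<lambda>n. Suc (x n + (z n - x n) * Suc (y n))"], rule conjI,
      rule_tac[2] bexI[of _ "\<lambda>n. 2 * b n + 1"], rule_tac[2] conjI)
    show "\<forall>\<^sub>F n in U. y n < Suc (x n + (z n - x n) * Suc (y n))"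
      using xz by eventually_elim (intro less_SucI loop_progress)
    show "\<forall>\<^sub>F n in U. 2 * b n + 1 = nba_run (w n) (b n) (Suc (x n + (z n - x n) * Suc (y n)))"
      by (simp add: nba_run_def w_def b_def fold_pos_loop del: mult_Suc_right)
    have "2 * b n + 1 < 2 * n + 4" for n using bn(2)[of n] by linarith
    then show "\<forall>\<^sub>F n in U. cmem (2 * b n + 1) (nba_final n)" by (simp add: cmem_nba_final)
  qed (intro K_Suc K_add K_mult K_diff x z y b2)+
  have "nba_accepts (\<lambda>n. graph_of (w n))"
    unfolding nba_accepts_def
  proof (intro conjI omW bexI[OF _ YD] omY ballI)
    show "\<forall>\<^sub>F n in U. pr 0 0 \<in> graph_of (nba_run (w n) (b n))" by (simp add: nba_run_def)
    fix s assume s: "s \<in> K"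
    show "\<exists>q\<in>K. \<exists>c\<in>K. \<exists>r\<in>K. (\<forall>\<^sub>F n in U. pr (s n) (q n) \<in> graph_of (nba_run (w n) (b n))) \<and>
        (\<forall>\<^sub>F n in U. pr (s n) (c n) \<in> graph_of (w n)) \<and>
        (\<forall>\<^sub>F n in U. pr (Suc (s n)) (r n) \<in> graph_of (nba_run (w n) (b n))) \<and>
        (\<forall>\<^sub>F n in U. cmem (pr (pr (q n) (c n)) (r n)) (nba_delta n))"
      by (rule bexI[OF _ runK[OF s]], rule bexI[OF _ wK[OF s]], rule bexI[OF _ runK[OF K_Suc[OF s]]])
        (simp add: trn)
    show "\<exists>x'\<in>K. (\<forall>\<^sub>F n in U. s n < x' n) \<and>
      (\<exists>q\<in>K. (\<forall>\<^sub>F n in U. pr (x' n) (q n) \<in> graph_of (nba_run (w n) (b n))) \<and> (\<forall>\<^sub>F n in U. cmem (q n) (nba_final n)))"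
      using inf[OF s] by simp
  qed
  then show ?thesis by (simp add: w_def[abs_def])
qed

text \<open>
  If the word is not over the alphabet of the parity automaton, one loops a forbidden letter.
\<close>

lemma dpa_rejects_loop_word:
  assumes comps: "A \<in> K" "Q \<in> K" "T \<in> K" "q0 \<in> K" "c \<in> K"
    and ok: "\<forall>\<^sub>F n in U. trans_ok (A n) (Q n) (T n)" "\<forall>\<^sub>F n in U. det_ok (A n) (Q n) (T n)"
    and rej: "\<not> dpa_accepts A Q T q0 c word"
  shows "\<exists>x\<in>K. \<exists>z\<in>K. (\<forall>\<^sub>F n in U. x n < z n) \<and> \<not> dpa_accepts A Q T q0 c (loop_word x z)"
proof (cases "omega word A")
  case False
  then obtain s where s: "s \<in> K" "\<not> (\<forall>\<^sub>F n in U. cmem (colour n (s n)) (A n))"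
    using omega_colour[of "\<lambda>_ s. s" A] word_D by auto
  \<comment> \<open>A loop of length one repeats the forbidden letter at \<open>s\<close>
    forever.\<close>
  define z where "z n = Suc (s n)" for n
  have z: "z \<in> K" unfolding z_def[abs_def] by (rule K_Suc[OF s(1)])
  have "\<not> omega (loop_word s z) A"
    using omega_colour[OF loop_word_D[OF s(1) z], of A] s by (auto simp: z_def fold_pos_def)
  then show ?thesis using s(1) z by (intro bexI[of _ s] bexI[of _ z]) (auto simp: dpa_accepts_def z_def)
next
  case True
  with rej obtain q x0 where q: "q \<in> K" "\<forall>\<^sub>F n in U. cmem (q n) (Q n)"
    and inf: "\<And>x. x \<in> K \<Longrightarrow> \<exists>x'\<in>K. (\<forall>\<^sub>F n in U. x n < x' n) \<and> (\<forall>\<^sub>F n in U. runs (word n) (T n) (q0 n) (x' n) (q n))"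
    and x0: "x0 \<in> K"
    and ev: "\<And>x. x \<in> K \<Longrightarrow> \<forall>\<^sub>F n in U. x0 n < x n \<Longrightarrow> \<exists>q'\<in>K. \<exists>k'\<in>K. \<exists>k\<in>K.
       (\<forall>\<^sub>F n in U. runs (word n) (T n) (q0 n) (x n) (q' n)) \<and> (\<forall>\<^sub>F n in U. cmem (pr (q' n) (k' n)) (c n)) \<and>
       (\<forall>\<^sub>F n in U. cmem (pr (q n) (k n)) (c n)) \<and>
       ((\<forall>\<^sub>F n in U. k n < k' n) \<or> (\<forall>\<^sub>F n in U. k n = k' n))"
    and odd: "\<not> (\<exists>k\<in>K. (\<forall>\<^sub>F n in U. cmem (pr (q n) (k n)) (c n)) \<and> (\<exists>h\<in>K. \<forall>\<^sub>F n in U. k n = h n + h n))"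
    unfolding dpa_accepts_def by blast
  \<comment> \<open>The loop begins beyond \<open>x0\<close>, so the colour of \<open>q\<close> is
    minimal throughout it, and both of its ends are visits of \<open>q\<close>.\<close>
  obtain x where x: "x \<in> K" "\<forall>\<^sub>F n in U. x0 n < x n" "\<forall>\<^sub>F n in U. runs (word n) (T n) (q0 n) (x n) (q n)"
    using inf[OF x0] by blast
  obtain z where z: "z \<in> K" "\<forall>\<^sub>F n in U. x n < z n" "\<forall>\<^sub>F n in U. runs (word n) (T n) (q0 n) (z n) (q n)"
    using inf[OF x(1)] by blast
  have loop: "\<forall>\<^sub>F n in U. runs (loop_word x z n) (T n) (q0 n) (y n) (q' n)"
    if "\<forall>\<^sub>F n in U. runs (word n) (T n) (q0 n) (fold_pos (x n) (z n) (y n)) (q' n)" for y q'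
    using ok x(3) z(2,3) that by eventually_elim (rule loop_runs)
  have inf': "\<exists>x'\<in>K. (\<forall>\<^sub>F n in U. y n < x' n) \<and> (\<forall>\<^sub>F n in U. runs (loop_word x z n) (T n) (q0 n) (x' n) (q n))"
    if y: "y \<in> K" for y
  proof (intro bexI[of _ "\<lambda>n. x n + (z n - x n) * Suc (y n)"] conjI)
    show "\<forall>\<^sub>F n in U. y n < x n + (z n - x n) * Suc (y n)"
      using z(2) by eventually_elim (rule loop_progress)
    show "\<forall>\<^sub>F n in U. runs (loop_word x z n) (T n) (q0 n) (x n + (z n - x n) * Suc (y n)) (q n)"
      by (rule loop) (simp only: fold_pos_loop x(3))
  qed (intro K_add K_mult K_diff K_Suc x(1) z(1) y)
  have ev': "\<exists>q'\<in>K. \<exists>k'\<in>K. \<exists>k\<in>K.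
       (\<forall>\<^sub>F n in U. runs (loop_word x z n) (T n) (q0 n) (y n) (q' n)) \<and> (\<forall>\<^sub>F n in U. cmem (pr (q' n) (k' n)) (c n)) \<and>
       (\<forall>\<^sub>F n in U. cmem (pr (q n) (k n)) (c n)) \<and>
       ((\<forall>\<^sub>F n in U. k n < k' n) \<or> (\<forall>\<^sub>F n in U. k n = k' n))"
    if y: "y \<in> K" "\<forall>\<^sub>F n in U. x n < y n" for y
  proof -
    \<comment> \<open>Folding a position beyond \<open>x\<close> never leads back before
      \<open>x\<close>, so it stays beyond \<open>x0\<close>.\<close>
    have "\<forall>\<^sub>F n in U. x0 n < fold_pos (x n) (z n) (y n)"
      using x(2) y(2) by eventually_elim (meson fold_pos_ge less_imp_le less_le_trans)
    from ev[OF fold_pos_K[OF x(1) z(1) y(1)] this] show ?thesis using loop by blast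
  qed
  have "\<not> dpa_accepts A Q T q0 c (loop_word x z)"
    unfolding dpa_accepts_def using q odd inf' ev' x(1) by blast
  then show ?thesis using x(1) z(1,2) by blast
qed

lemma not_sat_McNaughton_minus:
  assumes env: "\<And>i. e i \<in> K" "\<And>i. S i \<in> D"
  shows "\<not> sat e S (McNaughton_minus d)"
proof
  assume "sat e S (McNaughton_minus d)"
  moreover have "sat (case_nat nba e) S (is_NBA (Var 0))"
    by (rule sat_is_NBA) (use env nba_K in simp_all)
  ultimately obtain \<beta> where \<beta>: "\<beta> \<in> K" "sat (case_nat \<beta> (case_nat nba e)) S (is_DPA (Var 0))"
    "\<And>W. W \<in> D \<Longrightarrow> sat (case_nat \<beta> (case_nat nba e)) (case_nat W S) (NBA_accepts 0 (Var 1)) \<longleftrightarrow>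
      sat (case_nat \<beta> (case_nat nba e)) (case_nat W S) (DPA_accepts 0 (Var 0))"
    using nba_K(1) by (auto simp: McNaughton_minus_def)
  have env': "case_nat \<beta> (case_nat nba e) i \<in> K" for i using env \<beta>(1) nba_K(1) by simp
  obtain A Q T q0 c where comps: "A \<in> K" "Q \<in> K" "T \<in> K" "q0 \<in> K" "c \<in> K"
    "\<forall>\<^sub>F n in U. evs (case_nat \<beta> (case_nat nba e)) (Var 0) n = pr (A n) (pr (Q n) (pr (T n) (pr (q0 n) (c n))))"
    and ok: "\<forall>\<^sub>F n in U. trans_ok (A n) (Q n) (T n)" "\<forall>\<^sub>F n in U. det_ok (A n) (Q n) (T n)"
    by (rule sat_is_DPA[OF env' env(2) \<beta>(2)])
  have eq: "nba_accepts W \<longleftrightarrow> dpa_accepts A Q T q0 c W" if W: "W \<in> D" for W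
  proof -
    have S': "case_nat W S i \<in> D" for i using W env(2) by simp
    show ?thesis
      using \<beta>(3)[OF W] sat_NBA_accepts[OF env' S', where a = "Var 1" and X = 0]
        sat_DPA_accepts[OF env' S' comps, where X = 0]
      by simp
  qed
  have "\<not> dpa_accepts A Q T q0 c word" using eq[OF word_D] nba_rejects_word by simp
  from dpa_rejects_loop_word[OF comps(1-5) ok this]
  obtain x z where xz: "x \<in> K" "z \<in> K" "\<forall>\<^sub>F n in U. x n < z n" "\<not> dpa_accepts A Q T q0 c (loop_word x z)"
    by blast
  then show False using eq[OF loop_word_D[OF xz(1,2)]] nba_accepts_loop_word[OF xz(1-3)] by simp
qed

end

lemma ex_generic_cut: "\<exists>U D \<rho>. generic_cut U D \<rho>"
proof -
  obtain U :: "nat filter" where U: "ultra U" "\<And>P. eventually P U \<Longrightarrow> infinite {n. P n}"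
    using ex_free_ultrafilter[where 'a = nat] by auto
  have large: "\<forall>\<^sub>F n in U. i < n" for i
  proof (rule ccontr)
    assume "\<not> ?thesis"
    then have "\<forall>\<^sub>F n in U. \<not> i < n" by (simp add: ultra_not[OF U(1)])
    from U(2)[OF this] show False by (simp add: not_less)
  qed
  obtain D where D: "countable D" "\<And>F. F \<in> ops \<Longrightarrow> closed_under D F"
    "\<And>F. F \<in> ops \<Longrightarrow> (\<lambda>n. F n (\<lambda>_. 0) (\<lambda>_. {})) \<in> D"
    using ex_countable_closed[OF countable_ops finite_support_ops] by blast
  have "(\<lambda>n e S. {val e Zero}) \<in> ops"
    unfolding ops_def by (rule UnI2, rule image_eqI[OF _ num_opsI(1)[of Zero]]) simp
  from D(3)[OF this] have zero: "(\<lambda>n. {0}) \<in> D" by simp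
  define C where "C = D \<times> {h. (\<lambda>n. {h n}) \<in> D}"
  have "inj (\<lambda>h n. {h n :: nat})" by (auto simp: inj_def fun_eq_iff)
  then have "countable {h. (\<lambda>n. {h n}) \<in> D}"
    using countable_image_inj_Int_vimage[of "\<lambda>h n. {h n}" UNIV D] D(1) by (simp add: vimage_def)
  then have C: "countable C" using D(1) by (simp add: C_def)
  have ne: "C \<noteq> {}" using zero by (auto simp: C_def)
  \<comment> \<open>Only the first component of the decoded pair is used; the second makes each
    requirement return at arbitrarily late stages.\<close>
  define \<rho> where "\<rho> i = from_nat_into C (fst (prod_decode i))" for i
  have mem: "\<rho> i \<in> C" for i by (simp add: \<rho>_def from_nat_into[OF ne])
  have "generic_cut U D \<rho>"
  proof
    fix W c and j :: nat assume "W \<in> D" "(\<lambda>n. {c n}) \<in> D"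
    then have "(W, c) \<in> C" by (simp add: C_def)
    then obtain k where k: "from_nat_into C k = (W, c)" using C from_nat_into_surj by metis
    have "\<rho> (prod_encode (k, j)) = (W, c)" by (simp add: \<rho>_def k)
    then show "\<exists>i\<ge>j. \<rho> i = (W, c)" using le_prod_encode_2 by blast
  qed (use U large D zero mem in \<open>auto simp: C_def mem_Times_iff\<close>)
  then show ?thesis by blast
qed

theorem theorem9p5:
  fixes d :: primrec_def
  assumes "has_arity d 1"
  shows "\<not> (RCA0 \<turnstile> McNaughton_minus d)"
proof
  assume prov: "RCA0 \<turnstile> McNaughton_minus d"
  obtain U D \<rho> where "generic_cut U D \<rho>" using ex_generic_cut by blast
  then interpret generic_cut U D \<rho> .
  show False
    using sat_provable[OF prov, of "\<lambda>_ _. 0" "\<lambda>_ _. {0}"]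
      not_sat_McNaughton_minus[of "\<lambda>_ _. 0" "\<lambda>_ _. {0}" d] K_0 zero by blast
qed

end
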